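(* Let $n\ge 1$, let $S\subset\mathbb{R}^n$ be a nonempty bounded set, let $\tilde B$ be a ball centered at the origin with $S\subset\tilde B$, and let $B=\tilde B^{1}=\{t\in\mathbb{R}^n:\operatorname{dist}(t,\tilde B)\le 1\}$. Let $\mathcal{X}=\{X(t):t\in\mathbb{R}^n\}$ be a real-valued random field such that: (i) $\mathcal{X}$ is Gaussian, centered and stationary; (ii) the paths of $\mathcal{X}$ are of class $\mathcal{C}^3$; (iii) for all $s\neq t$ in $B$, the random vector $(X(s),X(t),X'(s),X'(t))$ has a non-degenerate distribution; (iv) for all $\lambda$ in the unit sphere $S^{n-1}$ of $\mathbb{R}^n$, the random vector $(X(0),X'(0),X''(0)\lambda)$ has a non-degenerate distribution; (v) for every $t$, $\operatorname{Var}(X(t))=1$ and $\operatorname{Var}(X'(t))=I_n$ (the $n\times n$ identity matrix). Let $M_S=\sup\{X(t):t\in S\}$. Then: 1. If $S$ is Minkowski measurable in the strong sense, with dimension $d$ and content $C$, then, as $u\to+\infty$, $$\mathbb{P}(M_S>u)\simeq \frac{C}{2^{d/2}\pi^{n/2}}\,\Gamma\big(1+(n-d)/2\big)\,u^{d-1}\varphi(u).$$ 2. If $S$ is Minkowski measurable in the weak sense, with dimension $d$, then, as $u\to+\infty$, $$\mathbb{P}(M_S>u)\sim u^{d-1}\varphi(u).$$ 3. If the Minkowski dimension $d$ of $S$ is well-defined, then, as $u\to+\infty$, $$\log\mathbb{P}(M_S>u)=-\frac12u^2+(d-1+o(1))\log u.$$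
   Context: $X'(t)$ and $X''(t)$ denote the gradient and the Hessian matrix of $X$ at $t$; $\varphi(u)=(2\pi)^{-1/2}e^{-u^2/2}$ is the standard normal density; in item 1, $\Gamma$ is Euler's Gamma function; $\lambda_n$ is Lebesgue measure on $\mathbb{R}^n$; $\operatorname{dist}$ is Euclidean distance. For $f,g$ real-valued functions of one real variable and $x_0\in\mathbb{R}\cup\{\pm\infty\}$: $f\simeq g$ as $x\to x_0$ means $\lim_{x\to x_0}f(x)/g(x)=1$; $f\sim g$ as $x\to x_0$ means that there is a constant $c>0$ with $1/c\le f(x)/g(x)\le c$ for all $x\ne x_0$ in some neighborhood of $x_0$. For $S\subset\mathbb{R}^n$ and $\epsilon>0$, $S^\epsilon=\{t\in\mathbb{R}^n:\operatorname{dist}(t,S)\le\epsilon\}$. The set $S$ is Minkowski measurable in the strong sense, with Minkowski dimension $d$ and content $C$, if $\lambda_n(S^\epsilon)\simeq C\epsilon^{n-d}$ as $\epsilon\to0$ (so $0<C<\infty$). It is Minkowski measurable in the weak sense, with Minkowski dimension $d$, if $\lambda_n(S^\epsilon)\sim\epsilon^{n-d}$ as $\epsilon\to0$. More generally, the Minkowski dimension of $S$ is $d=n-\lim_{\epsilon\to0}\frac{\log\lambda_n(S^\epsilon)}{\log\epsilon}$, whenever the limit exists (it is then said to be well-defined). *)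

theory Defs
  imports "HOL-Probability.Probability" "HOL-Library.Landau_Symbols"
begin

(* The relation f ~ g (comparable up to constants); the relation f/g -> 1 is the library
   relation asymp_equiv. *)
definition same_order :: "'b filter \<Rightarrow> ('b \<Rightarrow> real) \<Rightarrow> ('b \<Rightarrow> real) \<Rightarrow> bool" where
  "same_order F f g \<longleftrightarrow> (\<exists>c>0. \<forall>\<^sub>F x in F. 1 / c \<le> f x / g x \<and> f x / g x \<le> c)"

(* infdist t {} = 0, so this is meaningful for nonempty S only. *)
definition tube :: "real \<Rightarrow> (real^'n) set \<Rightarrow> (real^'n) set" where
  "tube \<epsilon> S = {t. infdist t S \<le> \<epsilon>}"

definition minkowski_measurable_strong :: "(real^'n) set \<Rightarrow> real \<Rightarrow> real \<Rightarrow> bool" where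
  "minkowski_measurable_strong S d C \<longleftrightarrow> 0 < C \<and>
     (\<lambda>\<epsilon>. measure lebesgue (tube \<epsilon> S)) \<sim>[at_right 0] (\<lambda>\<epsilon>. C * \<epsilon> powr (real CARD('n) - d))"

definition minkowski_measurable_weak :: "(real^'n) set \<Rightarrow> real \<Rightarrow> bool" where
  "minkowski_measurable_weak S d \<longleftrightarrow>
     same_order (at_right 0) (\<lambda>\<epsilon>. measure lebesgue (tube \<epsilon> S)) (\<lambda>\<epsilon>. \<epsilon> powr (real CARD('n) - d))"

definition has_minkowski_dim :: "(real^'n) set \<Rightarrow> real \<Rightarrow> bool" where
  "has_minkowski_dim S d \<longleftrightarrow>
     (\<exists>L. ((\<lambda>\<epsilon>. ln (measure lebesgue (tube \<epsilon> S)) / ln \<epsilon>) \<longlongrightarrow> L) (at_right 0) \<and>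
          d = real CARD('n) - L)"

(* The derivative is handled through its values in fixed directions, so that the recursion stays
   within real-valued functions. *)
primrec class_C :: "nat \<Rightarrow> (real^'n \<Rightarrow> real) \<Rightarrow> bool" where
  "class_C 0 f \<longleftrightarrow> continuous_on UNIV f"
| "class_C (Suc k) f \<longleftrightarrow>
     f differentiable_on UNIV \<and> (\<forall>v. class_C k (\<lambda>t. frechet_derivative f (at t) v))"

definition gradient :: "(real^'n \<Rightarrow> real) \<Rightarrow> real^'n \<Rightarrow> real^'n" where
  "gradient f t = (\<chi> i. frechet_derivative f (at t) (axis i 1))"

definition hessian :: "(real^'n \<Rightarrow> real) \<Rightarrow> real^'n \<Rightarrow> real^'n^'n" where
  "hessian f t = jacobian (gradient f) (at t)"

(* One-dimensional Gaussian laws include the Dirac measures (sigma = 0). *)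
definition gaussian_rv :: "'w measure \<Rightarrow> ('w \<Rightarrow> real) \<Rightarrow> bool" where
  "gaussian_rv M Y \<longleftrightarrow> Y \<in> borel_measurable M \<and>
     (\<exists>\<mu> \<sigma>. 0 \<le> \<sigma> \<and> distr M borel Y =
        (if \<sigma> = 0 then return borel \<mu> else density lborel (\<lambda>x. ennreal (normal_density \<mu> \<sigma> x))))"

definition gaussian_field :: "'w measure \<Rightarrow> (real^'n \<Rightarrow> 'w \<Rightarrow> real) \<Rightarrow> bool" where
  "gaussian_field M X \<longleftrightarrow>
     (\<forall>T a. finite T \<longrightarrow> gaussian_rv M (\<lambda>\<omega>. \<Sum>t\<in>T. a t * X t \<omega>))"

definition centered_field :: "'w measure \<Rightarrow> (real^'n \<Rightarrow> 'w \<Rightarrow> real) \<Rightarrow> bool" where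
  "centered_field M X \<longleftrightarrow> (\<forall>t. integrable M (X t) \<and> (\<integral>\<omega>. X t \<omega> \<partial>M) = 0)"

definition stationary_field :: "'w measure \<Rightarrow> (real^'n \<Rightarrow> 'w \<Rightarrow> real) \<Rightarrow> bool" where
  "stationary_field M X \<longleftrightarrow>
     (\<forall>T h. finite T \<longrightarrow>
        distr M (\<Pi>\<^sub>M t\<in>T. borel) (\<lambda>\<omega>. \<lambda>t\<in>T. X (t + h) \<omega>) =
        distr M (\<Pi>\<^sub>M t\<in>T. borel) (\<lambda>\<omega>. \<lambda>t\<in>T. X t \<omega>))"

(* The law of Y is not carried by a proper affine subspace; for a Gaussian vector this says that
   its variance matrix is nonsingular. *)
definition nondegenerate_distr :: "'w measure \<Rightarrow> ('w \<Rightarrow> 'v::euclidean_space) \<Rightarrow> bool" where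
  "nondegenerate_distr M Y \<longleftrightarrow>
     \<not> (\<exists>H. affine H \<and> H \<noteq> UNIV \<and> (AE y in distr M borel Y. y \<in> H))"

definition variance_matrix :: "'w measure \<Rightarrow> ('w \<Rightarrow> real^'n) \<Rightarrow> real^'n^'n" where
  "variance_matrix M Y =
     (\<chi> i j. \<integral>\<omega>. (Y \<omega> $ i - (\<integral>\<omega>'. Y \<omega>' $ i \<partial>M)) * (Y \<omega> $ j - (\<integral>\<omega>'. Y \<omega>' $ j \<partial>M)) \<partial>M)"

end

theory Submission
  imports Defs "HOL-Real_Asymp.Real_Asymp"
begin

text \<open>Why the theorem holds. Let \<open>n\<close> be the dimension. Given that the field is large at \<open>t\<close>, say of height about \<open>u\<close>,
its Hessian there is close to \<open>- u I\<close>: the covariance of \<open>X\<close> with its second derivatives is \<open>- I\<close>, and the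
residual is independent of \<open>X t\<close>. So above the level \<open>u\<close> the field is, up to a relative error \<open>\<epsilon>\<close>, a single
paraboloid with a peak at some \<open>t0\<close>, and \<open>sup X > u\<close> on \<open>S\<close> means that \<open>t0\<close> lies within
\<open>sqrt (2 (X t0 - u) / u)\<close> of \<open>S\<close>.

Peaks are counted through volumes. Near the peak the gradient is \<open>- u (t - t0)\<close>, so the set where every
partial derivative is at most \<open>\<rho>\<close> in absolute value is almost a cube of side \<open>2 \<rho> / u\<close> around \<open>t0\<close>. Intersect this
set with the points \<open>t\<close> whose distance to \<open>S\<close> is at most the radius belonging to the height \<open>X t\<close>. The volume of the
intersection is about \<open>(2 \<rho> / u)^n\<close> when the supremum exceeds \<open>u\<close>, and zero otherwise. Its expectation is
exact by Fubini, because \<open>X t\<close> and the partial derivatives at \<open>t\<close> are independent standard normal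
variables (lemma \<open>expected_volume\<close>): it is a one-dimensional integral of tube volumes against the normal density.
The substitution \<open>x = u + p / u\<close> turns that integral into
\<open>u^(n-1) \<phi>(u)\<close> times the integral of \<open>exp (- p)\<close> times the volume of the tube of radius \<open>sqrt (2 p) / u\<close>.

Two facts make this rigorous. The parabolic picture fails only with probability
\<open>O (exp (- (1/2 + c) u^2))\<close> for some \<open>c > 0\<close>, which is negligible against \<open>\<phi>(u)\<close>
(theorem \<open>parabolic_peaks_overwhelming\<close>): the comparison takes place on a finite grid, where it is a tail bound for
single Gaussian variables, and Fernique's theorem controls the oscillation of the path and of its second
derivatives between grid points. Two distant peaks are excluded because \<open>X s + X t\<close> has variance below \<open>4\<close> for distinct
\<open>s\<close> and \<open>t\<close>. Secondly, tube volumes grow at most polynomially, \<open>V (l e) \<le> (6 + l)^n V e\<close>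
(theorem \<open>tube_doubling\<close>), so the integral is comparable with \<open>V (1 / u)\<close> for every bounded set.

Hence the tail is of the order of \<open>u^(n-1) \<phi>(u) V (1 / u)\<close> (theorem \<open>ratio_bounded\<close>); this yields the
statement on weakly measurable sets and the logarithmic one. If \<open>V e\<close> is asymptotic to \<open>C e^m\<close> with
\<open>m = n - d\<close>, dominated convergence as \<open>u\<close> tends to infinity and then \<open>\<epsilon>\<close> to zero gives
the integral of \<open>exp (- p) (2 p)^(m/2)\<close>, a value of the Gamma function (theorem \<open>ratio_tendsto\<close>).\<close>

section \<open>Joint characteristic functions determine the probabilities of rectangles\<close>

text \<open>The value of the transform at \<open>0\<close> is the total mass, so both measures can be rescaled to
probability measures by the same factor and Levy's uniqueness theorem applies.\<close>

lemma finite_measure_eq_if_char_eq: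
  fixes \<mu> \<nu> :: "real measure"
  assumes \<mu>: "finite_measure \<mu>" "sets \<mu> = sets borel"
    and \<nu>: "finite_measure \<nu>" "sets \<nu> = sets borel"
    and eq: "\<And>t. (CLINT x|\<mu>. iexp (t * x)) = (CLINT x|\<nu>. iexp (t * x))"
  shows "\<mu> = \<nu>"
proof -
  interpret \<mu>: finite_measure \<mu> by fact
  interpret \<nu>: finite_measure \<nu> by fact
  have sp: "space \<mu> = UNIV" "space \<nu> = UNIV"
    using sets_eq_imp_space_eq[OF \<mu>(2)] sets_eq_imp_space_eq[OF \<nu>(2)] by auto
  define c where "c = measure \<mu> UNIV"
  have c: "c = measure \<nu> UNIV"
    using eq[of 0] sp unfolding c_def by simp
  show ?thesis
  proof (cases "c = 0")
    case True
    have "emeasure \<mu> A = emeasure \<nu> A" if A: "A \<in> sets \<mu>" for A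
    proof -
      have "measure \<mu> A = 0" "measure \<nu> A = 0"
        using \<mu>.bounded_measure[of A] \<nu>.bounded_measure[of A] sp True c
        by (simp_all add: c_def measure_le_0_iff)
      then show ?thesis by (simp add: \<mu>.emeasure_eq_measure \<nu>.emeasure_eq_measure)
    qed
    then show ?thesis by (intro measure_eqI) (use assms in auto)
  next
    case False
    then have cpos: "c > 0" by (simp add: c_def zero_less_measure_iff)
    define M where "M = (\<lambda>\<rho>::real measure. density \<rho> (\<lambda>_. ennreal (1 / c)))"
    have em: "emeasure (M \<rho>) A = ennreal (1 / c) * emeasure \<rho> A" if "A \<in> sets \<rho>" for \<rho> A
      unfolding M_def using that by (simp add: emeasure_density_const)
    have rd: "real_distribution (M \<rho>)" if "finite_measure \<rho>" "sets \<rho> = sets borel" "measure \<rho> UNIV = c" for \<rho>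
    proof -
      interpret finite_measure \<rho> by fact
      have s: "space \<rho> = UNIV" using sets_eq_imp_space_eq[OF that(2)] by simp
      have "prob_space (M \<rho>)"
      proof
        have "emeasure (M \<rho>) (space (M \<rho>)) = ennreal (1 / c) * emeasure \<rho> UNIV"
          using em[of UNIV \<rho>] that s by (simp add: M_def)
        also have "\<dots> = ennreal (1 / c) * ennreal c" by (simp add: emeasure_eq_measure that(3))
        also have "\<dots> = 1" using cpos by (simp flip: ennreal_mult)
        finally show "emeasure (M \<rho>) (space (M \<rho>)) = 1" .
      qed
      then show ?thesis
        unfolding real_distribution_def real_distribution_axioms_def using that by (simp add: M_def)
    qed
    have ch: "char (M \<rho>) t = (1 / c) *\<^sub>R (CLINT x|\<rho>. iexp (t * x))" if "sets \<rho> = sets borel" for \<rho> t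
    proof -
      have [measurable_cong]: "sets \<rho> = sets borel" by fact
      show ?thesis unfolding char_def M_def
        using cpos by (subst integral_density) (auto simp: scaleR_conv_of_real)
    qed
    have "M \<mu> = M \<nu>"
      using eq ch[OF \<mu>(2)] ch[OF \<nu>(2)] rd[OF \<mu>] rd[OF \<nu>] c
      by (intro Levy_uniqueness) (auto simp: c_def fun_eq_iff)
    then have eq1: "ennreal (1 / c) * emeasure \<mu> A = ennreal (1 / c) * emeasure \<nu> A" if "A \<in> sets borel" for A
      using em[of A \<mu>] em[of A \<nu>] that \<mu>(2) \<nu>(2) by simp
    have "emeasure \<mu> A = emeasure \<nu> A" if A: "A \<in> sets \<mu>" for A
      using eq1[of A] A \<mu>(2) cpos by (simp add: ennreal_mult_cancel_left)
    then show ?thesis by (intro measure_eqI) (use assms in auto)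
  qed
qed

lemma cos_shift_iexp:
  "complex_of_real (1 + cos (w + \<theta>)) * iexp y =
     iexp y + (iexp \<theta> / 2) * iexp (y + w) + (iexp (-\<theta>) / 2) * iexp (y - w)"
  by (simp add: cos_add sin_add cos_diff sin_diff complex_eq_iff exp_eq_polar cis.ctr field_simps)

lemma (in finite_measure) integral_weighted_iexp:
  assumes [measurable]: "W \<in> borel_measurable M" "V \<in> borel_measurable M"
  shows "(CLINT \<omega>|M. (1 + cos (W \<omega> + \<theta>)) *\<^sub>R iexp (V \<omega>)) =
    (CLINT \<omega>|M. iexp (V \<omega>)) + (iexp \<theta> / 2) * (CLINT \<omega>|M. iexp (V \<omega> + W \<omega>))
      + (iexp (-\<theta>) / 2) * (CLINT \<omega>|M. iexp (V \<omega> - W \<omega>))"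
proof -
  have int: "integrable M (\<lambda>\<omega>. iexp (U \<omega>))" if [measurable]: "U \<in> borel_measurable M" for U
    by (rule integrable_const_bound[of _ 1]) (auto)
  have i3: "integrable M (\<lambda>\<omega>. iexp (V \<omega>))" "integrable M (\<lambda>\<omega>. iexp (V \<omega> + W \<omega>))"
     "integrable M (\<lambda>\<omega>. iexp (V \<omega> - W \<omega>))"
    by (intro int; measurable)+
  have "(CLINT \<omega>|M. (1 + cos (W \<omega> + \<theta>)) *\<^sub>R iexp (V \<omega>)) =
     (CLINT \<omega>|M. iexp (V \<omega>) + (iexp \<theta> / 2) * iexp (V \<omega> + W \<omega>) + (iexp (-\<theta>) / 2) * iexp (V \<omega> - W \<omega>))"
    by (simp only: scaleR_conv_of_real cos_shift_iexp)
  also have "\<dots> = (CLINT \<omega>|M. iexp (V \<omega>)) + (CLINT \<omega>|M. (iexp \<theta> / 2) * iexp (V \<omega> + W \<omega>))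
      + (CLINT \<omega>|M. (iexp (-\<theta>) / 2) * iexp (V \<omega> - W \<omega>))"
    using i3 by (subst Bochner_Integration.integral_add; (intro Bochner_Integration.integrable_add integrable_mult_right)?; simp?)+
  finally show ?thesis by (simp only: integral_mult_right_zero)
qed

text \<open>The weight \<open>1 + cos (W + \<theta>)\<close> is nonnegative, hence the density of a finite measure, and the transform of the weighted law
of \<open>Y\<close> is a combination of the joint characteristic function of \<open>Y\<close> and \<open>W\<close> at three points. The one-dimensional
uniqueness theorem therefore identifies it.\<close>

lemma integral_weight_cos_eq:
  fixes Y W :: "'a \<Rightarrow> real" and Z V :: "'b \<Rightarrow> real"
  assumes "finite_measure M" "finite_measure N"
    and [measurable]: "Y \<in> borel_measurable M" "W \<in> borel_measurable M"
      "Z \<in> borel_measurable N" "V \<in> borel_measurable N" "A \<in> sets borel"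
    and eq: "\<And>b c. (CLINT \<omega>|M. iexp (b * Y \<omega> + c * W \<omega>)) = (CLINT \<omega>|N. iexp (b * Z \<omega> + c * V \<omega>))"
  shows "(LINT \<omega>|M. indicat_real A (Y \<omega>) * (1 + cos (W \<omega> + \<theta>))) =
         (LINT \<omega>|N. indicat_real A (Z \<omega>) * (1 + cos (V \<omega> + \<theta>)))"
proof -
  interpret M: finite_measure M by fact
  interpret N: finite_measure N by fact
  define \<mu> where "\<mu> = distr (density M (\<lambda>\<omega>. ennreal (1 + cos (W \<omega> + \<theta>)))) borel Y"
  define \<nu> where "\<nu> = distr (density N (\<lambda>\<omega>. ennreal (1 + cos (V \<omega> + \<theta>)))) borel Z"
  have nn: "0 \<le> 1 + cos x" for x :: real using cos_ge_minus_one[of x] by linarith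
  have le: "1 + cos x \<le> 2" for x :: real using cos_le_one[of x] by linarith
  have fin: "finite_measure (density K (\<lambda>\<omega>. ennreal (1 + cos (U \<omega> + \<theta>))))"
    if "finite_measure K" and [measurable]: "U \<in> borel_measurable K" for K :: "'z measure" and U
  proof -
    interpret K: finite_measure K by fact
    have "(\<integral>\<^sup>+\<omega>. ennreal (1 + cos (U \<omega> + \<theta>)) \<partial>K) \<le> (\<integral>\<^sup>+\<omega>. ennreal 2 \<partial>K)"
      by (intro nn_integral_mono ennreal_leI le)
    also have "\<dots> < top" using K.finite_emeasure_space by (auto simp: ennreal_mult_eq_top_iff less_top[symmetric])
    finally show ?thesis by (intro finite_measureI) (auto simp: emeasure_density)
  qed
  have "\<mu> = \<nu>"
  proof (rule finite_measure_eq_if_char_eq)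
    show "finite_measure \<mu>" unfolding \<mu>_def
      by (intro finite_measure.finite_measure_distr fin) (auto intro: assms)
    show "finite_measure \<nu>" unfolding \<nu>_def
      by (intro finite_measure.finite_measure_distr fin) (auto intro: assms)
    fix t
    have "(CLINT x|\<mu>. iexp (t * x)) = (CLINT \<omega>|M. (1 + cos (W \<omega> + \<theta>)) *\<^sub>R iexp (t * Y \<omega>))"
      unfolding \<mu>_def by (subst integral_distr; (subst integral_density)?) (auto simp: nn)
    also have "\<dots> = (CLINT \<omega>|N. (1 + cos (V \<omega> + \<theta>)) *\<^sub>R iexp (t * Z \<omega>))"
      using eq[of t 0] eq[of t 1] eq[of t "-1"]
      by (subst M.integral_weighted_iexp, simp, simp, subst N.integral_weighted_iexp, simp, simp) simp
    also have "\<dots> = (CLINT x|\<nu>. iexp (t * x))"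
      unfolding \<nu>_def by (subst integral_distr; (subst integral_density)?) (auto simp: nn)
    finally show "(CLINT x|\<mu>. iexp (t * x)) = (CLINT x|\<nu>. iexp (t * x))" .
  qed (auto simp: \<mu>_def \<nu>_def)
  moreover have "(LINT x|\<mu>. indicat_real A x) = (LINT \<omega>|M. indicat_real A (Y \<omega>) * (1 + cos (W \<omega> + \<theta>)))"
    unfolding \<mu>_def by (subst integral_distr; (subst integral_density)?) (auto simp: nn mult.commute)
  moreover have "(LINT x|\<nu>. indicat_real A x) = (LINT \<omega>|N. indicat_real A (Z \<omega>) * (1 + cos (V \<omega> + \<theta>)))"
    unfolding \<nu>_def by (subst integral_distr; (subst integral_density)?) (auto simp: nn mult.commute)
  ultimately show ?thesis by metis
qed

text \<open>Induction on the coordinates. Restricting both measures to the event that coordinate \<open>j\<close> lies in \<open>A j\<close> keeps the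
hypothesis for the remaining coordinates: the transform of the restricted measure at \<open>a\<close> has real and imaginary
parts given by the cosine and the sine of the linear combination \<open>W\<close>, and these are differences of integrals with the weights
\<open>1 + cos (W + \<theta>)\<close> at the four phases \<open>0\<close>, \<open>pi\<close>, \<open>- pi/2\<close>, \<open>pi/2\<close>.\<close>

theorem measure_rectangle_eq_if_char_eq:
  fixes Y :: "'i \<Rightarrow> 'a \<Rightarrow> real" and Z :: "'i \<Rightarrow> 'b \<Rightarrow> real"
  assumes "finite I" "finite_measure M" "finite_measure N"
    and "\<And>i. i \<in> I \<Longrightarrow> Y i \<in> borel_measurable M" "\<And>i. i \<in> I \<Longrightarrow> Z i \<in> borel_measurable N"
    and "\<And>i. i \<in> I \<Longrightarrow> A i \<in> sets borel"
    and "\<And>a. (CLINT \<omega>|M. iexp (\<Sum>i\<in>I. a i * Y i \<omega>)) = (CLINT \<omega>|N. iexp (\<Sum>i\<in>I. a i * Z i \<omega>))"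
  shows "measure M {\<omega>\<in>space M. \<forall>i\<in>I. Y i \<omega> \<in> A i} = measure N {\<omega>\<in>space N. \<forall>i\<in>I. Z i \<omega> \<in> A i}"
  using assms
proof (induction I arbitrary: M N rule: finite_induct)
  case empty
  then show ?case by simp
next
  case (insert j I)
  interpret M: finite_measure M by fact
  interpret N: finite_measure N by fact
  have [measurable]: "i \<in> I \<Longrightarrow> Y i \<in> borel_measurable M" "i \<in> I \<Longrightarrow> Z i \<in> borel_measurable N"
    "Y j \<in> borel_measurable M" "Z j \<in> borel_measurable N" "A j \<in> sets borel" 
    "i \<in> I \<Longrightarrow> A i \<in> sets borel" for i
    using insert.prems by auto
  define M' where "M' = density M (\<lambda>\<omega>. ennreal (indicator (A j) (Y j \<omega>)))"
  define N' where "N' = density N (\<lambda>\<omega>. ennreal (indicator (A j) (Z j \<omega>)))"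
  have fin: "finite_measure (density K (\<lambda>\<omega>. ennreal (indicator B (U \<omega>))))"
    if "finite_measure K" and [measurable]: "U \<in> borel_measurable K" "B \<in> sets borel"
    for K :: "'z measure" and U :: "'z \<Rightarrow> real" and B
  proof -
    interpret K: finite_measure K by fact
    have "(\<integral>\<^sup>+\<omega>. ennreal (indicator B (U \<omega>)) \<partial>K) \<le> (\<integral>\<^sup>+\<omega>. ennreal 1 \<partial>K)"
      by (intro nn_integral_mono ennreal_leI) (auto simp: indicator_def)
    also have "\<dots> < top" using K.finite_emeasure_space by (auto simp: less_top[symmetric])
    finally show ?thesis by (intro finite_measureI) (auto simp: emeasure_density)
  qed
  have meas: "measure (density K (\<lambda>\<omega>. ennreal (indicator (A j) (U j \<omega>)))) {\<omega>\<in>space K. \<forall>i\<in>I. U i \<omega> \<in> A i}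
      = measure K {\<omega>\<in>space K. \<forall>i\<in>insert j I. U i \<omega> \<in> A i}"
    if "\<And>i. i \<in> insert j I \<Longrightarrow> U i \<in> borel_measurable K" for K :: "'z measure" and U
  proof -
    have [measurable]: "i \<in> I \<Longrightarrow> U i \<in> borel_measurable K" "U j \<in> borel_measurable K" for i
      using that by auto
    have [measurable]: "finite I" by fact
    have [measurable]: "{\<omega>\<in>space K. \<forall>i\<in>I. U i \<omega> \<in> A i} \<in> sets K"
      using insert.hyps(1) by (intro sets.sets_Collect_finite_All) auto
    have [measurable]: "{\<omega>\<in>space K. \<forall>i\<in>insert j I. U i \<omega> \<in> A i} \<in> sets K"
      using insert.hyps(1) by (intro sets.sets_Collect_finite_All) auto
    have "emeasure (density K (\<lambda>\<omega>. ennreal (indicator (A j) (U j \<omega>)))) {\<omega>\<in>space K. \<forall>i\<in>I. U i \<omega> \<in> A i}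
       = (\<integral>\<^sup>+\<omega>. ennreal (indicator (A j) (U j \<omega>)) * indicator {\<omega>\<in>space K. \<forall>i\<in>I. U i \<omega> \<in> A i} \<omega> \<partial>K)"
      by (rule emeasure_density) auto
    also have "\<dots> = (\<integral>\<^sup>+\<omega>. indicator {\<omega>\<in>space K. \<forall>i\<in>insert j I. U i \<omega> \<in> A i} \<omega> \<partial>K)"
      by (intro nn_integral_cong) (auto simp: indicator_def)
    also have "\<dots> = emeasure K {\<omega>\<in>space K. \<forall>i\<in>insert j I. U i \<omega> \<in> A i}"
      by (rule nn_integral_indicator) measurable
    finally show ?thesis by (simp add: measure_def)
  qed
  have "measure M' {\<omega>\<in>space M'. \<forall>i\<in>I. Y i \<omega> \<in> A i} = measure N' {\<omega>\<in>space N'. \<forall>i\<in>I. Z i \<omega> \<in> A i}"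
  proof (rule insert.IH)
    show "finite_measure M'" "finite_measure N'"
      unfolding M'_def N'_def by (intro fin; simp add: M.finite_measure_axioms N.finite_measure_axioms)+
    show "Y i \<in> borel_measurable M'" "Z i \<in> borel_measurable N'" "A i \<in> sets borel" if "i \<in> I" for i
      using that by (auto simp: M'_def N'_def)
    fix a
    define W where "W = (\<lambda>\<omega>. \<Sum>i\<in>I. a i * Y i \<omega>)"
    define V where "V = (\<lambda>\<omega>. \<Sum>i\<in>I. a i * Z i \<omega>)"
    have [measurable]: "W \<in> borel_measurable M" "V \<in> borel_measurable N"
      unfolding W_def V_def by auto
    have eq: "(CLINT \<omega>|M. iexp (b * Y j \<omega> + c * W \<omega>)) = (CLINT \<omega>|N. iexp (b * Z j \<omega> + c * V \<omega>))" for b c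
    proof -
      have "(\<Sum>i\<in>insert j I. (if i = j then b else c * a i) * U i) = b * U j + c * (\<Sum>i\<in>I. a i * U i)" for U :: "'i \<Rightarrow> real"
        using insert.hyps by (auto simp: sum_distrib_left mult.assoc intro!: sum.cong)
      then show ?thesis
        using insert.prems(6)[of "\<lambda>i. if i = j then b else c * a i"] by (simp only: W_def V_def)
    qed
    define g where "g = (\<lambda>\<theta>. LINT \<omega>|M. indicat_real (A j) (Y j \<omega>) * (1 + cos (W \<omega> + \<theta>)))"
    define h where "h = (\<lambda>\<theta>. LINT \<omega>|N. indicat_real (A j) (Z j \<omega>) * (1 + cos (V \<omega> + \<theta>)))"
    have gh: "g \<theta> = h \<theta>" for \<theta>
      unfolding g_def h_def
      by (rule integral_weight_cos_eq) (use eq insert.prems in auto)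
    have key: "(CLINT \<omega>|density K (\<lambda>\<omega>. ennreal (indicator (A j) (U \<omega>))). iexp (T \<omega>)) =
        Complex ((f 0 - f pi) / 2) ((f (-(pi/2)) - f (pi/2)) / 2)"
      if "finite_measure K" and [measurable]: "U \<in> borel_measurable K" "T \<in> borel_measurable K"
        and f: "f = (\<lambda>\<theta>. LINT \<omega>|K. indicat_real (A j) (U \<omega>) * (1 + cos (T \<omega> + \<theta>)))"
      for K :: "'z measure" and U T f
    proof -
      interpret K: finite_measure K by fact
      have int1: "integrable K (\<lambda>\<omega>. indicat_real (A j) (U \<omega>) * (1 + cos (T \<omega> + \<theta>)))" for \<theta>
        by (rule K.integrable_const_bound[of _ 2])
          (auto simp: indicator_def abs_le_iff intro!: AE_I2; smt (verit) cos_ge_minus_one cos_le_one)+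
      have integrable_mult_H: "integrable K (\<lambda>\<omega>. indicat_real (A j) (U \<omega>) *\<^sub>R iexp (T \<omega>))"
        by (rule K.integrable_const_bound[of _ 1]) (auto simp: indicator_def)
      have "(CLINT \<omega>|density K (\<lambda>\<omega>. ennreal (indicator (A j) (U \<omega>))). iexp (T \<omega>)) =
        (CLINT \<omega>|K. indicat_real (A j) (U \<omega>) *\<^sub>R iexp (T \<omega>))" (is "_ = ?I")
        by (rule integral_density) auto
      moreover have "Re ?I = (LINT \<omega>|K. indicat_real (A j) (U \<omega>) * cos (T \<omega>))"
        using integral_Re[OF integrable_mult_H] by (simp add: Re_exp)
      moreover have "Im ?I = (LINT \<omega>|K. indicat_real (A j) (U \<omega>) * sin (T \<omega>))"
        using integral_Im[OF integrable_mult_H] by (simp add: Im_exp)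
      moreover have "(f 0 - f pi) / 2 = (LINT \<omega>|K. indicat_real (A j) (U \<omega>) * cos (T \<omega>))"
        unfolding f by (subst Bochner_Integration.integral_diff[symmetric, OF int1 int1])
          (simp add: algebra_simps flip: integral_divide_zero)
      moreover have "(f (-(pi/2)) - f (pi/2)) / 2 = (LINT \<omega>|K. indicat_real (A j) (U \<omega>) * sin (T \<omega>))"
        unfolding f by (subst Bochner_Integration.integral_diff[symmetric, OF int1 int1])
          (simp add: algebra_simps cos_add cos_diff flip: integral_divide_zero)
      ultimately show ?thesis by (simp add: complex_eq_iff)
    qed
    have "(CLINT \<omega>|M'. iexp (W \<omega>)) = Complex ((g 0 - g pi) / 2) ((g (-(pi/2)) - g (pi/2)) / 2)"
      unfolding M'_def by (rule key) (auto simp: g_def M.finite_measure_axioms)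
    also have "\<dots> = (CLINT \<omega>|N'. iexp (V \<omega>))"
      unfolding N'_def gh by (rule key[symmetric]) (auto simp: h_def N.finite_measure_axioms)
    finally show "(CLINT \<omega>|M'. iexp (\<Sum>i\<in>I. a i * Y i \<omega>)) = (CLINT \<omega>|N'. iexp (\<Sum>i\<in>I. a i * Z i \<omega>))"
      by (simp add: W_def V_def)
  qed
  then show ?case
    using meas[of Y M] meas[of Z N] insert.prems unfolding M'_def N'_def by simp
qed

section \<open>Spaces of centred Gaussian variables\<close>


text \<open>Shifting by \<open>x\<close> and using \<open>(x + z)^2 \<ge> x^2 + z^2\<close> for \<open>x, z \<ge> 0\<close>.\<close>

lemma std_normal_tail:
  assumes x: "0 \<le> x"
  shows "measure std_normal_distribution {x..} \<le> exp (- x\<^sup>2 / 2)"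
proof -
  have "emeasure std_normal_distribution {x..} = (\<integral>\<^sup>+y. ennreal (std_normal_density y) * indicator {x..} y \<partial>lborel)"
    by (simp add: emeasure_density)
  also have "\<dots> = (\<integral>\<^sup>+z. ennreal (std_normal_density (x + z)) * indicator {x..} (x + z) \<partial>lborel)"
    using nn_integral_real_affine[of "\<lambda>y. ennreal (std_normal_density y) * indicator {x..} y" 1 x] by simp
  also have "\<dots> \<le> (\<integral>\<^sup>+z. ennreal (exp (- x\<^sup>2 / 2)) * ennreal (std_normal_density z) \<partial>lborel)"
  proof (rule nn_integral_mono)
    fix z :: real
    show "ennreal (std_normal_density (x + z)) * indicator {x..} (x + z)
        \<le> ennreal (exp (- x\<^sup>2 / 2)) * ennreal (std_normal_density z)"
    proof (cases "z \<ge> 0")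
      case True
      have "std_normal_density (x + z) \<le> exp (- x\<^sup>2 / 2) * std_normal_density z"
      proof -
        have "0 \<le> x * z" using x True by simp
        then have "exp (- (x + z)\<^sup>2 / 2) \<le> exp (- x\<^sup>2 / 2 + - z\<^sup>2 / 2)"
          by (simp add: power2_sum)
        then have "exp (- (x + z)\<^sup>2 / 2) \<le> exp (- x\<^sup>2 / 2) * exp (- z\<^sup>2 / 2)"
          by (simp add: mult_exp_exp)
        then show ?thesis by (simp add: std_normal_density_def divide_right_mono)
      qed
      then show ?thesis using True by (simp add: ennreal_leI flip: ennreal_mult)
    qed (auto simp: indicator_def)
  qed
  also have "\<dots> = ennreal (exp (- x\<^sup>2 / 2))"
    using prob_space.emeasure_space_1[OF prob_space_normal_density[of 1 0]]
    by (subst nn_integral_cmult) (auto simp: emeasure_density)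
  finally show ?thesis unfolding measure_def by (simp add: enn2real_leI)
qed

context prob_space
begin

text \<open>Writing the law as that of \<open>sqrt v\<close> times a standard normal variable covers the point mass \<open>v = 0\<close> together with
the laws that have a density.\<close>

lemma distr_centered_gaussian:
  assumes [measurable]: "Y \<in> borel_measurable M" and v: "0 \<le> v"
    and ch: "\<And>b. (CLINT \<omega>|M. iexp (b * Y \<omega>)) = exp (- (v * b\<^sup>2 / 2))"
  shows "distr M borel Y = distr std_normal_distribution borel (\<lambda>x. sqrt v * x)"
proof (rule Levy_uniqueness)
  interpret N: real_distribution std_normal_distribution by (rule real_dist_normal_dist)
  show "real_distribution (distr M borel Y)"
    by (rule real_distribution_distr) simp
  show "real_distribution (distr std_normal_distribution borel (\<lambda>x. sqrt v * x))"
    by (rule N.real_distribution_distr) simp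
  show "char (distr M borel Y) = char (distr std_normal_distribution borel (\<lambda>x. sqrt v * x))"
  proof
    fix b
    have "char (distr std_normal_distribution borel (\<lambda>x. sqrt v * x)) b = char std_normal_distribution (b * sqrt v)"
      unfolding char_def by (subst integral_distr) (auto simp: mult.assoc)
    also have "\<dots> = exp (- (v * b\<^sup>2 / 2))"
      using v by (simp add: char_std_normal_distribution power_mult_distrib mult.commute exp_of_real)
    also have "\<dots> = char (distr M borel Y) b"
      unfolding char_def using ch[of b] by (subst integral_distr) auto
    finally show "char (distr M borel Y) b = char (distr std_normal_distribution borel (\<lambda>x. sqrt v * x)) b" ..
  qed
qed

lemma scaled_normal_moments:
  assumes [measurable]: "Y \<in> borel_measurable M" and v: "0 \<le> v"
    and d: "distr M borel Y = distr std_normal_distribution borel (\<lambda>x. sqrt v * x)"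
  shows "integrable M Y" "integrable M (\<lambda>\<omega>. (Y \<omega>)\<^sup>2)" "expectation Y = 0" "expectation (\<lambda>\<omega>. (Y \<omega>)\<^sup>2) = v"
    and "\<And>A. A \<in> sets borel \<Longrightarrow> prob {\<omega>\<in>space M. Y \<omega> \<in> A} = measure std_normal_distribution {x. sqrt v * x \<in> A}"
proof -
  have i: "integrable std_normal_distribution (\<lambda>x. x^k)" for k by (rule integrable_std_normal_distribution_moment)
  have "integrable std_normal_distribution (\<lambda>x. sqrt v * x)" "integrable std_normal_distribution (\<lambda>x. v * x\<^sup>2)"
    using i[of 1] i[of 2] by (auto intro!: integrable_mult_right)
  then have "integrable (distr M borel Y) (\<lambda>x. x)" "integrable (distr M borel Y) (\<lambda>x. x\<^sup>2)"
    unfolding d using v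
    by (simp_all add: integrable_distr_eq[where M = std_normal_distribution and N = borel] power_mult_distrib)
  then show "integrable M Y" "integrable M (\<lambda>\<omega>. (Y \<omega>)\<^sup>2)"
    by (simp_all add: integrable_distr_eq[where M = M and N = borel])
  have "expectation Y = (LINT x|distr M borel Y. x)" by (subst integral_distr) auto
  also have "\<dots> = (LINT x|std_normal_distribution. sqrt v * x)" unfolding d by (subst integral_distr) auto
  also have "\<dots> = 0" using integral_std_normal_distribution_moment_odd[of 1] by simp
  finally show "expectation Y = 0" .
  have "expectation (\<lambda>\<omega>. (Y \<omega>)\<^sup>2) = (LINT x|distr M borel Y. x\<^sup>2)" by (subst integral_distr) auto
  also have "\<dots> = (LINT x|std_normal_distribution. v * x\<^sup>2)"
    unfolding d using v by (subst integral_distr) (auto simp: power_mult_distrib)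
  also have "\<dots> = v" using std_normal_distribution_even_moments(1)[of 1] by simp
  finally show "expectation (\<lambda>\<omega>. (Y \<omega>)\<^sup>2) = v" .
  fix A :: "real set" assume [measurable]: "A \<in> sets borel"
  have "prob {\<omega>\<in>space M. Y \<omega> \<in> A} = measure (distr M borel Y) A"
    by (subst measure_distr) (auto intro!: arg_cong[where f = prob])
  also have "\<dots> = measure std_normal_distribution {x. sqrt v * x \<in> A}"
    unfolding d by (subst measure_distr) (auto intro!: arg_cong[where f = "measure _"])
  finally show "prob {\<omega>\<in>space M. Y \<omega> \<in> A} = measure std_normal_distribution {x. sqrt v * x \<in> A}" .
qed

end

text \<open>A linear space of jointly Gaussian centred variables. Membership is expressed by characteristic functions, which
pass to pointwise limits and do not separate the degenerate case.\<close>

definition gaussian_space :: "'w measure \<Rightarrow> ('w \<Rightarrow> real) set \<Rightarrow> bool" where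
  "gaussian_space M H \<longleftrightarrow>
     (\<lambda>_. 0) \<in> H \<and> (\<forall>Y\<in>H. \<forall>Z\<in>H. \<forall>a b. (\<lambda>\<omega>. a * Y \<omega> + b * Z \<omega>) \<in> H) \<and>
     (\<forall>Y\<in>H. Y \<in> borel_measurable M \<and> (\<exists>v\<ge>0. \<forall>b. (CLINT \<omega>|M. iexp (b * Y \<omega>)) = exp (- (v * b\<^sup>2 / 2))))"

text \<open>Derivatives of the paths are pointwise limits of difference quotients; one step of this closure is taken for each derivative.\<close>

definition limit_closure :: "'w measure \<Rightarrow> ('w \<Rightarrow> real) set \<Rightarrow> ('w \<Rightarrow> real) set" where
  "limit_closure M H = {g. \<exists>f. (\<forall>n::nat. f n \<in> H) \<and> (\<forall>\<omega>\<in>space M. (\<lambda>n. f n \<omega>) \<longlonglongrightarrow> g \<omega>)}"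

lemma subset_limit_closure: "H \<subseteq> limit_closure M H"
  unfolding limit_closure_def by (auto intro!: exI[of _ "\<lambda>_. _"])

lemma gaussian_space_lin:
  assumes "gaussian_space M H" "Y \<in> H" "Z \<in> H"
  shows "(\<lambda>\<omega>. a * Y \<omega> + b * Z \<omega>) \<in> H"
  using assms unfolding gaussian_space_def by blast

lemma gaussian_space_sum:
  assumes "gaussian_space M H" "finite I" "\<And>i. i \<in> I \<Longrightarrow> Y i \<in> H"
  shows "(\<lambda>\<omega>. \<Sum>i\<in>I. a i * Y i \<omega>) \<in> H"
  using assms(2,3)
proof (induction I rule: finite_induct)
  case empty
  then show ?case using assms(1) by (simp add: gaussian_space_def)
next
  case (insert i I)
  then have "(\<lambda>\<omega>. a i * Y i \<omega> + 1 * (\<Sum>i\<in>I. a i * Y i \<omega>)) \<in> H"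
    by (intro gaussian_space_lin[OF assms(1)]) auto
  then show ?case using insert by simp
qed

lemma gaussian_space_add:
  assumes "gaussian_space M H" "Y \<in> H" "Z \<in> H"
  shows "(\<lambda>\<omega>. Y \<omega> + Z \<omega>) \<in> H" "(\<lambda>\<omega>. Y \<omega> - Z \<omega>) \<in> H" "(\<lambda>\<omega>. c * Y \<omega>) \<in> H" "(\<lambda>\<omega>. Y \<omega> / c) \<in> H"
  using gaussian_space_lin[OF assms, of 1 1] gaussian_space_lin[OF assms, of 1 "-1"]
    gaussian_space_lin[OF assms, of c 0] gaussian_space_lin[OF assms, of "1/c" 0] by simp_all

context prob_space
begin

lemma gaussian_space_distr:
  assumes "gaussian_space M H" "Y \<in> H"
  shows "distr M borel Y = distr std_normal_distribution borel (\<lambda>x. sqrt (expectation (\<lambda>\<omega>. (Y \<omega>)\<^sup>2)) * x)"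
proof -
  obtain v where v: "v \<ge> 0" "\<And>b. (CLINT \<omega>|M. iexp (b * Y \<omega>)) = exp (- (v * b\<^sup>2 / 2))"
    and m: "Y \<in> borel_measurable M"
    using assms unfolding gaussian_space_def by blast
  have d: "distr M borel Y = distr std_normal_distribution borel (\<lambda>x. sqrt v * x)"
    by (rule distr_centered_gaussian[OF m v])
  then show ?thesis using scaled_normal_moments(4)[OF m v(1)] by simp
qed

lemma gaussian_space_measurable: "gaussian_space M H \<Longrightarrow> Y \<in> H \<Longrightarrow> Y \<in> borel_measurable M"
  by (auto simp: gaussian_space_def)

lemma gaussian_space_moments:
  assumes "gaussian_space M H" "Y \<in> H"
  shows "integrable M Y" "integrable M (\<lambda>\<omega>. (Y \<omega>)\<^sup>2)" "expectation Y = 0"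
  by (intro scaled_normal_moments(1-3)[OF gaussian_space_measurable[OF assms] _ gaussian_space_distr[OF assms]]
      integral_nonneg_AE AE_I2 zero_le_power2)+

lemma gaussian_space_char:
  assumes "gaussian_space M H" "Y \<in> H"
  shows "(CLINT \<omega>|M. iexp (Y \<omega>)) = exp (- (expectation (\<lambda>\<omega>. (Y \<omega>)\<^sup>2) / 2))"
proof -
  obtain v where v: "v \<ge> 0" "\<And>b. (CLINT \<omega>|M. iexp (b * Y \<omega>)) = exp (- (v * b\<^sup>2 / 2))"
    and m: "Y \<in> borel_measurable M"
    using assms unfolding gaussian_space_def by blast
  show ?thesis
    using v(2)[of 1] scaled_normal_moments(4)[OF m v(1) distr_centered_gaussian[OF m v]] by simp
qed

lemma gaussian_space_tail:
  assumes "gaussian_space M H" "Y \<in> H" and v: "expectation (\<lambda>\<omega>. (Y \<omega>)\<^sup>2) \<le> v" "0 < v" and a: "0 \<le> a"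
  shows "prob {\<omega>\<in>space M. Y \<omega> \<ge> a} \<le> exp (- a\<^sup>2 / (2 * v))"
proof -
  interpret N: real_distribution std_normal_distribution by (rule real_dist_normal_dist)
  define w where "w = expectation (\<lambda>\<omega>. (Y \<omega>)\<^sup>2)"
  have w0: "0 \<le> w" by (simp add: w_def)
  have "prob {\<omega>\<in>space M. Y \<omega> \<in> {a..}} = measure std_normal_distribution {x. sqrt w * x \<in> {a..}}"
    unfolding w_def
    by (rule scaled_normal_moments(5)[OF gaussian_space_measurable[OF assms(1,2)] _ gaussian_space_distr[OF assms(1,2)]])
      auto
  also have "\<dots> \<le> exp (- a\<^sup>2 / (2 * v))"
  proof (cases "a = 0")
    case True then show ?thesis by simp
  next
    case False
    have "{x. sqrt w * x \<in> {a..}} \<subseteq> {a / sqrt v..}"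
    proof (rule subsetI)
      fix x assume "x \<in> {x. sqrt w * x \<in> {a..}}"
      then have ax: "a \<le> sqrt w * x" by simp
      then have "0 < sqrt w * x" using False a by simp
      then have "0 \<le> x" using w0 by (simp add: zero_less_mult_iff not_less)
      then have "a \<le> sqrt v * x" using ax v w_def by (smt (verit) mult_right_mono real_sqrt_le_iff)
      then show "x \<in> {a / sqrt v..}" using v by (simp add: field_simps)
    qed
    then have "measure std_normal_distribution {x. sqrt w * x \<in> {a..}} \<le> measure std_normal_distribution {a / sqrt v..}"
      by (intro N.finite_measure_mono) auto
    also have "\<dots> \<le> exp (- (a / sqrt v)\<^sup>2 / 2)" using a v by (intro std_normal_tail) simp
    also have "\<dots> = exp (- a\<^sup>2 / (2 * v))" using v by (simp add: power_divide)
    finally show ?thesis .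
  qed
  finally show ?thesis by simp
qed

text \<open>The characteristic function \<open>\<psi>\<close> of the limit is continuous with \<open>\<psi> 0 = 1\<close>, so it is nonzero at some \<open>b \<noteq> 0\<close>. Since
\<open>exp (- v n * b^2 / 2)\<close> converges to \<open>\<psi> b\<close>, the variances \<open>v n\<close> converge, and the limit is again Gaussian.\<close>

lemma gaussian_space_limit:
  assumes H: "gaussian_space M H" and f: "\<And>n. f n \<in> H" and g: "\<And>\<omega>. \<omega> \<in> space M \<Longrightarrow> (\<lambda>n. f n \<omega>) \<longlonglongrightarrow> g \<omega>"
  shows "g \<in> borel_measurable M"
    and "\<exists>v\<ge>0. (\<lambda>n. expectation (\<lambda>\<omega>. (f n \<omega>)\<^sup>2)) \<longlonglongrightarrow> v \<and> (\<forall>b. (CLINT \<omega>|M. iexp (b * g \<omega>)) = exp (- (v * b\<^sup>2 / 2)))"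
proof -
  have [measurable]: "f n \<in> borel_measurable M" for n by (rule gaussian_space_measurable[OF H f])
  show gm[measurable]: "g \<in> borel_measurable M"
    by (rule borel_measurable_LIMSEQ_real[of _ f]) (auto intro: g)
  define \<psi> where "\<psi> = (\<lambda>b. CLINT \<omega>|M. iexp (b * g \<omega>))"
  define v where "v = (\<lambda>n. expectation (\<lambda>\<omega>. (f n \<omega>)\<^sup>2))"
  have vn: "(CLINT \<omega>|M. iexp (b * f n \<omega>)) = exp (- (v n * b\<^sup>2 / 2))" for n b
    using gaussian_space_char[OF H gaussian_space_add(3)[OF H f f, of b]]
    by (simp add: v_def power_mult_distrib mult.commute)
  have conv: "(\<lambda>n. complex_of_real (exp (- (v n * b\<^sup>2 / 2)))) \<longlonglongrightarrow> \<psi> b" for b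
    unfolding vn[symmetric] \<psi>_def
  proof (rule integral_dominated_convergence[where w = "\<lambda>_. 1"])
    show "AE \<omega> in M. (\<lambda>n. iexp (b * f n \<omega>)) \<longlonglongrightarrow> iexp (b * g \<omega>)"
      by (intro AE_I2 tendsto_intros g)
  qed auto
  then have convr: "(\<lambda>n. exp (- (v n * b\<^sup>2 / 2))) \<longlonglongrightarrow> Re (\<psi> b)" for b
    using tendsto_Re by fastforce
  interpret D: real_distribution "distr M borel g" by (rule real_distribution_distr) simp
  have \<psi>: "\<psi> = char (distr M borel g)"
    unfolding \<psi>_def char_def by (rule ext) (subst integral_distr, auto)
  have "\<psi> \<midarrow>0\<rightarrow> \<psi> 0" using D.isCont_char[of 0] by (simp add: \<psi> isCont_def)
  moreover have "\<psi> 0 = 1" unfolding \<psi> by (rule D.char_zero)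
  ultimately have "\<forall>\<^sub>F b in at 0. dist (\<psi> b) 1 < 1" by (metis tendstoD zero_less_one)
  then obtain d where d: "d > 0" "\<And>x. x \<noteq> 0 \<Longrightarrow> dist x 0 < d \<Longrightarrow> dist (\<psi> x) 1 < 1"
    unfolding eventually_at by auto
  obtain b where b: "b \<noteq> 0" "dist (\<psi> b) 1 < 1"
    by (rule that[of "d / 2"]) (use d in auto)
  have c: "Re (\<psi> b) > 0"
  proof -
    have "\<bar>Re (\<psi> b - 1)\<bar> < 1" using b(2) abs_Re_le_cmod[of "\<psi> b - 1"] by (simp add: dist_norm)
    then show ?thesis by simp
  qed
  have "(\<lambda>n. ln (exp (- (v n * b\<^sup>2 / 2)))) \<longlonglongrightarrow> ln (Re (\<psi> b))"
    using c by (intro tendsto_ln convr) auto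
  then have "(\<lambda>n. - (v n * b\<^sup>2 / 2) * (- 2 / b\<^sup>2)) \<longlonglongrightarrow> ln (Re (\<psi> b)) * (- 2 / b\<^sup>2)"
    by (intro tendsto_mult) auto
  then have vl: "v \<longlonglongrightarrow> ln (Re (\<psi> b)) * (- 2 / b\<^sup>2)" (is "_ \<longlonglongrightarrow> ?v") using b by (simp add: field_simps)
  have "0 \<le> ?v" by (rule LIMSEQ_le_const[OF vl]) (auto simp: v_def)
  moreover have "\<psi> a = exp (- (?v * a\<^sup>2 / 2))" for a
  proof (rule LIMSEQ_unique[OF conv])
    show "(\<lambda>n. complex_of_real (exp (- (v n * a\<^sup>2 / 2)))) \<longlonglongrightarrow> complex_of_real (exp (- (?v * a\<^sup>2 / 2)))"
      by (intro tendsto_intros vl) simp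
  qed
  ultimately show "\<exists>v\<ge>0. (\<lambda>n. expectation (\<lambda>\<omega>. (f n \<omega>)\<^sup>2)) \<longlonglongrightarrow> v \<and> (\<forall>b. (CLINT \<omega>|M. iexp (b * g \<omega>)) = exp (- (v * b\<^sup>2 / 2)))"
    using vl unfolding v_def \<psi>_def by blast
qed

lemma gaussian_space_limit_closure:
  assumes H: "gaussian_space M H"
  shows "gaussian_space M (limit_closure M H)"
  unfolding gaussian_space_def
proof (intro conjI ballI allI)
  show "(\<lambda>_. 0) \<in> limit_closure M H"
    using H subset_limit_closure[of H M] by (auto simp: gaussian_space_def)
next
  fix Y Z a b assume "Y \<in> limit_closure M H" "Z \<in> limit_closure M H"
  then obtain f g where "\<forall>n. f n \<in> H" "\<forall>\<omega>\<in>space M. (\<lambda>n. f n \<omega>) \<longlonglongrightarrow> Y \<omega>"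
    "\<forall>n. g n \<in> H" "\<forall>\<omega>\<in>space M. (\<lambda>n. g n \<omega>) \<longlonglongrightarrow> Z \<omega>"
    unfolding limit_closure_def by blast
  then show "(\<lambda>\<omega>. a * Y \<omega> + b * Z \<omega>) \<in> limit_closure M H"
    unfolding limit_closure_def
    by (auto intro!: exI[of _ "\<lambda>n \<omega>. a * f n \<omega> + b * g n \<omega>"] gaussian_space_lin[OF H] tendsto_intros)
next
  fix Y assume "Y \<in> limit_closure M H"
  then obtain f where "\<And>n. f n \<in> H" "\<And>\<omega>. \<omega> \<in> space M \<Longrightarrow> (\<lambda>n. f n \<omega>) \<longlonglongrightarrow> Y \<omega>"
    unfolding limit_closure_def by auto
  from gaussian_space_limit[OF H this]
  show "Y \<in> borel_measurable M" "\<exists>v\<ge>0. \<forall>b. (CLINT \<omega>|M. iexp (b * Y \<omega>)) = exp (- (v * b\<^sup>2 / 2))"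
    by blast+
qed

lemma gaussian_space_integrable_mult:
  assumes "gaussian_space M H" "Y \<in> H" "Z \<in> H"
  shows "integrable M (\<lambda>\<omega>. Y \<omega> * Z \<omega>)"
proof -
  have "integrable M (\<lambda>\<omega>. ((Y \<omega> + Z \<omega>)\<^sup>2 - (Y \<omega> - Z \<omega>)\<^sup>2) / 4)"
    using assms by (intro Bochner_Integration.integrable_diff integrable_divide gaussian_space_moments(2) gaussian_space_add)
  then show ?thesis by (simp add: power2_eq_square algebra_simps)
qed

lemma gaussian_space_second_moment_tendsto:
  assumes H: "gaussian_space M H" and f: "\<And>n. f n \<in> H" and g: "\<And>\<omega>. \<omega> \<in> space M \<Longrightarrow> (\<lambda>n. f n \<omega>) \<longlonglongrightarrow> g \<omega>"
  shows "(\<lambda>n. expectation (\<lambda>\<omega>. (f n \<omega>)\<^sup>2)) \<longlonglongrightarrow> expectation (\<lambda>\<omega>. (g \<omega>)\<^sup>2)"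
proof -
  from gaussian_space_limit[OF assms] obtain v where v: "v \<ge> 0"
    "(\<lambda>n. expectation (\<lambda>\<omega>. (f n \<omega>)\<^sup>2)) \<longlonglongrightarrow> v" "\<And>b. (CLINT \<omega>|M. iexp (b * g \<omega>)) = exp (- (v * b\<^sup>2 / 2))"
    and m: "g \<in> borel_measurable M"
    by blast
  have "expectation (\<lambda>\<omega>. (g \<omega>)\<^sup>2) = v"
    by (rule scaled_normal_moments(4)[OF m v(1) distr_centered_gaussian[OF m v(1,3)]])
  then show ?thesis using v by simp
qed

text \<open>Polarisation of the convergence of second moments.\<close>

lemma gaussian_space_covariance_tendsto:
  assumes H: "gaussian_space M H" and f: "\<And>n. f n \<in> H" "\<And>n. f' n \<in> H"
    and g: "\<And>\<omega>. \<omega> \<in> space M \<Longrightarrow> (\<lambda>n. f n \<omega>) \<longlonglongrightarrow> g \<omega>" "\<And>\<omega>. \<omega> \<in> space M \<Longrightarrow> (\<lambda>n. f' n \<omega>) \<longlonglongrightarrow> g' \<omega>"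
  shows "(\<lambda>n. expectation (\<lambda>\<omega>. f n \<omega> * f' n \<omega>)) \<longlonglongrightarrow> expectation (\<lambda>\<omega>. g \<omega> * g' \<omega>)"
proof -
  note H' = gaussian_space_limit_closure[OF H]
  have g': "g \<in> limit_closure M H" "g' \<in> limit_closure M H"
    using f g unfolding limit_closure_def by blast+
  have pol: "expectation (\<lambda>\<omega>. Y \<omega> * Z \<omega>) =
     (expectation (\<lambda>\<omega>. (Y \<omega> + Z \<omega>)\<^sup>2) - expectation (\<lambda>\<omega>. (Y \<omega> - Z \<omega>)\<^sup>2)) / 4"
    if "Y \<in> limit_closure M H" "Z \<in> limit_closure M H" for Y Z
  proof -
    have "expectation (\<lambda>\<omega>. (Y \<omega> + Z \<omega>)\<^sup>2) - expectation (\<lambda>\<omega>. (Y \<omega> - Z \<omega>)\<^sup>2)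
       = expectation (\<lambda>\<omega>. (Y \<omega> + Z \<omega>)\<^sup>2 - (Y \<omega> - Z \<omega>)\<^sup>2)"
      using that by (intro Bochner_Integration.integral_diff[symmetric] gaussian_space_moments(2)[OF H'] gaussian_space_add[OF H'])
    also have "\<dots> = expectation (\<lambda>\<omega>. 4 * (Y \<omega> * Z \<omega>))"
      by (intro Bochner_Integration.integral_cong refl) (simp add: power2_eq_square algebra_simps)
    finally show ?thesis by simp
  qed
  show ?thesis
    using f subset_limit_closure[of H M] g'
    by (subst (1 2) pol)
      (auto intro!: tendsto_intros gaussian_space_second_moment_tendsto[OF H] gaussian_space_add[OF H] g)
qed

end

section \<open>Independence and Fernique's theorem\<close>

context prob_space
begin

text \<open>The joint characteristic function is that of the product measure, and rectangles see nothing else.\<close>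

lemma gaussian_space_independent:
  assumes H: "gaussian_space M H" and I: "finite I" and Y: "\<And>i. i \<in> I \<Longrightarrow> Y i \<in> H"
    and cov: "\<And>i j. i \<in> I \<Longrightarrow> j \<in> I \<Longrightarrow> expectation (\<lambda>\<omega>. Y i \<omega> * Y j \<omega>) = (if i = j then 1 else 0)"
    and A: "\<And>i. i \<in> I \<Longrightarrow> A i \<in> sets borel"
  shows "prob {\<omega>\<in>space M. \<forall>i\<in>I. Y i \<omega> \<in> A i} = (\<Prod>i\<in>I. measure std_normal_distribution (A i))"
proof -
  interpret N: real_distribution std_normal_distribution by (rule real_dist_normal_dist)
  interpret P: finite_product_prob_space "\<lambda>_. std_normal_distribution" I
    by unfold_locales (rule I)
  define N where "N = PiM I (\<lambda>_. std_normal_distribution)"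
  interpret PN: prob_space N unfolding N_def by unfold_locales
  have int: "integrable std_normal_distribution (\<lambda>x. iexp (c * x))" for c
    by (rule N.integrable_const_bound[of _ 1]) auto
  have "prob {\<omega>\<in>space M. \<forall>i\<in>I. Y i \<omega> \<in> A i} = measure N {x\<in>space N. \<forall>i\<in>I. x i \<in> A i}"
  proof (rule measure_rectangle_eq_if_char_eq[OF I])
    show "finite_measure M" "finite_measure N" by unfold_locales
    show "Y i \<in> borel_measurable M" if "i \<in> I" for i using gaussian_space_measurable[OF H Y[OF that]] .
    show "(\<lambda>x. x i) \<in> borel_measurable N" if "i \<in> I" for i unfolding N_def using that by measurable
    show "A i \<in> sets borel" if "i \<in> I" for i by (rule A[OF that])
    fix a :: "_ \<Rightarrow> real"
    have ii: "integrable M (\<lambda>\<omega>. c * (Y i \<omega> * Y j \<omega>))" if "i \<in> I" "j \<in> I" for i j c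
      using gaussian_space_integrable_mult[OF H Y Y] that by simp
    have "expectation (\<lambda>\<omega>. (\<Sum>i\<in>I. a i * Y i \<omega>)\<^sup>2)
        = expectation (\<lambda>\<omega>. \<Sum>i\<in>I. \<Sum>j\<in>I. (a i * a j) * (Y i \<omega> * Y j \<omega>))"
      by (intro Bochner_Integration.integral_cong refl)
        (simp only: power2_eq_square sum_product mult.assoc mult.left_commute)
    also have "\<dots> = (\<Sum>i\<in>I. \<Sum>j\<in>I. (a i * a j) * expectation (\<lambda>\<omega>. Y i \<omega> * Y j \<omega>))"
      using ii by (simp add: Bochner_Integration.integral_sum Bochner_Integration.integrable_sum)
    also have "\<dots> = (\<Sum>i\<in>I. \<Sum>j\<in>I. if j = i then (a i)\<^sup>2 else 0)"
      by (intro sum.cong refl) (auto simp: cov power2_eq_square)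
    also have "\<dots> = (\<Sum>i\<in>I. (a i)\<^sup>2)" using I by simp
    finally have v: "expectation (\<lambda>\<omega>. (\<Sum>i\<in>I. a i * Y i \<omega>)\<^sup>2) = (\<Sum>i\<in>I. (a i)\<^sup>2)" .
    have "(CLINT \<omega>|M. iexp (\<Sum>i\<in>I. a i * Y i \<omega>)) = complex_of_real (exp (\<Sum>i\<in>I. - (a i)\<^sup>2 / 2))"
      using gaussian_space_char[OF H gaussian_space_sum[where a = a, OF H I Y]]
      by (simp add: v sum_divide_distrib sum_negf)
    also have "\<dots> = (\<Prod>i\<in>I. char std_normal_distribution (a i))"
      using I by (simp add: exp_sum char_std_normal_distribution)
    also have "\<dots> = (\<Prod>i\<in>I. (CLINT x|std_normal_distribution. iexp (a i * x)))" by (simp add: char_def)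
    also have "\<dots> = (CLINT x|N. (\<Prod>i\<in>I. iexp (a i * x i)))"
      unfolding N_def by (rule P.product_integral_prod[symmetric, OF I int])
    also have "\<dots> = (CLINT x|N. iexp (\<Sum>i\<in>I. a i * x i))"
      using I by (simp add: exp_sum[symmetric] sum_distrib_left)
    finally show "(CLINT \<omega>|M. iexp (\<Sum>i\<in>I. a i * Y i \<omega>)) = (CLINT x|N. iexp (\<Sum>i\<in>I. a i * x i))" .
  qed
  also have "{x\<in>space N. \<forall>i\<in>I. x i \<in> A i} = Pi\<^sub>E I A"
    unfolding N_def by (auto simp: space_PiM PiE_iff extensional_def)
  also have "measure N (Pi\<^sub>E I A) = (\<Prod>i\<in>I. measure std_normal_distribution (A i))"
    unfolding N_def by (rule P.prob_times) (use A in auto)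
  finally show ?thesis .
qed

lemma char_independent_copy:
  assumes H: "gaussian_space M H" and A: "A \<in> H" and B: "B \<in> H"
  shows "(CLINT p|M \<Otimes>\<^sub>M M. iexp (A (fst p) + B (snd p)))
     = exp (- ((expectation (\<lambda>\<omega>. (A \<omega>)\<^sup>2) + expectation (\<lambda>\<omega>. (B \<omega>)\<^sup>2)) / 2))"
proof -
  interpret P: pair_prob_space M M by unfold_locales
  have [measurable]: "A \<in> borel_measurable M" "B \<in> borel_measurable M"
    using gaussian_space_measurable[OF H] A B by auto
  have "(CLINT p|M \<Otimes>\<^sub>M M. iexp (A (fst p) + B (snd p)))
      = (CLINT x|M. (CLINT y|M. iexp (A x) * iexp (B y)))"
    by (subst P.integral_fst'[symmetric])
      (auto intro!: P.P.integrable_const_bound[of _ 1] simp: mult_exp_exp distrib_left)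
  also have "\<dots> = (CLINT x|M. iexp (A x)) * (CLINT y|M. iexp (B y))" by simp
  also have "\<dots> = exp (- ((expectation (\<lambda>\<omega>. (A \<omega>)\<^sup>2) + expectation (\<lambda>\<omega>. (B \<omega>)\<^sup>2)) / 2))"
    using gaussian_space_char[OF H A] gaussian_space_char[OF H B]
    by (simp add: mult_exp_exp exp_of_real[symmetric] add_divide_distrib)
  finally show ?thesis .
qed

lemma measure_pair_rectangle:
  assumes "A \<in> events" "B \<in> events"
  shows "measure (M \<Otimes>\<^sub>M M) (A \<times> B) = prob A * prob B"
proof -
  show ?thesis using assms
    by (simp add: measure_def emeasure_pair_measure_Times enn2real_mult)
qed

text \<open>The pair \<open>(x - y) / sqrt 2\<close>, \<open>(x + y) / sqrt 2\<close> formed from two independent copies has the same law as the two copies. If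
the first component is at most \<open>s\<close> and the second exceeds \<open>t\<close> in some coordinate, then both copies exceed
\<open>(t - s) / sqrt 2\<close> in that coordinate.\<close>

lemma fernique_step:
  fixes Z :: "nat \<Rightarrow> 'a \<Rightarrow> real"
  assumes H: "gaussian_space M H" and Z: "\<And>i. i < N \<Longrightarrow> Z i \<in> H" and s: "0 \<le> s"
  shows "prob {\<omega>\<in>space M. \<forall>i<N. \<bar>Z i \<omega>\<bar> \<le> s} * prob {\<omega>\<in>space M. \<exists>i<N. \<bar>Z i \<omega>\<bar> > t}
     \<le> (prob {\<omega>\<in>space M. \<exists>i<N. \<bar>Z i \<omega>\<bar> > (t - s) / sqrt 2})\<^sup>2"
proof -
  interpret P: pair_prob_space M M by unfold_locales
  define PM where "PM = M \<Otimes>\<^sub>M M"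
  interpret PM: prob_space PM unfolding PM_def by unfold_locales
  have Zm[measurable]: "i < N \<Longrightarrow> Z i \<in> borel_measurable M" for i using gaussian_space_measurable[OF H Z] .
  have sp: "space PM = space M \<times> space M" by (simp add: PM_def space_pair_measure)
  define I where "I = (UNIV :: bool set) \<times> {..<N}"
  \<comment> \<open>the rotated pair \<open>Y\<close> and the plain pair \<open>W\<close>; the flag selects the component\<close>
  define Y where "Y = (\<lambda>(b, i) p. (Z i (fst p) + (if b then 1 else -1) * Z i (snd p)) / sqrt 2)"
  define W where "W = (\<lambda>(b, i) p. if b then Z i (snd p) else Z i (fst p))"
  have I: "finite I" unfolding I_def by (intro finite_cartesian_product) auto
  have split: "(\<Sum>q\<in>I. f q) = (\<Sum>i<N. f (False, i)) + (\<Sum>i<N. f (True, i))" for f :: "bool \<times> nat \<Rightarrow> real"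
    proof -
    have "(\<Sum>q\<in>I. f q) = (\<Sum>b\<in>UNIV. \<Sum>i<N. f (b, i))" unfolding I_def by (simp add: sum.cartesian_product)
    then show ?thesis by (simp add: UNIV_bool add.commute)
  qed
  have Ym: "Y q \<in> borel_measurable PM" and Wm: "W q \<in> borel_measurable PM" if "q \<in> I" for q
    using that unfolding Y_def W_def I_def PM_def by (auto split: prod.splits) measurable
  have ch: "(CLINT p|PM. iexp (\<Sum>q\<in>I. a q * Y q p)) = (CLINT p|PM. iexp (\<Sum>q\<in>I. a q * W q p))" for a
  proof -
    define C where "C = (\<lambda>\<omega>. \<Sum>i<N. a (False, i) * Z i \<omega>)"
    define D where "D = (\<lambda>\<omega>. \<Sum>i<N. a (True, i) * Z i \<omega>)"
    have CD: "C \<in> H" "D \<in> H" unfolding C_def D_def by (intro gaussian_space_sum[OF H] Z; simp)+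
    define A where "A = (\<lambda>\<omega>. (C \<omega> + D \<omega>) / sqrt 2)"
    define B where "B = (\<lambda>\<omega>. (D \<omega> - C \<omega>) / sqrt 2)"
    have AB: "A \<in> H" "B \<in> H" unfolding A_def B_def
      by (intro gaussian_space_add[OF H] CD; rule CD)+
    have "(\<Sum>q\<in>I. a q * Y q p) = A (fst p) + B (snd p)" for p
      unfolding split Y_def A_def B_def C_def D_def
      by (simp add: sum_divide_distrib flip: sum.distrib sum_subtractf)
        (intro sum.cong refl, simp add: field_simps)
    moreover have "(\<Sum>q\<in>I. a q * W q p) = C (fst p) + D (snd p)" for p
      unfolding split W_def C_def D_def by simp
    moreover have "expectation (\<lambda>\<omega>. (A \<omega>)\<^sup>2) + expectation (\<lambda>\<omega>. (B \<omega>)\<^sup>2) = expectation (\<lambda>\<omega>. (A \<omega>)\<^sup>2 + (B \<omega>)\<^sup>2)"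
      using gaussian_space_moments(2)[OF H] AB by simp
    moreover have "expectation (\<lambda>\<omega>. (C \<omega>)\<^sup>2) + expectation (\<lambda>\<omega>. (D \<omega>)\<^sup>2) = expectation (\<lambda>\<omega>. (C \<omega>)\<^sup>2 + (D \<omega>)\<^sup>2)"
      using gaussian_space_moments(2)[OF H] CD by simp
    moreover have "(A \<omega>)\<^sup>2 + (B \<omega>)\<^sup>2 = (C \<omega>)\<^sup>2 + (D \<omega>)\<^sup>2" for \<omega>
      unfolding A_def B_def by (simp add: power_divide power2_sum power2_diff field_simps)
    ultimately show ?thesis
      unfolding PM_def by (simp only: char_independent_copy[OF H AB] char_independent_copy[OF H CD])
  qed
  have rect: "PM.prob {p\<in>space PM. \<forall>q\<in>I. Y q p \<in> R q} = PM.prob {p\<in>space PM. \<forall>q\<in>I. W q p \<in> R q}"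
    if "\<And>q. q \<in> I \<Longrightarrow> R q \<in> sets borel" for R
    by (rule measure_rectangle_eq_if_char_eq[OF I _ _ Ym Wm that ch]) (auto simp: PM.finite_measure_axioms)
  define E where "E = (\<lambda>x. {\<omega>\<in>space M. \<forall>i<N. \<bar>Z i \<omega>\<bar> \<le> x})"
  define G where "G = (\<lambda>x. {\<omega>\<in>space M. \<exists>i<N. \<bar>Z i \<omega>\<bar> > x})"
  have EG[measurable]: "E x \<in> events" "G x \<in> events" for x
    using sets.sets_Collect_finite_All[of "{..<N}" M "\<lambda>i \<omega>. \<bar>Z i \<omega>\<bar> \<le> x"]
      sets.sets_Collect_finite_Ex[of "{..<N}" M "\<lambda>i \<omega>. x < \<bar>Z i \<omega>\<bar>"]
    unfolding E_def G_def by auto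
  define U where "U = (\<lambda>x. {p\<in>space PM. \<forall>i<N. \<bar>Y (False, i) p\<bar> \<le> s \<and> (x \<longrightarrow> \<bar>Y (True, i) p\<bar> \<le> t)})"
  have Um: "U x \<in> sets PM" for x
  proof -
    have [measurable]: "i < N \<Longrightarrow> Y (b, i) \<in> borel_measurable PM" for i b using Ym by (auto simp: I_def)
    show ?thesis
      using sets.sets_Collect_finite_All[of "{..<N}" PM
        "\<lambda>i p. \<bar>Y (False, i) p\<bar> \<le> s \<and> (x \<longrightarrow> \<bar>Y (True, i) p\<bar> \<le> t)"]
      unfolding U_def by auto
  qed
  have Ueq: "PM.prob (U x) = prob (E s) * prob (if x then E t else space M)" for x
  proof -
    define R where "R = (\<lambda>(b, i::nat). if b then if x then {-t..t} else UNIV else {-s..s})"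
    have ball: "(\<forall>q\<in>I. Q q) \<longleftrightarrow> (\<forall>i<N. Q (False, i)) \<and> (\<forall>i<N. Q (True, i))" for Q
      unfolding I_def Ball_def split_paired_All all_bool_eq by auto
    have R: "R (False, i) = {-s..s}" "R (True, i) = (if x then {-t..t} else UNIV)" for i
      by (simp_all add: R_def)
    have abs: "a \<in> {-b..b} \<longleftrightarrow> \<bar>a\<bar> \<le> b" for a b :: real by auto
    have W: "W (False, i) p = Z i (fst p)" "W (True, i) p = Z i (snd p)" for i p by (simp_all add: W_def)
    have "U x = {p\<in>space PM. \<forall>q\<in>I. Y q p \<in> R q}"
      unfolding U_def ball R by (cases x) (auto simp only: abs if_True if_False UNIV_I simp_thms)
    moreover have "{p\<in>space PM. \<forall>q\<in>I. W q p \<in> R q} = E s \<times> (if x then E t else space M)"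
      unfolding ball R W E_def sp by (cases x) (auto simp only: abs if_True if_False UNIV_I simp_thms mem_Times_iff mem_Collect_eq fst_conv snd_conv)
    moreover have "R q \<in> sets borel" for q by (cases q) (auto simp: R_def)
    ultimately have "PM.prob (U x) = PM.prob (E s \<times> (if x then E t else space M))"
      using rect[of R] by simp
    then show ?thesis unfolding PM_def by (simp add: measure_pair_rectangle EG)
  qed
  have sub: "U False - U True \<subseteq> G ((t - s) / sqrt 2) \<times> G ((t - s) / sqrt 2)"
  proof (rule subsetI)
    fix p assume p: "p \<in> U False - U True"
    obtain x y where xy: "p = (x, y)" by (cases p)
    from p obtain i where i: "i < N" "\<bar>(Z i x - Z i y) / sqrt 2\<bar> \<le> s" "\<bar>(Z i x + Z i y) / sqrt 2\<bar> > t"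
      and sp': "x \<in> space M" "y \<in> space M"
      by (auto simp: U_def Y_def sp xy)
    have b: "\<bar>Z i x - Z i y\<bar> \<le> s * sqrt 2" "\<bar>Z i x + Z i y\<bar> > t * sqrt 2"
      using i by (simp_all add: abs_divide field_simps)
    have e: "(t - s) / sqrt 2 = (t * sqrt 2 - s * sqrt 2) / 2"
      using real_sqrt_mult_self[of 2] by (simp add: field_simps)
    have "\<bar>Z i x\<bar> > (t - s) / sqrt 2" "\<bar>Z i y\<bar> > (t - s) / sqrt 2"
      using b unfolding e by (auto simp: abs_if split: if_splits)
    then show "p \<in> G ((t - s) / sqrt 2) \<times> G ((t - s) / sqrt 2)"
      using i sp' by (auto simp: G_def xy)
  qed
  have "prob (E s) * prob (G t) = prob (E s) * (1 - prob (E t))"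
  proof -
    have "G t = space M - E t" unfolding G_def E_def by (auto simp: not_le)
    then show ?thesis by (simp add: prob_compl)
  qed
  also have "\<dots> = PM.prob (U False) - PM.prob (U True)"
    by (simp add: Ueq prob_space algebra_simps)
  also have "\<dots> = PM.prob (U False - U True)"
    by (rule PM.finite_measure_Diff[symmetric, OF Um Um]) (unfold U_def, blast)
  also have "\<dots> \<le> PM.prob (G ((t - s) / sqrt 2) \<times> G ((t - s) / sqrt 2))"
    by (intro PM.finite_measure_mono sub) (auto simp: PM_def)
  also have "\<dots> = (prob (G ((t - s) / sqrt 2)))\<^sup>2"
    unfolding PM_def by (simp add: measure_pair_rectangle power2_eq_square)
  finally show ?thesis unfolding E_def G_def .
qed

text \<open>Iterating the previous inequality squares the tail at each step while the level grows by the factor \<open>sqrt 2\<close>, which is a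
Gaussian decay. The constants do not depend on the number of variables.\<close>

lemma fernique_finite:
  fixes Z :: "nat \<Rightarrow> 'a \<Rightarrow> real"
  assumes H: "gaussian_space M H" and Z: "\<And>i. i < N \<Longrightarrow> Z i \<in> H" and s: "0 < s"
    and q: "prob {\<omega>\<in>space M. \<exists>i<N. \<bar>Z i \<omega>\<bar> > s} \<le> 1 / 4" and u: "u \<ge> 1"
  shows "prob {\<omega>\<in>space M. \<exists>i<N. \<bar>Z i \<omega>\<bar> > 6 * s * u} \<le> exp (- u\<^sup>2)"
proof -
  define G where "G = (\<lambda>x. {\<omega>\<in>space M. \<exists>i<N. \<bar>Z i \<omega>\<bar> > x})"
  have Zm[measurable]: "i < N \<Longrightarrow> Z i \<in> borel_measurable M" for i using gaussian_space_measurable[OF H Z] .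
  have Gm[measurable]: "G x \<in> events" for x
    using sets.sets_Collect_finite_Ex[of "{..<N}" M "\<lambda>i \<omega>. x < \<bar>Z i \<omega>\<bar>"]
    unfolding G_def by auto
  have mono: "prob (G y) \<le> prob (G x)" if "x \<le> y" for x y
    by (intro finite_measure_mono) (use that in \<open>force simp: G_def\<close>, simp)
  have "{\<omega>\<in>space M. \<forall>i<N. \<bar>Z i \<omega>\<bar> \<le> s} = space M - G s" unfolding G_def by (auto simp: not_le)
  then have E: "prob {\<omega>\<in>space M. \<forall>i<N. \<bar>Z i \<omega>\<bar> \<le> s} = 1 - prob (G s)" by (simp add: prob_compl)
  have q': "prob (G s) \<le> 1 / 4" using q by (simp only: G_def)
  have step: "3 / 4 * prob (G t) \<le> (prob (G ((t - s) / sqrt 2)))\<^sup>2" for t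
  proof -
    have "3 / 4 * prob (G t) \<le> (1 - prob (G s)) * prob (G t)"
      using q' by (intro mult_right_mono) auto
    also have "\<dots> \<le> (prob (G ((t - s) / sqrt 2)))\<^sup>2"
      using fernique_step[where Z = Z and N = N and s = s and t = t, OF H Z] s
      unfolding E by (simp add: G_def)
    finally show ?thesis .
  qed
  \<comment> \<open>starts at \<open>s\<close> and grows slowly enough: \<open>T k \<le> (T (k + 1) - s) / sqrt 2\<close> amounts to \<open>4 \<le> 3 sqrt 2\<close>\<close>
  define T where "T = (\<lambda>k::nat. 4 * s * sqrt 2 ^ k - 3 * s)"
  have T: "T k \<le> (T (Suc k) - s) / sqrt 2" for k
  proof -
    have "4 / 3 \<le> sqrt (2::real)" by (rule real_le_rsqrt) (simp add: power2_eq_square)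
    then have "4 * s \<le> 3 * s * sqrt 2" using s by simp
    then show ?thesis unfolding T_def by (simp add: field_simps)
  qed
  have dec: "4 / 3 * prob (G (T k)) \<le> (1 / 3) ^ (2 ^ k)" for k
  proof (induction k)
    case 0
    then show ?case using q' by (simp add: T_def)
  next
    case (Suc k)
    have "3 / 4 * prob (G (T (Suc k))) \<le> (prob (G (T k)))\<^sup>2"
      using step[of "T (Suc k)"] power_mono[OF mono[OF T[of k]] measure_nonneg, of 2] by linarith
    then have "4 / 3 * prob (G (T (Suc k))) \<le> (4 / 3 * prob (G (T k)))\<^sup>2"
      by (simp add: power2_eq_square)
    also have "\<dots> \<le> ((1 / 3) ^ (2 ^ k))\<^sup>2" by (intro power_mono Suc) simp
    also have "\<dots> = (1 / 3) ^ (2 ^ Suc k)" by (simp flip: power_mult add: mult.commute)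
    finally show ?case .
  qed
  have "\<exists>k. u\<^sup>2 \<le> 2 ^ k" using real_arch_pow[of 2 "u\<^sup>2"] by (auto intro: less_imp_le)
  \<comment> \<open>minimality gives \<open>2 ^ k \<le> 2 u^2\<close>, so that \<open>T k \<le> 6 s u\<close> since \<open>4 sqrt 2 \<le> 6\<close>\<close>
  define k where "k = (LEAST k. u\<^sup>2 \<le> 2 ^ k)"
  have k: "u\<^sup>2 \<le> 2 ^ k" unfolding k_def by (rule LeastI_ex) fact
  have k2: "2 ^ k \<le> 2 * u\<^sup>2"
  proof (cases k)
    case 0
    have "1 \<le> u\<^sup>2" using u by (simp add: one_le_power)
    then show ?thesis using 0 by simp
  next
    case (Suc j)
    then have "\<not> u\<^sup>2 \<le> 2 ^ j" using not_less_Least[of j "\<lambda>k. u\<^sup>2 \<le> 2 ^ k"] by (simp add: k_def)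
    then show ?thesis using Suc by simp
  qed
  have "sqrt 2 ^ k = sqrt (2 ^ k)" by (simp add: real_sqrt_power)
  also have "\<dots> \<le> sqrt (2 * u\<^sup>2)" using k2 by simp
  also have "\<dots> \<le> 3 / 2 * u" using u by (intro real_le_lsqrt) (auto simp: power_mult_distrib power2_eq_square)
  finally have "4 * s * sqrt 2 ^ k \<le> 4 * s * (3 / 2 * u)" by (rule mult_left_mono) (use s in simp)
  then have "T k \<le> 6 * s * u" unfolding T_def using s by linarith
  then have "prob (G (6 * s * u)) \<le> prob (G (T k))" by (rule mono)
  also have "\<dots> \<le> 4 / 3 * prob (G (T k))" by simp
  also have "\<dots> \<le> (1 / 3) ^ (2 ^ k)" by (rule dec)
  also have "\<dots> \<le> exp (-1) ^ (2 ^ k)"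
    using exp_le by (intro power_mono) (auto simp: exp_minus field_simps)
  also have "\<dots> = exp (- (2 ^ k))" by (simp flip: exp_of_nat_mult)
  also have "\<dots> \<le> exp (- u\<^sup>2)" using k by simp
  finally show ?thesis unfolding G_def .
qed

text \<open>Fernique's theorem: a finite supremum of jointly Gaussian variables has Gaussian tails.\<close>

lemma fernique:
  fixes Z :: "nat \<Rightarrow> 'a \<Rightarrow> real"
  assumes H: "gaussian_space M H" and Z: "\<And>i. Z i \<in> H"
    and bdd: "\<And>\<omega>. \<omega> \<in> space M \<Longrightarrow> \<exists>K. \<forall>i. \<bar>Z i \<omega>\<bar> \<le> K"
  shows "\<exists>K>0. \<forall>u\<ge>1. prob {\<omega>\<in>space M. \<exists>i. \<bar>Z i \<omega>\<bar> > K * u} \<le> exp (- u\<^sup>2)"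
proof -
  have Zm[measurable]: "Z i \<in> borel_measurable M" for i using gaussian_space_measurable[OF H Z] .
  define E where "E = (\<lambda>k::nat. {\<omega>\<in>space M. \<exists>i. \<bar>Z i \<omega>\<bar> > real k})"
  have Em: "E k \<in> events" for k unfolding E_def by measurable
  have "(\<lambda>k. prob (E k)) \<longlonglongrightarrow> prob (\<Inter>k. E k)"
  proof (rule finite_Lim_measure_decseq)
    show "range E \<subseteq> events" using Em by auto
    show "decseq E" by (rule antimonoI) (auto simp: E_def, meson le_less_trans of_nat_le_iff)
  qed
  moreover have "(\<Inter>k. E k) = {}"
  proof -
    have False if "\<omega> \<in> (\<Inter>k. E k)" for \<omega>
    proof -
      have "\<omega> \<in> space M" using that by (auto simp: E_def)
      then obtain K where "\<And>i. \<bar>Z i \<omega>\<bar> \<le> K" using bdd by blast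
      moreover obtain k :: nat where "K \<le> real k" using real_arch_simple by blast
      ultimately have "\<omega> \<notin> E k" unfolding E_def by (auto simp: not_less intro: order_trans)
      then show False using that by blast
    qed
    then show ?thesis by blast
  qed
  ultimately have "(\<lambda>k. prob (E k)) \<longlonglongrightarrow> 0" by simp
  then have "\<forall>\<^sub>F k in sequentially. prob (E k) < 1 / 4" by (rule order_tendstoD) simp
  then have "\<forall>\<^sub>F k in sequentially. prob (E k) < 1 / 4 \<and> k > 0"
    by (intro eventually_conj eventually_gt_at_top)
  then obtain k where k: "prob (E k) < 1 / 4" "k > 0" using eventually_happens'[of sequentially] by auto
  define s where "s = real k"
  have s: "s > 0" using k by (simp add: s_def)
  show ?thesis
  proof (intro exI[of _ "6 * s"] conjI allI impI)
    fix u :: real assume u: "u \<ge> 1"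
    define F where "F = (\<lambda>N::nat. {\<omega>\<in>space M. \<exists>i<N. \<bar>Z i \<omega>\<bar> > 6 * s * u})"
    have "prob (F N) \<le> exp (- u\<^sup>2)" for N
      unfolding F_def
    proof (rule fernique_finite[OF H Z s _ u])
      have "prob {\<omega>\<in>space M. \<exists>i<N. \<bar>Z i \<omega>\<bar> > s} \<le> prob (E k)"
        by (intro finite_measure_mono Em) (auto simp: E_def s_def)
      then show "prob {\<omega>\<in>space M. \<exists>i<N. \<bar>Z i \<omega>\<bar> > s} \<le> 1 / 4" using k by simp
    qed
    moreover have "(\<lambda>N. prob (F N)) \<longlonglongrightarrow> prob (\<Union>N. F N)"
    proof (rule finite_Lim_measure_incseq)
      show "range F \<subseteq> events"
        using sets.sets_Collect_finite_Ex[of "{..<N}" M "\<lambda>i \<omega>. 6 * s * u < \<bar>Z i \<omega>\<bar>" for N]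
        unfolding F_def by auto
      show "incseq F" unfolding F_def by (rule monoI) (blast intro: order_less_le_trans)
    qed
    moreover have "(\<Union>N. F N) = {\<omega>\<in>space M. \<exists>i. \<bar>Z i \<omega>\<bar> > 6 * s * u}"
      unfolding F_def by auto
    ultimately show "prob {\<omega>\<in>space M. \<exists>i. \<bar>Z i \<omega>\<bar> > 6 * s * u} \<le> exp (- u\<^sup>2)"
      by (metis (no_types, lifting) LIMSEQ_le_const2)
  qed (use s in simp)
qed

end

section \<open>The field and its derivatives\<close>

text \<open>The coordinates of \<open>gradient\<close>, as a map that can be iterated.\<close>

definition partial :: "'n \<Rightarrow> (real^'n \<Rightarrow> real) \<Rightarrow> real^'n \<Rightarrow> real" where
  "partial i f t = frechet_derivative f (at t) (axis i 1)"

lemma gradient_nth: "gradient f t $ i = partial i f t"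
  by (simp add: gradient_def partial_def)

lemma class_C_partial: "class_C (Suc k) f \<Longrightarrow> class_C k (partial i f)"
  unfolding partial_def[abs_def] by simp

lemma class_C_has_derivative:
  assumes "class_C (Suc k) f"
  shows "(f has_derivative (\<lambda>v. \<Sum>i\<in>UNIV. v $ i * partial i f t)) (at t)"
proof -
  have d: "(f has_derivative frechet_derivative f (at t)) (at t)"
    using assms by (auto simp: differentiable_on_def frechet_derivative_works)
  then interpret bounded_linear "frechet_derivative f (at t)" by (rule has_derivative_bounded_linear)
  have "frechet_derivative f (at t) v = (\<Sum>i\<in>UNIV. v $ i * partial i f t)" for v
  proof -
    have "v = (\<Sum>i\<in>UNIV. v $ i *\<^sub>R axis i 1)"
      by (simp add: vec_eq_iff axis_def sum.delta' if_distrib cong: if_cong)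
    then have "frechet_derivative f (at t) v = frechet_derivative f (at t) (\<Sum>i\<in>UNIV. v $ i *\<^sub>R axis i 1)" by simp
    also have "\<dots> = (\<Sum>i\<in>UNIV. v $ i * partial i f t)"
      by (simp add: sum scaleR partial_def)
    finally show ?thesis .
  qed
  then have "frechet_derivative f (at t) = (\<lambda>v. \<Sum>i\<in>UNIV. v $ i * partial i f t)" by (rule ext)
  then show ?thesis using d by (simp only:)
qed

lemma class_C_continuous: "class_C k f \<Longrightarrow> continuous_on UNIV f"
  by (cases k) (auto intro: differentiable_imp_continuous_on)

lemma class_C_difference_quotient:
  assumes f: "class_C (Suc k) f" and h: "h \<longlonglongrightarrow> 0" "\<And>n. h n \<noteq> (0::real)"
  shows "(\<lambda>n. (f (t + h n *\<^sub>R axis i 1) - f t) / h n) \<longlonglongrightarrow> partial i f t"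
proof -
  have "((\<lambda>x. f (t + x *\<^sub>R axis i 1)) has_derivative (\<lambda>x. \<Sum>j\<in>UNIV. (x *\<^sub>R axis i 1) $ j * partial j f t)) (at 0)"
    by (rule has_derivative_compose[of "\<lambda>x. t + x *\<^sub>R axis i 1", OF _ class_C_has_derivative[OF f, THEN has_derivative_eq_rhs], simplified])
      (auto intro!: derivative_eq_intros)
  moreover have "(\<lambda>x. \<Sum>j\<in>UNIV. (x *\<^sub>R axis i 1) $ j * partial j f t) = (\<lambda>x. x * partial i f t)"
    by (rule ext) (simp add: axis_def if_distrib[of "\<lambda>y. _ * y"] if_distrib[of "\<lambda>y. y * _"] cong: if_cong)
  ultimately have "((\<lambda>x. f (t + x *\<^sub>R axis i 1)) has_field_derivative partial i f t) (at 0)"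
    by (simp only: has_field_derivative_def mult_commute_abs)
  then have "(\<lambda>x. (f (t + x *\<^sub>R axis i 1) - f t) / x) \<midarrow>0\<rightarrow> partial i f t"
    by (simp add: DERIV_def)
  moreover have "filterlim h (at 0) sequentially"
    using h by (simp add: filterlim_at)
  ultimately show ?thesis by (rule filterlim_compose)
qed

context prob_space
begin

lemma partial_in_limit_closure:
  fixes Y :: "real^'n \<Rightarrow> 'a \<Rightarrow> real"
  assumes H: "gaussian_space M H" and Y: "\<And>t. Y t \<in> H"
    and C: "\<And>\<omega>. \<omega> \<in> space M \<Longrightarrow> class_C (Suc k) (\<lambda>t. Y t \<omega>)"
  shows "(\<lambda>\<omega>. partial i (\<lambda>t. Y t \<omega>) t) \<in> limit_closure M H"
proof -
  define h where "h = (\<lambda>n. inverse (real (Suc n)))"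
  have h: "h \<longlonglongrightarrow> 0" "\<And>n. h n \<noteq> 0" by (simp_all add: h_def LIMSEQ_inverse_real_of_nat del: of_nat_Suc)
  have "(\<lambda>\<omega>. (Y (t + h n *\<^sub>R axis i 1) \<omega> - Y t \<omega>) / h n) \<in> H" for n
    by (rule gaussian_space_add(4)[OF H gaussian_space_add(2)[OF H Y Y] Y])
  then show ?thesis
    unfolding limit_closure_def
    using class_C_difference_quotient[OF C h]
    by (auto intro!: exI[of _ "\<lambda>n \<omega>. (Y (t + h n *\<^sub>R axis i 1) \<omega> - Y t \<omega>) / h n"])
qed

lemma continuous_second_moment:
  fixes Y :: "'t::metric_space \<Rightarrow> 'a \<Rightarrow> real"
  assumes H: "gaussian_space M H" and Y: "\<And>t. Y t \<in> H"
    and C: "\<And>\<omega>. \<omega> \<in> space M \<Longrightarrow> continuous_on UNIV (\<lambda>t. Y t \<omega>)"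
  shows "continuous_on UNIV (\<lambda>t. expectation (\<lambda>\<omega>. (Y t \<omega>)\<^sup>2))"
proof (rule continuous_at_imp_continuous_on, intro ballI, rule continuous_at_sequentiallyI)
  fix t :: 't and x :: "nat \<Rightarrow> 't" assume x: "x \<longlonglongrightarrow> t"
  show "(\<lambda>n. expectation (\<lambda>\<omega>. (Y (x n) \<omega>)\<^sup>2)) \<longlonglongrightarrow> expectation (\<lambda>\<omega>. (Y t \<omega>)\<^sup>2)"
  proof (rule gaussian_space_second_moment_tendsto[OF H Y])
    fix \<omega> assume "\<omega> \<in> space M"
    from C[OF this] have "isCont (\<lambda>t. Y t \<omega>) t" by (simp add: continuous_on_eq_continuous_at)
    then show "(\<lambda>n. Y (x n) \<omega>) \<longlonglongrightarrow> Y t \<omega>" using x by (rule isCont_tendsto_compose)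
  qed
qed

text \<open>Fernique's theorem for a countable dense set of parameters, extended by continuity. The event \<open>E\<close> is
defined by the dense set and so is measurable.\<close>

lemma sup_tail:
  fixes Y :: "'t::euclidean_space \<Rightarrow> 'a \<Rightarrow> real"
  assumes H: "gaussian_space M H" and Y: "\<And>t. Y t \<in> H"
    and C: "\<And>\<omega>. \<omega> \<in> space M \<Longrightarrow> continuous_on UNIV (\<lambda>t. Y t \<omega>)"
    and B: "compact B" "B \<noteq> {}"
  shows "\<exists>K>0. \<forall>u\<ge>1. \<exists>E\<in>events. prob E \<le> exp (- u\<^sup>2) \<and> (\<forall>\<omega>\<in>space M - E. \<forall>t\<in>B. \<bar>Y t \<omega>\<bar> \<le> K * u)"
proof -
  obtain D where D: "countable D" "D \<subseteq> B" "B \<subseteq> closure D" using separable by blast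
  then have Dne: "D \<noteq> {}" using B by auto
  define Z where "Z = (\<lambda>i. Y (from_nat_into D i))"
  have range: "range (from_nat_into D) = D" using Dne D(1) by (rule range_from_nat_into)
  have "\<exists>K. \<forall>i. \<bar>Z i \<omega>\<bar> \<le> K" if "\<omega> \<in> space M" for \<omega>
  proof -
    have "compact ((\<lambda>t. Y t \<omega>) ` B)"
      by (intro compact_continuous_image continuous_on_subset[OF C[OF that]] B) auto
    then have "bounded ((\<lambda>t. Y t \<omega>) ` B)" by (rule compact_imp_bounded)
    then obtain K where "\<forall>t\<in>B. \<bar>Y t \<omega>\<bar> \<le> K" by (auto simp: bounded_iff)
    then show ?thesis using D(2) from_nat_into[OF Dne] unfolding Z_def by blast
  qed
  note bdd = this
  have Zin: "Z i \<in> H" for i unfolding Z_def by (rule Y)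
  obtain K where K: "K > 0" "\<And>u. u \<ge> 1 \<Longrightarrow> prob {\<omega>\<in>space M. \<exists>i. \<bar>Z i \<omega>\<bar> > K * u} \<le> exp (- u\<^sup>2)"
    using fernique[OF H Zin bdd] by blast
  have Zm[measurable]: "Z i \<in> borel_measurable M" for i unfolding Z_def by (rule gaussian_space_measurable[OF H Y])
  show ?thesis
  proof (intro exI[of _ K] conjI allI impI K(1))
    fix u :: real assume u: "u \<ge> 1"
    define E where "E = {\<omega>\<in>space M. \<exists>i. \<bar>Z i \<omega>\<bar> > K * u}"
    show "\<exists>E\<in>events. prob E \<le> exp (- u\<^sup>2) \<and> (\<forall>\<omega>\<in>space M - E. \<forall>t\<in>B. \<bar>Y t \<omega>\<bar> \<le> K * u)"
    proof (intro bexI[of _ E] conjI ballI)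
      show "E \<in> events" unfolding E_def by measurable
      show "prob E \<le> exp (- u\<^sup>2)" unfolding E_def by (rule K(2)[OF u])
      fix \<omega> t assume \<omega>: "\<omega> \<in> space M - E" and t: "t \<in> B"
      have le: "\<bar>Y d \<omega>\<bar> \<le> K * u" if "d \<in> D" for d
      proof -
        have "d \<in> range (from_nat_into D)" using range that by simp
        then obtain i where "d = from_nat_into D i" by (rule rangeE)
        then show ?thesis using \<omega> by (auto simp: E_def Z_def not_less)
      qed
      have "continuous_on (closure D) (\<lambda>t. \<bar>Y t \<omega>\<bar>)"
        using C \<omega> by (auto intro: continuous_on_subset intro!: continuous_intros)
      then show "\<bar>Y t \<omega>\<bar> \<le> K * u"
        by (rule continuous_le_on_closure[where S = D]) (use t D le in auto)
    qed
  qed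
qed

end

text \<open>The linear span of the values of the field; the derivatives of order up to three lie in its threefold limit closure \<open>H\<close> below.\<close>

definition finite_combinations :: "(real^'n \<Rightarrow> 'w \<Rightarrow> real) \<Rightarrow> ('w \<Rightarrow> real) set" where
  "finite_combinations X = {\<lambda>\<omega>. \<Sum>t\<in>T. a t * X t \<omega> | T a. finite T}"

locale smooth_gaussian_field = prob_space M for M :: "'w measure" +
  fixes X :: "real^'n \<Rightarrow> 'w \<Rightarrow> real"
  assumes gaussian: "gaussian_field M X" and centered: "centered_field M X" and stationary: "stationary_field M X"
    and smooth: "\<forall>\<omega>\<in>space M. class_C 3 (\<lambda>t. X t \<omega>)"
    and var1: "\<forall>t. (\<integral>\<omega>. (X t \<omega> - (\<integral>\<omega>'. X t \<omega>' \<partial>M))\<^sup>2 \<partial>M) = 1"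
    and vargrad: "\<forall>t. variance_matrix M (\<lambda>\<omega>. gradient (\<lambda>t. X t \<omega>) t) = mat 1"
begin

definition "X1 i t \<omega> = partial i (\<lambda>t. X t \<omega>) t"
definition "X2 i j t \<omega> = partial j (\<lambda>t. X1 i t \<omega>) t"
definition "X3 i j k t \<omega> = partial k (\<lambda>t. X2 i j t \<omega>) t"

lemma class_C_derivs:
  assumes "\<omega> \<in> space M"
  shows "class_C 3 (\<lambda>t. X t \<omega>)" "class_C 2 (\<lambda>t. X1 i t \<omega>)" "class_C 1 (\<lambda>t. X2 i j t \<omega>)" "class_C 0 (\<lambda>t. X3 i j k t \<omega>)"
proof -
  have e: "(3::nat) = Suc 2" "(2::nat) = Suc 1" "(1::nat) = Suc 0" by simp_all
  show 3: "class_C 3 (\<lambda>t. X t \<omega>)" using smooth assms by blast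
  then show 2: "class_C 2 (\<lambda>t. X1 i t \<omega>)" for i
    unfolding X1_def e(1) by (rule class_C_partial)
  then show 1: "class_C 1 (\<lambda>t. X2 i j t \<omega>)" for i j
    unfolding X2_def e(2) by (intro class_C_partial)
  then show "class_C 0 (\<lambda>t. X3 i j k t \<omega>)"
    unfolding X3_def e(3) by (intro class_C_partial)
qed

lemma class_C_Suc:
  assumes "\<omega> \<in> space M"
  shows "class_C (Suc 2) (\<lambda>t. X t \<omega>)" "class_C (Suc 1) (\<lambda>t. X1 i t \<omega>)" "class_C (Suc 0) (\<lambda>t. X2 i j t \<omega>)"
proof -
  have e: "Suc 2 = 3" "Suc 1 = 2" "Suc 0 = 1" by simp_all
  show "class_C (Suc 2) (\<lambda>t. X t \<omega>)" unfolding e by (rule class_C_derivs[OF assms])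
  show "class_C (Suc 1) (\<lambda>t. X1 i t \<omega>)" unfolding e by (rule class_C_derivs[OF assms])
  show "class_C (Suc 0) (\<lambda>t. X2 i j t \<omega>)" unfolding e by (rule class_C_derivs[OF assms])
qed

lemma finite_combinations_gaussian: "gaussian_space M (finite_combinations X)"
  unfolding gaussian_space_def
proof (intro conjI ballI allI)
  show "(\<lambda>_. 0) \<in> finite_combinations X"
    unfolding finite_combinations_def by (auto intro!: exI[of _ "{}"])
next
  fix Y Z a b assume "Y \<in> finite_combinations X" "Z \<in> finite_combinations X"
  then obtain T1 c1 T2 c2 where YZ: "Y = (\<lambda>\<omega>. \<Sum>t\<in>T1. c1 t * X t \<omega>)" "Z = (\<lambda>\<omega>. \<Sum>t\<in>T2. c2 t * X t \<omega>)"
    and fin: "finite T1" "finite T2"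
    unfolding finite_combinations_def by blast
  define c where "c = (\<lambda>t. a * (if t \<in> T1 then c1 t else 0) + b * (if t \<in> T2 then c2 t else 0))"
  have "a * Y \<omega> + b * Z \<omega> = (\<Sum>t\<in>T1 \<union> T2. c t * X t \<omega>)" for \<omega>
  proof -
    have "(\<Sum>t\<in>T1 \<union> T2. c t * X t \<omega>) = a * (\<Sum>t\<in>T1 \<union> T2. if t \<in> T1 then c1 t * X t \<omega> else 0)
        + b * (\<Sum>t\<in>T1 \<union> T2. if t \<in> T2 then c2 t * X t \<omega> else 0)"
      unfolding c_def sum_distrib_left sum.distrib[symmetric] by (intro sum.cong refl) (simp add: algebra_simps)
    also have "\<dots> = a * Y \<omega> + b * Z \<omega>"
      unfolding YZ using fin
      by (intro arg_cong2[where f = "\<lambda>x y. a * x + b * y"] sum.mono_neutral_cong_right) auto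
    finally show ?thesis ..
  qed
  then show "(\<lambda>\<omega>. a * Y \<omega> + b * Z \<omega>) \<in> finite_combinations X"
    unfolding finite_combinations_def using fin by (auto intro!: exI[of _ "T1 \<union> T2"] exI[of _ c])
next
  fix Y assume "Y \<in> finite_combinations X"
  then obtain T c where Y: "Y = (\<lambda>\<omega>. \<Sum>t\<in>T. c t * X t \<omega>)" and fin: "finite T"
    unfolding finite_combinations_def by blast
  have g: "gaussian_rv M Y" using gaussian fin unfolding gaussian_field_def Y by blast
  then show m[measurable]: "Y \<in> borel_measurable M" by (simp add: gaussian_rv_def)
  have EY: "expectation Y = 0"
    using centered unfolding Y centered_field_def by simp
  from g obtain \<mu> \<sigma> where \<sigma>: "0 \<le> \<sigma>" "distr M borel Y =
        (if \<sigma> = 0 then return borel \<mu> else density lborel (\<lambda>x. ennreal (normal_density \<mu> \<sigma> x)))"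
    unfolding gaussian_rv_def by blast
  show "\<exists>v\<ge>0. \<forall>b. (CLINT \<omega>|M. iexp (b * Y \<omega>)) = exp (- (v * b\<^sup>2 / 2))"
  proof (intro exI[of _ "\<sigma>\<^sup>2"] conjI allI)
    fix b :: real
    have cl: "(CLINT \<omega>|M. iexp (b * Y \<omega>)) = (CLINT x|distr M borel Y. iexp (b * x))"
      by (subst integral_distr) auto
    show "(CLINT \<omega>|M. iexp (b * Y \<omega>)) = exp (- (\<sigma>\<^sup>2 * b\<^sup>2 / 2))"
    proof (cases "\<sigma> = 0")
      case True
      have "expectation Y = (LINT x|distr M borel Y. x)" by (subst integral_distr) auto
      also have "\<dots> = \<mu>" using True \<sigma>(2) by (simp add: integral_return)
      finally have "\<mu> = 0" using EY by simp
      then show ?thesis unfolding cl using True \<sigma>(2) by (simp add: integral_return)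
    next
      case False
      then have s: "\<sigma> > 0" using \<sigma> by simp
      have d: "distributed M lborel Y (normal_density \<mu> \<sigma>)"
        using False \<sigma>(2) by (auto simp: distributed_def cong: distr_cong)
      have "\<mu> = 0" using normal_distributed_expectation[OF s d] EY by simp
      then have "distributed M lborel (\<lambda>\<omega>. Y \<omega> / \<sigma>) std_normal_density"
        using d normal_standard_normal_convert[OF s, of Y \<mu>] by simp
      then have ds: "distr M lborel (\<lambda>\<omega>. Y \<omega> / \<sigma>) = std_normal_distribution" by (simp add: distributed_def)
      have "(CLINT \<omega>|M. iexp (b * Y \<omega>)) = (CLINT \<omega>|M. iexp (b * \<sigma> * (Y \<omega> / \<sigma>)))" using s by simp
      also have "\<dots> = (CLINT x|distr M lborel (\<lambda>\<omega>. Y \<omega> / \<sigma>). iexp (b * \<sigma> * x))" by (subst integral_distr) auto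
      also have "\<dots> = char std_normal_distribution (b * \<sigma>)" unfolding ds char_def by simp
      also have "\<dots> = exp (- (\<sigma>\<^sup>2 * b\<^sup>2 / 2))" by (simp add: char_std_normal_distribution power_mult_distrib mult.commute)
      finally show ?thesis .
    qed
  qed simp
qed

definition "H0 = finite_combinations X"
definition "H1 = limit_closure M H0"
definition "H2 = limit_closure M H1"
definition "H = limit_closure M H2"

lemma gaussian_H: "gaussian_space M H0" "gaussian_space M H1" "gaussian_space M H2" "gaussian_space M H"
  unfolding H0_def H1_def H2_def H_def
  by (intro gaussian_space_limit_closure finite_combinations_gaussian)+

lemma H_mono: "H0 \<subseteq> H1" "H1 \<subseteq> H2" "H2 \<subseteq> H"
  unfolding H1_def H2_def H_def by (rule subset_limit_closure)+

lemma X_in_H0: "X t \<in> H0"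
  unfolding H0_def finite_combinations_def
  by (intro CollectI exI[of _ "{t}"] exI[of _ "\<lambda>_. 1"]) simp

lemma X1_in_H1: "X1 i t \<in> H1"
proof -
  have "(\<lambda>\<omega>. partial i (\<lambda>t. X t \<omega>) t) \<in> limit_closure M H0"
    by (rule partial_in_limit_closure[OF gaussian_H(1) X_in_H0 class_C_Suc(1)])
  then show ?thesis by (simp add: H1_def X1_def[abs_def])
qed

lemma X2_in_H2: "X2 i j t \<in> H2"
proof -
  have "(\<lambda>\<omega>. partial j (\<lambda>t. X1 i t \<omega>) t) \<in> limit_closure M H1"
    by (rule partial_in_limit_closure[OF gaussian_H(2) X1_in_H1 class_C_Suc(2)])
  then show ?thesis by (simp add: H2_def X2_def[abs_def])
qed

lemma in_H: "X t \<in> H" "X1 i t \<in> H" "X2 i j t \<in> H" "X3 i j k t \<in> H"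
proof -
  have "(\<lambda>\<omega>. partial k (\<lambda>t. X2 i j t \<omega>) t) \<in> limit_closure M H2"
    by (rule partial_in_limit_closure[OF gaussian_H(3) X2_in_H2 class_C_Suc(3)])
  then show "X3 i j k t \<in> H" by (simp add: H_def X3_def[abs_def])
qed (use X_in_H0 X1_in_H1 X2_in_H2 H_mono in blast)+

lemma X_measurable[measurable]: "X t \<in> borel_measurable M" "X1 i t \<in> borel_measurable M" "X2 i j t \<in> borel_measurable M"
  using gaussian_space_measurable[OF gaussian_H(4) in_H(1)] gaussian_space_measurable[OF gaussian_H(4) in_H(2)]
   gaussian_space_measurable[OF gaussian_H(4) in_H(3)] by auto

lemma integrable_mult_H: "Y \<in> H \<Longrightarrow> Z \<in> H \<Longrightarrow> integrable M (\<lambda>\<omega>. Y \<omega> * Z \<omega>)"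
  by (rule gaussian_space_integrable_mult[OF gaussian_H(4)])

lemma mean0: "Y \<in> H \<Longrightarrow> expectation Y = 0"
  by (rule gaussian_space_moments[OF gaussian_H(4)])

lemma var_X: "expectation (\<lambda>\<omega>. (X t \<omega>)\<^sup>2) = 1"
  using var1 mean0[OF in_H(1)] by simp

lemma cov_X1: "expectation (\<lambda>\<omega>. X1 i t \<omega> * X1 j t \<omega>) = (if i = j then 1 else 0)"
proof -
  have "variance_matrix M (\<lambda>\<omega>. gradient (\<lambda>t. X t \<omega>) t) $ i $ j = mat 1 $ i $ j" using vargrad by simp
  then show ?thesis
    using mean0[OF in_H(2)]
    by (simp add: variance_matrix_def gradient_nth mat_def X1_def[symmetric, abs_def])
qed

lemma cov_X_shift: "expectation (\<lambda>\<omega>. X (s + h) \<omega> * X (t + h) \<omega>) = expectation (\<lambda>\<omega>. X s \<omega> * X t \<omega>)"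
proof -
  have e: "expectation (\<lambda>\<omega>. Y s \<omega> * Y t \<omega>) =
     (LINT x|distr M (\<Pi>\<^sub>M t\<in>{s, t}. borel) (\<lambda>\<omega>. \<lambda>t\<in>{s, t}. Y t \<omega>). x s * x t)"
    if [measurable]: "\<And>t. Y t \<in> borel_measurable M" for Y :: "real^'n \<Rightarrow> 'w \<Rightarrow> real"
    by (subst integral_distr) (auto intro!: measurable_restrict)
  have "distr M (\<Pi>\<^sub>M t\<in>{s, t}. borel) (\<lambda>\<omega>. \<lambda>t\<in>{s, t}. X (t + h) \<omega>) =
        distr M (\<Pi>\<^sub>M t\<in>{s, t}. borel) (\<lambda>\<omega>. \<lambda>t\<in>{s, t}. X t \<omega>)"
    by (rule stationary[unfolded stationary_field_def, rule_format]) simp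
  then show ?thesis using e[of "\<lambda>t. X (t + h)"] e[of X] by (simp only: X_measurable)
qed

abbreviation "hseq n \<equiv> inverse (real (Suc n))"

lemma hseq: "(\<lambda>n. hseq n) \<longlonglongrightarrow> 0" "(\<lambda>n. - hseq n) \<longlonglongrightarrow> 0" "hseq n \<noteq> 0" "- hseq n \<noteq> 0"
  using LIMSEQ_inverse_real_of_nat tendsto_minus[OF LIMSEQ_inverse_real_of_nat]
  by (simp_all del: of_nat_Suc)

lemma X1_limit:
  assumes "\<omega> \<in> space M" "h \<longlonglongrightarrow> 0" "\<And>n. h n \<noteq> 0"
  shows "(\<lambda>n. (X (t + h n *\<^sub>R axis i 1) \<omega> - X t \<omega>) / h n) \<longlonglongrightarrow> X1 i t \<omega>"
  unfolding X1_def
  by (rule class_C_difference_quotient[OF class_C_Suc(1)[OF assms(1)] assms(2,3)])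

lemma X2_limit:
  assumes "\<omega> \<in> space M" "h \<longlonglongrightarrow> 0" "\<And>n. h n \<noteq> 0"
  shows "(\<lambda>n. (X1 i (t + h n *\<^sub>R axis j 1) \<omega> - X1 i t \<omega>) / h n) \<longlonglongrightarrow> X2 i j t \<omega>"
  unfolding X2_def
  by (rule class_C_difference_quotient[OF class_C_Suc(2)[OF assms(1)] assms(2,3)])

text \<open>Difference quotients of covariances compute covariances with derivatives.\<close>

lemma cov_quotient_X1:
  assumes Y: "Y \<in> H" and h: "h \<longlonglongrightarrow> 0" "\<And>n. h n \<noteq> 0"
  shows "(\<lambda>n. (expectation (\<lambda>\<omega>. Y \<omega> * X (t + h n *\<^sub>R axis i 1) \<omega>) - expectation (\<lambda>\<omega>. Y \<omega> * X t \<omega>)) / h n)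
    \<longlonglongrightarrow> expectation (\<lambda>\<omega>. Y \<omega> * X1 i t \<omega>)"
proof -
  have "(\<lambda>n. expectation (\<lambda>\<omega>. Y \<omega> * ((X (t + h n *\<^sub>R axis i 1) \<omega> - X t \<omega>) / h n)))
    \<longlonglongrightarrow> expectation (\<lambda>\<omega>. Y \<omega> * X1 i t \<omega>)"
    by (rule gaussian_space_covariance_tendsto[OF gaussian_H(4)])
      (auto intro!: Y X1_limit h gaussian_space_add(2)[OF gaussian_H(4)] gaussian_space_add(4)[OF gaussian_H(4) _ Y] in_H)
  moreover have "expectation (\<lambda>\<omega>. Y \<omega> * ((X (t + h n *\<^sub>R axis i 1) \<omega> - X t \<omega>) / h n))
     = (expectation (\<lambda>\<omega>. Y \<omega> * X (t + h n *\<^sub>R axis i 1) \<omega>) - expectation (\<lambda>\<omega>. Y \<omega> * X t \<omega>)) / h n" for n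
    by (simp add: right_diff_distrib integrable_mult_H Y in_H)
  ultimately show ?thesis by (rule Lim_transform_eventually[OF _ always_eventually, rule_format])
qed

lemma cov_X_X1_shift: "expectation (\<lambda>\<omega>. X (s + v) \<omega> * X1 i (t + v) \<omega>) = expectation (\<lambda>\<omega>. X s \<omega> * X1 i t \<omega>)"
proof (rule LIMSEQ_unique)
  show "(\<lambda>n. (expectation (\<lambda>\<omega>. X s \<omega> * X (t + hseq n *\<^sub>R axis i 1) \<omega>) - expectation (\<lambda>\<omega>. X s \<omega> * X t \<omega>)) / hseq n)
    \<longlonglongrightarrow> expectation (\<lambda>\<omega>. X s \<omega> * X1 i t \<omega>)"
    by (rule cov_quotient_X1[OF in_H(1) hseq(1,3)])
  have "expectation (\<lambda>\<omega>. X (s + v) \<omega> * X (t + v + w) \<omega>) = expectation (\<lambda>\<omega>. X s \<omega> * X (t + w) \<omega>)" for w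
    using cov_X_shift[of s v "t + w"] by (simp add: add_ac)
  from this this[of 0]
  show "(\<lambda>n. (expectation (\<lambda>\<omega>. X s \<omega> * X (t + hseq n *\<^sub>R axis i 1) \<omega>) - expectation (\<lambda>\<omega>. X s \<omega> * X t \<omega>)) / hseq n)
    \<longlonglongrightarrow> expectation (\<lambda>\<omega>. X (s + v) \<omega> * X1 i (t + v) \<omega>)"
    using cov_quotient_X1[OF in_H(1) hseq(1,3), of "s + v" "t + v" i] by simp
qed

text \<open>By stationarity the covariance function is even, so its derivative at \<open>0\<close> equals its own negative.\<close>

lemma cov_X_X1: "expectation (\<lambda>\<omega>. X t \<omega> * X1 i t \<omega>) = 0"
proof -
  define q where "q = (\<lambda>h. (expectation (\<lambda>\<omega>. X t \<omega> * X (t + h *\<^sub>R axis i 1) \<omega>) - expectation (\<lambda>\<omega>. X t \<omega> * X t \<omega>)))"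
  have even: "q (- h) = q h" for h
    using cov_X_shift[of t "h *\<^sub>R axis i 1" "t + (-h) *\<^sub>R axis i 1"] by (simp add: q_def mult.commute)
  have "(\<lambda>n. q (hseq n) / hseq n) \<longlonglongrightarrow> expectation (\<lambda>\<omega>. X t \<omega> * X1 i t \<omega>)"
    unfolding q_def by (rule cov_quotient_X1[OF in_H(1) hseq(1,3)])
  then have 1: "(\<lambda>n. - (q (hseq n) / hseq n)) \<longlonglongrightarrow> - expectation (\<lambda>\<omega>. X t \<omega> * X1 i t \<omega>)" by (rule tendsto_minus)
  have "(\<lambda>n. q (- hseq n) / (- hseq n)) \<longlonglongrightarrow> expectation (\<lambda>\<omega>. X t \<omega> * X1 i t \<omega>)"
    unfolding q_def by (rule cov_quotient_X1[OF in_H(1) hseq(2,4)])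
  then have "(\<lambda>n. - (q (hseq n) / hseq n)) \<longlonglongrightarrow> expectation (\<lambda>\<omega>. X t \<omega> * X1 i t \<omega>)"
    by (simp only: even divide_minus_right)
  from LIMSEQ_unique[OF this 1] show ?thesis by simp
qed

text \<open>Shifting the second derivative from one factor to the other by stationarity changes the sign and leaves the
covariance of two first derivatives.\<close>

lemma cov_X_X2: "expectation (\<lambda>\<omega>. X t \<omega> * X2 i j t \<omega>) = - (if i = j then 1 else 0)"
proof (rule LIMSEQ_unique)
  show "(\<lambda>n. expectation (\<lambda>\<omega>. X t \<omega> * ((X1 i (t + hseq n *\<^sub>R axis j 1) \<omega> - X1 i t \<omega>) / hseq n)))
     \<longlonglongrightarrow> expectation (\<lambda>\<omega>. X t \<omega> * X2 i j t \<omega>)"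
    by (rule gaussian_space_covariance_tendsto[OF gaussian_H(4)])
      (auto intro!: X2_limit hseq gaussian_space_add(2)[OF gaussian_H(4)] gaussian_space_add(4)[OF gaussian_H(4) _ in_H(1)[of t]] in_H
        simp del: of_nat_Suc)
  have eq: "- ((expectation (\<lambda>\<omega>. X1 i t \<omega> * X (t + (- hseq n) *\<^sub>R axis j 1) \<omega>)
       - expectation (\<lambda>\<omega>. X1 i t \<omega> * X t \<omega>)) / (- hseq n))
      = expectation (\<lambda>\<omega>. X t \<omega> * ((X1 i (t + hseq n *\<^sub>R axis j 1) \<omega> - X1 i t \<omega>) / hseq n))" for n
  proof -
    define h where "h = hseq n"
    have "expectation (\<lambda>\<omega>. X t \<omega> * ((X1 i (t + h *\<^sub>R axis j 1) \<omega> - X1 i t \<omega>) / h)) =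
       (expectation (\<lambda>\<omega>. X t \<omega> * X1 i (t + h *\<^sub>R axis j 1) \<omega>) - expectation (\<lambda>\<omega>. X t \<omega> * X1 i t \<omega>)) / h"
      by (simp add: right_diff_distrib integrable_mult_H in_H)
    moreover have "expectation (\<lambda>\<omega>. X t \<omega> * X1 i (t + h *\<^sub>R axis j 1) \<omega>)
       = expectation (\<lambda>\<omega>. X1 i t \<omega> * X (t + (-h) *\<^sub>R axis j 1) \<omega>)"
      using cov_X_X1_shift[of "t + (-h) *\<^sub>R axis j 1" "h *\<^sub>R axis j 1" i t] by (simp add: mult.commute)
    moreover have "expectation (\<lambda>\<omega>. X t \<omega> * X1 i t \<omega>) = expectation (\<lambda>\<omega>. X1 i t \<omega> * X t \<omega>)"
      by (simp add: mult.commute)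
    moreover have "h \<noteq> 0" by (simp add: h_def)
    ultimately show ?thesis unfolding h_def[symmetric] by simp
  qed
  have "(\<lambda>n. - ((expectation (\<lambda>\<omega>. X1 i t \<omega> * X (t + (- hseq n) *\<^sub>R axis j 1) \<omega>)
       - expectation (\<lambda>\<omega>. X1 i t \<omega> * X t \<omega>)) / (- hseq n)))
     \<longlonglongrightarrow> - expectation (\<lambda>\<omega>. X1 i t \<omega> * X1 j t \<omega>)"
    by (rule tendsto_minus, rule cov_quotient_X1[OF in_H(2) hseq(2,4)])
  then show "(\<lambda>n. expectation (\<lambda>\<omega>. X t \<omega> * ((X1 i (t + hseq n *\<^sub>R axis j 1) \<omega> - X1 i t \<omega>) / hseq n)))
     \<longlonglongrightarrow> - (if i = j then 1 else 0)"
    unfolding eq cov_X1 .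
qed

lemma prob_X_X1:
  assumes A: "A \<in> sets borel" "C \<in> sets borel"
  shows "prob {\<omega>\<in>space M. X t \<omega> \<in> A \<and> (\<forall>i. X1 i t \<omega> \<in> C)}
     = measure std_normal_distribution A * measure std_normal_distribution C ^ CARD('n)"
proof -
  \<comment> \<open>the value and the partial derivatives as one family\<close>
  define Y where "Y = (\<lambda>q. case q of None \<Rightarrow> X t | Some i \<Rightarrow> X1 i t)"
  define R where "R = (\<lambda>q. case q of None \<Rightarrow> A | Some (i::'n) \<Rightarrow> C)"
  have c: "expectation (\<lambda>\<omega>. X t \<omega> * X t \<omega>) = 1" "expectation (\<lambda>\<omega>. X1 i t \<omega> * X t \<omega>) = 0" for i
    using var_X[of t] cov_X_X1[of t i] by (simp_all only: power2_eq_square mult.commute)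
  have cov: "expectation (\<lambda>\<omega>. Y p \<omega> * Y q \<omega>) = (if p = q then 1 else 0)" for p q
  proof -
    have Y: "Y None = X t" "Y (Some i) = X1 i t" for i by (simp_all add: Y_def)
    have X1: "expectation (\<lambda>\<omega>. X1 i t \<omega> * X1 j t \<omega>) = (if Some i = Some j then 1 else 0)" for i j
      by (simp only: cov_X1 option.inject)
    show ?thesis
    proof (cases p)
      case None
      then show ?thesis by (cases q) (simp_all only: Y c cov_X_X1 option.simps if_True if_False refl)
    next
      case (Some i)
      then show ?thesis by (cases q) (simp_all only: Y X1 c option.simps(3) if_False)
    qed
  qed
  have "prob {\<omega>\<in>space M. \<forall>q\<in>UNIV. Y q \<omega> \<in> R q} = (\<Prod>q\<in>UNIV. measure std_normal_distribution (R q))"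
    by (rule gaussian_space_independent[OF gaussian_H(4) finite _ cov])
      (simp_all add: Y_def R_def in_H A split: option.split)
  also have "\<dots> = measure std_normal_distribution A * measure std_normal_distribution C ^ CARD('n)"
    unfolding UNIV_option_conv R_def by (simp add: prod.reindex)
  also have "{\<omega>\<in>space M. \<forall>q\<in>UNIV. Y q \<omega> \<in> R q} = {\<omega>\<in>space M. X t \<omega> \<in> A \<and> (\<forall>i. X1 i t \<omega> \<in> C)}"
    by (simp add: Y_def R_def split_option_all)
  finally show ?thesis .
qed

text \<open>The variances of \<open>X s + X t\<close> and \<open>X s - X t\<close> add up to \<open>4\<close>. If the second one vanished, the vector would be
carried by the hyperplane on which its first two coordinates agree.\<close>

lemma variance_sum_less_4:
  assumes nd: "nondegenerate_distr M (\<lambda>\<omega>. (X s \<omega>, X t \<omega>, gradient (\<lambda>t. X t \<omega>) s, gradient (\<lambda>t. X t \<omega>) t))"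
  shows "expectation (\<lambda>\<omega>. (X s \<omega> + X t \<omega>)\<^sup>2) < 4"
proof (rule ccontr)
  assume c: "\<not> expectation (\<lambda>\<omega>. (X s \<omega> + X t \<omega>)\<^sup>2) < 4"
  have i: "integrable M (\<lambda>\<omega>. X s \<omega> * X t \<omega>)" "integrable M (\<lambda>\<omega>. (X s \<omega>)\<^sup>2)" for s t
    using integrable_mult_H[OF in_H(1) in_H(1)] by (simp_all add: power2_eq_square)
  have p: "expectation (\<lambda>\<omega>. (X s \<omega> + X t \<omega>)\<^sup>2) = 2 + 2 * expectation (\<lambda>\<omega>. X s \<omega> * X t \<omega>)"
    using i by (simp add: power2_sum var_X mult.assoc)
  have q: "expectation (\<lambda>\<omega>. (X s \<omega> - X t \<omega>)\<^sup>2) = 2 - 2 * expectation (\<lambda>\<omega>. X s \<omega> * X t \<omega>)"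
    using i by (simp add: power2_diff var_X mult.assoc)
  have "0 \<le> expectation (\<lambda>\<omega>. (X s \<omega> - X t \<omega>)\<^sup>2)" by simp
  then have z: "expectation (\<lambda>\<omega>. (X s \<omega> - X t \<omega>)\<^sup>2) = 0" using p q c by linarith
  have "AE \<omega> in M. (X s \<omega> - X t \<omega>)\<^sup>2 = 0"
  proof -
    have "integrable M (\<lambda>\<omega>. (X s \<omega> - X t \<omega>)\<^sup>2)"
      by (intro gaussian_space_moments(2)[OF gaussian_H(4)] gaussian_space_add(2)[OF gaussian_H(4)] in_H)
    from integral_nonneg_eq_0_iff_AE[OF this] z show ?thesis by simp
  qed
  then have ae: "AE \<omega> in M. X s \<omega> = X t \<omega>" by simp
  define L where "L = {y :: real \<times> real \<times> (real^'n) \<times> (real^'n). fst y = fst (snd y)}"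
  have gm[measurable]: "(\<lambda>\<omega>. gradient (\<lambda>t. X t \<omega>) s) \<in> borel_measurable M" for s
    unfolding borel_measurable_euclidean_space[of "\<lambda>\<omega>. gradient (\<lambda>t. X t \<omega>) s"]
    by (auto simp: Basis_vec_def inner_axis gradient_nth X1_def[symmetric] X_measurable)
  have "closed L" unfolding L_def by (intro closed_Collect_eq continuous_intros)
  then have [measurable]: "L \<in> sets borel" by simp
  have "AE y in distr M borel (\<lambda>\<omega>. (X s \<omega>, X t \<omega>, gradient (\<lambda>t. X t \<omega>) s, gradient (\<lambda>t. X t \<omega>) t)). y \<in> L"
    using ae by (subst AE_distr_iff) (measurable, simp add: L_def)
  moreover have "affine L" unfolding affine_def L_def by (auto simp: algebra_simps)
  moreover have "L \<noteq> UNIV"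
  proof -
    have "(1, 0, 0, 0) \<notin> L" by (simp add: L_def)
    then show ?thesis by blast
  qed
  ultimately show False using nd unfolding nondegenerate_distr_def by blast
qed

end

section \<open>High points lie on one parabolic peak, with overwhelming probability\<close>

lemma class_C_line_derivative:
  fixes f :: "real^'n \<Rightarrow> real"
  assumes f: "class_C (Suc k) f"
  shows "((\<lambda>\<tau>. f (t + \<tau> *\<^sub>R v)) has_real_derivative (\<Sum>i\<in>UNIV. v $ i * partial i f (t + \<tau> *\<^sub>R v))) (at \<tau>)"
proof -
  have "((\<lambda>\<tau>. f (t + \<tau> *\<^sub>R v)) has_derivative (\<lambda>x. \<Sum>i\<in>UNIV. (x *\<^sub>R v) $ i * partial i f (t + \<tau> *\<^sub>R v))) (at \<tau>)"
    by (rule has_derivative_compose[of "\<lambda>\<tau>. t + \<tau> *\<^sub>R v", OF _ class_C_has_derivative[OF f]])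
      (auto intro!: derivative_eq_intros)
  moreover have "(\<lambda>x. \<Sum>i\<in>UNIV. (x *\<^sub>R v) $ i * partial i f (t + \<tau> *\<^sub>R v))
     = (*) (\<Sum>i\<in>UNIV. v $ i * partial i f (t + \<tau> *\<^sub>R v))"
    by (rule ext) (simp add: sum_distrib_left mult_ac)
  ultimately show ?thesis by (simp only: has_field_derivative_def)
qed

lemma class_C_mvt:
  fixes f :: "real^'n \<Rightarrow> real"
  assumes f: "class_C (Suc k) f"
  shows "\<exists>\<tau>\<in>{0<..<1}. f s - f t = (\<Sum>i\<in>UNIV. (s $ i - t $ i) * partial i f (t + \<tau> *\<^sub>R (s - t)))"
proof -
  obtain \<tau> where "0 < \<tau>" "\<tau> < 1"
    "f (t + 1 *\<^sub>R (s - t)) - f (t + 0 *\<^sub>R (s - t))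
      = (1 - 0) * (\<Sum>i\<in>UNIV. (s - t) $ i * partial i f (t + \<tau> *\<^sub>R (s - t)))"
    using MVT2[OF zero_less_one class_C_line_derivative[OF f, of t "s - t"]] by blast
  then show ?thesis by (intro bexI[of _ \<tau>]) auto
qed

lemma sum_abs_le_norm:
  fixes v :: "real^'n" and L :: real
  assumes "\<And>i. \<bar>c i\<bar> \<le> L"
  shows "\<bar>\<Sum>i\<in>UNIV. v $ i * c i\<bar> \<le> CARD('n) * L * norm v"
proof -
  have L: "0 \<le> L" using assms[of undefined] by linarith
  have "\<bar>\<Sum>i\<in>UNIV. v $ i * c i\<bar> \<le> (\<Sum>i\<in>UNIV. \<bar>v $ i * c i\<bar>)" by (rule sum_abs)
  also have "\<dots> \<le> (\<Sum>i\<in>(UNIV::'n set). norm v * L)"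
    unfolding abs_mult by (intro sum_mono mult_mono component_le_norm_cart assms) auto
  finally show ?thesis by (simp add: mult_ac)
qed

lemma segment_point:
  fixes s t :: "'v::real_normed_vector"
  assumes "convex B" "s \<in> B" "t \<in> B" "\<tau> \<in> {0<..<1::real}"
  shows "t + \<tau> *\<^sub>R (s - t) \<in> B" "norm (\<tau> *\<^sub>R (s - t)) \<le> norm (s - t)"
proof -
  have "(1 - \<tau>) *\<^sub>R t + \<tau> *\<^sub>R s \<in> B" using assms by (intro convexD) auto
  then show "t + \<tau> *\<^sub>R (s - t) \<in> B" by (simp add: algebra_simps)
  show "norm (\<tau> *\<^sub>R (s - t)) \<le> norm (s - t)"
    using assms(4) by (simp add: mult_left_le_one_le)
qed

lemma class_C_lipschitz:
  fixes f :: "real^'n \<Rightarrow> real" and L :: real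
  assumes f: "class_C (Suc k) f" and B: "convex B" "s \<in> B" "t \<in> B"
    and L: "\<And>i p. p \<in> B \<Longrightarrow> \<bar>partial i f p\<bar> \<le> L"
  shows "\<bar>f s - f t\<bar> \<le> CARD('n) * L * norm (s - t)"
proof -
  obtain \<tau> where \<tau>: "\<tau> \<in> {0<..<1}"
    and e: "f s - f t = (\<Sum>i\<in>UNIV. (s $ i - t $ i) * partial i f (t + \<tau> *\<^sub>R (s - t)))"
    using class_C_mvt[OF f] by blast
  have "\<bar>\<Sum>i\<in>UNIV. (s - t) $ i * partial i f (t + \<tau> *\<^sub>R (s - t))\<bar> \<le> CARD('n) * L * norm (s - t)"
    by (rule sum_abs_le_norm) (rule L, rule segment_point[OF B \<tau>])
  then show ?thesis unfolding e by simp
qed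

text \<open>The event on which the geometric argument runs: around every high point the gradient moves like that of
\<open>- u / 2 * norm t ^ 2\<close>, and all high points are close together. The division by the dimension is there so that
summing over coordinates costs only a factor \<open>\<epsilon>\<close>.\<close>

definition parabolic_peaks :: "(real^'n) set \<Rightarrow> real \<Rightarrow> real \<Rightarrow> real \<Rightarrow> (real^'n \<Rightarrow> real) \<Rightarrow> bool" where
  "parabolic_peaks B \<epsilon> \<delta> u f \<longleftrightarrow>
     (\<forall>s\<in>B. \<forall>t\<in>B. norm (s - t) \<le> \<delta> \<longrightarrow> u - 1 \<le> f t \<longrightarrow>
        (\<forall>i. \<bar>partial i f s - partial i f t + u * (s $ i - t $ i)\<bar> \<le> \<epsilon> / CARD('n) * u * norm (s - t))) \<and>
     (\<forall>s\<in>B. \<forall>t\<in>B. u - 1 \<le> f s \<longrightarrow> u - 1 \<le> f t \<longrightarrow> norm (s - t) < \<delta>)"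

context prob_space
begin

text \<open>Families of sets of outcomes whose probability is exponentially small relative to the normal density \<open>exp (- u^2 / 2)\<close>.
They need not be events, so a covering event is asked for.\<close>

definition negligible_at :: "(real \<Rightarrow> 'a set) \<Rightarrow> bool" where
  "negligible_at A \<longleftrightarrow> (\<exists>c>0. \<exists>C\<ge>0. \<forall>\<^sub>F u in at_top. \<exists>E\<in>events. A u \<subseteq> E \<and> prob E \<le> C * exp (- (1/2 + c) * u\<^sup>2))"

lemma negligible_at_mono:
  assumes "negligible_at A" "\<forall>\<^sub>F u in at_top. A' u \<subseteq> A u"
  shows "negligible_at A'"
proof -
  obtain c C where c: "c > 0" "C \<ge> 0"
    "\<forall>\<^sub>F u in at_top. \<exists>E\<in>events. A u \<subseteq> E \<and> prob E \<le> C * exp (- (1/2 + c) * u\<^sup>2)"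
    using assms(1) unfolding negligible_at_def by blast
  from c(3) assms(2) have "\<forall>\<^sub>F u in at_top. \<exists>E\<in>events. A' u \<subseteq> E \<and> prob E \<le> C * exp (- (1/2 + c) * u\<^sup>2)"
    by eventually_elim (meson subset_trans)
  then show ?thesis unfolding negligible_at_def using c by blast
qed

lemma negligible_at_empty: "negligible_at (\<lambda>_. {})"
  unfolding negligible_at_def by (intro exI[of _ 1] conjI exI[of _ 0])
    (auto intro!: always_eventually bexI[of _ "{}"])

lemma negligible_at_Un:
  assumes "negligible_at A" "negligible_at A'"
  shows "negligible_at (\<lambda>u. A u \<union> A' u)"
proof -
  obtain c C where c: "c > 0" "C \<ge> 0"
    "\<forall>\<^sub>F u in at_top. \<exists>E\<in>events. A u \<subseteq> E \<and> prob E \<le> C * exp (- (1/2 + c) * u\<^sup>2)"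
    using assms(1) unfolding negligible_at_def by blast
  obtain d D where d: "d > 0" "D \<ge> 0"
    "\<forall>\<^sub>F u in at_top. \<exists>E\<in>events. A' u \<subseteq> E \<and> prob E \<le> D * exp (- (1/2 + d) * u\<^sup>2)"
    using assms(2) unfolding negligible_at_def by blast
  define m where "m = min c d"
  from c(3) d(3) have "\<forall>\<^sub>F u in at_top. \<exists>E\<in>events. A u \<union> A' u \<subseteq> E \<and> prob E \<le> (C + D) * exp (- (1/2 + m) * u\<^sup>2)"
  proof eventually_elim
    case (elim u)
    then obtain E F where E: "E \<in> events" "A u \<subseteq> E" "prob E \<le> C * exp (- (1/2 + c) * u\<^sup>2)"
      and F: "F \<in> events" "A' u \<subseteq> F" "prob F \<le> D * exp (- (1/2 + d) * u\<^sup>2)" by blast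
    have ex: "exp (- (1/2 + c) * u\<^sup>2) \<le> exp (- (1/2 + m) * u\<^sup>2)" "exp (- (1/2 + d) * u\<^sup>2) \<le> exp (- (1/2 + m) * u\<^sup>2)"
      by (auto simp: m_def intro!: mult_right_mono)
    have "prob (E \<union> F) \<le> prob E + prob F" using E F by (intro measure_Un_le)
    also have "\<dots> \<le> C * exp (- (1/2 + c) * u\<^sup>2) + D * exp (- (1/2 + d) * u\<^sup>2)" using E F by linarith
    also have "\<dots> \<le> C * exp (- (1/2 + m) * u\<^sup>2) + D * exp (- (1/2 + m) * u\<^sup>2)"
      using ex c d by (intro add_mono mult_left_mono) auto
    finally show ?case using E F by (intro bexI[of _ "E \<union> F"]) (auto simp: algebra_simps)
  qed
  then show ?thesis
    unfolding negligible_at_def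
  proof (intro exI conjI)
    show "0 < m" using c d by (simp add: m_def)
    show "0 \<le> C + D" using c d by simp
  qed
qed

lemma negligible_at_UN:
  assumes "finite I" "\<And>i. i \<in> I \<Longrightarrow> negligible_at (A i)"
  shows "negligible_at (\<lambda>u. \<Union>i\<in>I. A i u)"
  using assms by (induction I rule: finite_induct) (auto intro: negligible_at_empty negligible_at_Un)

text \<open>Exceeding \<open>a u\<close> costs more than \<open>exp (- u^2 / 2)\<close> as soon as the variance is below \<open>a^2\<close>. All the exclusions
below are of this form.\<close>

lemma negligible_at_tail:
  assumes H: "gaussian_space M H" "Y \<in> H" and v: "expectation (\<lambda>\<omega>. (Y \<omega>)\<^sup>2) \<le> v" "0 < v" and a: "0 < a" "v < a\<^sup>2"
  shows "negligible_at (\<lambda>u. {\<omega>\<in>space M. Y \<omega> \<ge> a * u})"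
  unfolding negligible_at_def
proof (rule exI[of _ "(a\<^sup>2 / v - 1) / 2"], intro conjI exI[of _ 1])
  show "0 < (a\<^sup>2 / v - 1) / 2" using a v by (simp add: field_simps)
  have [measurable]: "Y \<in> borel_measurable M" by (rule gaussian_space_measurable[OF H])
  show "\<forall>\<^sub>F u in at_top. \<exists>E\<in>events. {\<omega>\<in>space M. Y \<omega> \<ge> a * u} \<subseteq> E \<and>
      prob E \<le> 1 * exp (- (1/2 + (a\<^sup>2 / v - 1) / 2) * u\<^sup>2)"
    using eventually_ge_at_top[of "0::real"]
  proof eventually_elim
    case (elim u)
    have "prob {\<omega>\<in>space M. Y \<omega> \<ge> a * u} \<le> exp (- (a * u)\<^sup>2 / (2 * v))"
      using a elim by (intro gaussian_space_tail[OF H v]) simp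
    also have "- (a * u)\<^sup>2 / (2 * v) = - (1/2 + (a\<^sup>2 / v - 1) / 2) * u\<^sup>2"
      using v by (simp add: field_simps power_mult_distrib)
    finally show ?case by (intro bexI[of _ "{\<omega>\<in>space M. Y \<omega> \<ge> a * u}"]) auto
  qed
qed simp

lemma negligible_at_sup:
  fixes Y :: "'i \<Rightarrow> 't::euclidean_space \<Rightarrow> 'a \<Rightarrow> real"
  assumes H: "gaussian_space M H" and Y: "\<And>i t. i \<in> I \<Longrightarrow> Y i t \<in> H"
    and C: "\<And>i \<omega>. i \<in> I \<Longrightarrow> \<omega> \<in> space M \<Longrightarrow> continuous_on UNIV (\<lambda>t. Y i t \<omega>)"
    and B: "compact B" "B \<noteq> {}" and I: "finite I"
  shows "\<exists>K>0. negligible_at (\<lambda>u. {\<omega>\<in>space M. \<exists>i\<in>I. \<exists>t\<in>B. \<bar>Y i t \<omega>\<bar> > K * u})"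
proof -
  have "\<exists>K>0. negligible_at (\<lambda>u. {\<omega>\<in>space M. \<exists>t\<in>B. \<bar>Y i t \<omega>\<bar> > K * u})" if i: "i \<in> I" for i
  proof -
    obtain K where K: "K > 0" "\<And>u. u \<ge> 1 \<Longrightarrow> \<exists>E\<in>events. prob E \<le> exp (- u\<^sup>2) \<and> (\<forall>\<omega>\<in>space M - E. \<forall>t\<in>B. \<bar>Y i t \<omega>\<bar> \<le> K * u)"
      using sup_tail[OF H Y[OF i] C[OF i] B] by blast
    have "negligible_at (\<lambda>u. {\<omega>\<in>space M. \<exists>t\<in>B. \<bar>Y i t \<omega>\<bar> > K * u})"
      unfolding negligible_at_def
    proof (rule exI[of _ "1/2"], intro conjI exI[of _ 1])
      show "\<forall>\<^sub>F u in at_top. \<exists>E\<in>events. {\<omega>\<in>space M. \<exists>t\<in>B. \<bar>Y i t \<omega>\<bar> > K * u} \<subseteq> E \<and> prob E \<le> 1 * exp (- (1/2 + 1/2) * u\<^sup>2)"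
        using eventually_ge_at_top[of "1::real"]
      proof eventually_elim
        case (elim u)
        then obtain E where "E \<in> events" "prob E \<le> exp (- u\<^sup>2)" "\<forall>\<omega>\<in>space M - E. \<forall>t\<in>B. \<bar>Y i t \<omega>\<bar> \<le> K * u"
          using K(2) by blast
        then show ?case by (intro bexI[of _ E]) (auto simp: not_less, meson DiffI not_less)
      qed
    qed auto
    then show ?thesis using K(1) by blast
  qed
  then have "\<forall>i\<in>I. \<exists>K. K > 0 \<and> negligible_at (\<lambda>u. {\<omega>\<in>space M. \<exists>t\<in>B. \<bar>Y i t \<omega>\<bar> > K * u})" by blast
  then obtain K where "\<forall>i\<in>I. K i > 0 \<and> negligible_at (\<lambda>u. {\<omega>\<in>space M. \<exists>t\<in>B. \<bar>Y i t \<omega>\<bar> > K i * u})"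
    by (rule bchoice[THEN exE])
  then have K: "\<And>i. i \<in> I \<Longrightarrow> K i > 0"
    "\<And>i. i \<in> I \<Longrightarrow> negligible_at (\<lambda>u. {\<omega>\<in>space M. \<exists>t\<in>B. \<bar>Y i t \<omega>\<bar> > K i * u})" by blast+
  define K' where "K' = (\<Sum>i\<in>I. K i) + 1"
  have K': "K i \<le> K'" if "i \<in> I" for i
    using member_le_sum[OF that _ I, of K] K(1) by (force simp: K'_def)
  have "0 \<le> sum K I" by (intro sum_nonneg less_imp_le K(1))
  then have "0 < K'" by (simp add: K'_def)
  moreover have "negligible_at (\<lambda>u. {\<omega>\<in>space M. \<exists>i\<in>I. \<exists>t\<in>B. \<bar>Y i t \<omega>\<bar> > K' * u})"
  proof (rule negligible_at_mono)
    show "negligible_at (\<lambda>u. \<Union>i\<in>I. {\<omega>\<in>space M. \<exists>t\<in>B. \<bar>Y i t \<omega>\<bar> > K i * u})"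
      by (rule negligible_at_UN[OF I K(2)])
    show "\<forall>\<^sub>F u in at_top. {\<omega>\<in>space M. \<exists>i\<in>I. \<exists>t\<in>B. \<bar>Y i t \<omega>\<bar> > K' * u}
        \<subseteq> (\<Union>i\<in>I. {\<omega>\<in>space M. \<exists>t\<in>B. \<bar>Y i t \<omega>\<bar> > K i * u})"
      using eventually_ge_at_top[of "0::real"]
    proof eventually_elim
      case (elim u)
      have "K i * u \<le> K' * u" if "i \<in> I" for i using K'[OF that] elim by (rule mult_right_mono)
      then show ?case by (fastforce intro: le_less_trans)
    qed
  qed
  ultimately show ?thesis by blast
qed

end

locale separated_gaussian_field = smooth_gaussian_field M X for M :: "'w measure" and X :: "real^'n \<Rightarrow> 'w \<Rightarrow> real" +
  fixes B :: "(real^'n) set"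
  assumes B: "compact B" "convex B" "B \<noteq> {}"
    and sep: "\<And>s t. s \<in> B \<Longrightarrow> t \<in> B \<Longrightarrow> s \<noteq> t \<Longrightarrow> expectation (\<lambda>\<omega>. (X s \<omega> + X t \<omega>)\<^sup>2) < 4"
begin

text \<open>The residual of the second derivatives after regression on \<open>X t\<close>.\<close>

definition "Z i j t \<omega> = X2 i j t \<omega> + (if i = j then X t \<omega> else 0)"

lemma Z_in_H: "Z i j t \<in> H"
proof -
  have "(\<lambda>\<omega>. 1 * X2 i j t \<omega> + (if i = j then 1 else 0) * X t \<omega>) \<in> H"
    by (intro gaussian_space_lin[OF gaussian_H(4)] in_H)
  then show ?thesis by (auto simp: Z_def[abs_def] split: if_splits)
qed

lemma continuous_paths:
  assumes "\<omega> \<in> space M"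
  shows "continuous_on UNIV (\<lambda>t. X t \<omega>)" "continuous_on UNIV (\<lambda>t. X1 i t \<omega>)" "continuous_on UNIV (\<lambda>t. X2 i j t \<omega>)"
    "continuous_on UNIV (\<lambda>t. X3 i j k t \<omega>)" "continuous_on UNIV (\<lambda>t. Z i j t \<omega>)"
proof -
  note c = class_C_derivs[OF assms, THEN class_C_continuous]
  show "continuous_on UNIV (\<lambda>t. X t \<omega>)" "continuous_on UNIV (\<lambda>t. X1 i t \<omega>)" "continuous_on UNIV (\<lambda>t. X2 i j t \<omega>)"
    "continuous_on UNIV (\<lambda>t. X3 i j k t \<omega>)" by (rule c)+
  show "continuous_on UNIV (\<lambda>t. Z i j t \<omega>)"
    unfolding Z_def using c(1) c(3)[of i j] by (cases "i = j") (auto intro!: continuous_intros)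
qed

lemma cov_X_Z: "expectation (\<lambda>\<omega>. X t \<omega> * Z i j t \<omega>) = 0"
proof (cases "i = j")
  case True
  have "expectation (\<lambda>\<omega>. X t \<omega> * Z i j t \<omega>) = expectation (\<lambda>\<omega>. X t \<omega> * X2 i j t \<omega>) + expectation (\<lambda>\<omega>. X t \<omega> * X t \<omega>)"
    using True by (simp add: Z_def distrib_left integrable_mult_H in_H)
  then show ?thesis using True var_X[of t] by (simp add: cov_X_X2 power2_eq_square)
next
  case False
  then show ?thesis by (simp add: Z_def cov_X_X2)
qed

lemma Z_variance_bound: "\<exists>v\<ge>1. \<forall>i j. \<forall>t\<in>B. expectation (\<lambda>\<omega>. (Z i j t \<omega>)\<^sup>2) \<le> v"
proof -
  have "\<exists>v. \<forall>t\<in>B. expectation (\<lambda>\<omega>. (Z i j t \<omega>)\<^sup>2) \<le> v" for i j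
  proof -
    have "continuous_on B (\<lambda>t. expectation (\<lambda>\<omega>. (Z i j t \<omega>)\<^sup>2))"
      by (rule continuous_on_subset[OF continuous_second_moment[OF gaussian_H(4) Z_in_H continuous_paths(5)]]) auto
    from continuous_attains_sup[OF B(1,3) this] show ?thesis by blast
  qed
  then obtain v where v: "\<And>i j t. t \<in> B \<Longrightarrow> expectation (\<lambda>\<omega>. (Z i j t \<omega>)\<^sup>2) \<le> v i j" by metis
  define V where "V = 1 + (\<Sum>p\<in>UNIV. \<bar>v (fst p) (snd p)\<bar>)"
  have "v i j \<le> V" for i j
    using member_le_sum[of "(i, j)" UNIV "\<lambda>p. \<bar>v (fst p) (snd p)\<bar>"] by (simp add: V_def)
  moreover have "1 \<le> V" by (simp add: V_def sum_nonneg)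
  ultimately show ?thesis using v by (meson order_trans)
qed

text \<open>A large residual at a high point makes \<open>X t + l Z\<close> or \<open>X t - l Z\<close> exceed \<open>(1 + l e / 2) u\<close>. As \<open>X t\<close> and \<open>Z\<close>
are uncorrelated this combination has variance at most \<open>1 + l^2 v\<close>, which is smaller than the square of the level for
small \<open>l\<close>; \<open>l = e / (2 v)\<close> works.\<close>

lemma negligible_large_hessian:
  assumes t: "t \<in> B" and v: "1 \<le> v" "expectation (\<lambda>\<omega>. (Z i j t \<omega>)\<^sup>2) \<le> v" and e: "0 < e" "e \<le> 1"
    and l: "l = e / (2 * v)"
  shows "negligible_at (\<lambda>u. {\<omega>\<in>space M. X t \<omega> \<ge> (1 - l * e / 2) * u \<and> \<bar>Z i j t \<omega>\<bar> \<ge> e * u})"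
proof -
  have l0: "0 < l" using e v by (simp add: l)
  define a where "a = 1 + l * e / 2"
  have va: "1 + l\<^sup>2 * v < a\<^sup>2"
  proof -
    have "l\<^sup>2 * v = l * e / 2" using v by (simp add: l power2_eq_square field_simps)
    moreover have "0 < l * e" using l0 e by simp
    moreover have "a\<^sup>2 = 1 + l * e + (l * e / 2)\<^sup>2" by (simp add: a_def power2_sum)
    ultimately show ?thesis using zero_le_power2[of "l * e / 2"] by linarith
  qed
  have neg: "negligible_at (\<lambda>u. {\<omega>\<in>space M. X t \<omega> + c * Z i j t \<omega> \<ge> a * u})" if c: "c\<^sup>2 = l\<^sup>2" for c
  proof (rule negligible_at_tail[OF gaussian_H(4)])
    show "(\<lambda>\<omega>. X t \<omega> + c * Z i j t \<omega>) \<in> H"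
      using gaussian_space_lin[OF gaussian_H(4) in_H(1) Z_in_H, of 1 t c i j t] by simp
    have i: "integrable M (\<lambda>\<omega>. (X t \<omega>)\<^sup>2)" "integrable M (\<lambda>\<omega>. X t \<omega> * Z i j t \<omega>)" "integrable M (\<lambda>\<omega>. (Z i j t \<omega>)\<^sup>2)"
      using integrable_mult_H[OF in_H(1) in_H(1)] integrable_mult_H[OF in_H(1) Z_in_H] integrable_mult_H[OF Z_in_H Z_in_H] by (simp_all add: power2_eq_square)
    have "expectation (\<lambda>\<omega>. (X t \<omega> + c * Z i j t \<omega>)\<^sup>2)
       = expectation (\<lambda>\<omega>. (X t \<omega>)\<^sup>2 + (2 * c) * (X t \<omega> * Z i j t \<omega>) + c\<^sup>2 * (Z i j t \<omega>)\<^sup>2)"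
      by (intro Bochner_Integration.integral_cong refl) (simp add: power2_eq_square algebra_simps)
    also have "\<dots> = 1 + l\<^sup>2 * expectation (\<lambda>\<omega>. (Z i j t \<omega>)\<^sup>2)"
      using i by (simp add: var_X cov_X_Z c)
    finally show "expectation (\<lambda>\<omega>. (X t \<omega> + c * Z i j t \<omega>)\<^sup>2) \<le> 1 + l\<^sup>2 * v"
      using v by (simp add: mult_left_mono)
    show "0 < 1 + l\<^sup>2 * v" using v by (intro add_pos_nonneg) auto
    show "0 < a" using l0 e by (simp add: a_def add_pos_pos)
  qed (rule va)
  show ?thesis
  proof (rule negligible_at_mono)
    show "negligible_at (\<lambda>u. {\<omega>\<in>space M. X t \<omega> + l * Z i j t \<omega> \<ge> a * u} \<union> {\<omega>\<in>space M. X t \<omega> + (-l) * Z i j t \<omega> \<ge> a * u})"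
      by (intro negligible_at_Un neg) auto
    show "\<forall>\<^sub>F u in at_top. {\<omega>\<in>space M. X t \<omega> \<ge> (1 - l * e / 2) * u \<and> \<bar>Z i j t \<omega>\<bar> \<ge> e * u} \<subseteq>
      {\<omega>\<in>space M. X t \<omega> + l * Z i j t \<omega> \<ge> a * u} \<union> {\<omega>\<in>space M. X t \<omega> + (-l) * Z i j t \<omega> \<ge> a * u}"
    proof (intro always_eventually allI subsetI)
      fix u \<omega> assume \<omega>: "\<omega> \<in> {\<omega>\<in>space M. X t \<omega> \<ge> (1 - l * e / 2) * u \<and> \<bar>Z i j t \<omega>\<bar> \<ge> e * u}"
      have "l * (e * u) \<le> l * \<bar>Z i j t \<omega>\<bar>" using \<omega> l0 by (intro mult_left_mono) auto
      moreover have "X t \<omega> \<ge> u - l * (e * u) / 2" using \<omega> by (simp add: algebra_simps)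
      moreover have "a * u = u + l * (e * u) / 2" by (simp add: a_def algebra_simps)
      ultimately show "\<omega> \<in> {\<omega>\<in>space M. X t \<omega> + l * Z i j t \<omega> \<ge> a * u} \<union> {\<omega>\<in>space M. X t \<omega> + (-l) * Z i j t \<omega> \<ge> a * u}"
        using \<omega> by (cases "Z i j t \<omega> \<ge> 0") auto
    qed
  qed
qed

text \<open>The variance of \<open>X s + X t\<close> is continuous and below \<open>4\<close> on the compact set of pairs at distance at least \<open>d\<close>.\<close>

lemma separation_bound:
  assumes d: "0 < d"
  shows "\<exists>m. 0 < m \<and> m < 4 \<and> (\<forall>s\<in>B. \<forall>t\<in>B. d \<le> norm (s - t) \<longrightarrow> expectation (\<lambda>\<omega>. (X s \<omega> + X t \<omega>)\<^sup>2) \<le> m)"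
proof -
  define A where "A = (B \<times> B) \<inter> {p. d \<le> norm (fst p - snd p)}"
  define q where "q = (\<lambda>p. expectation (\<lambda>\<omega>. (X (fst p) \<omega> + X (snd p) \<omega>)\<^sup>2))"
  have cA: "compact A" unfolding A_def
    by (intro compact_Int_closed compact_Times B closed_Collect_le continuous_intros)
  have "continuous_on UNIV q" unfolding q_def
  proof (rule continuous_second_moment[OF gaussian_H(4)])
    show "(\<lambda>\<omega>. X (fst t) \<omega> + X (snd t) \<omega>) \<in> H" for t
      by (intro gaussian_space_add(1)[OF gaussian_H(4)] in_H)
    show "continuous_on UNIV (\<lambda>t. X (fst t) \<omega> + X (snd t) \<omega>)" if "\<omega> \<in> space M" for \<omega>
      by (intro continuous_on_add continuous_on_compose2[OF continuous_paths(1)[OF that]] continuous_intros) auto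
  qed
  then have cq: "continuous_on A q" by (rule continuous_on_subset) simp
  show ?thesis
  proof (cases "A = {}")
    case True
    have "\<not> d \<le> norm (s - t)" if "s \<in> B" "t \<in> B" for s t
    proof
      assume "d \<le> norm (s - t)"
      then have "(s, t) \<in> A" using that by (simp add: A_def)
      then show False using True by blast
    qed
    then show ?thesis by (intro exI[of _ 1]) simp
  next
    case False
    obtain p where p: "p \<in> A" "\<And>x. x \<in> A \<Longrightarrow> q x \<le> q p" using continuous_attains_sup[OF cA False cq] by blast
    have "q p < 4" unfolding q_def using p(1) d by (intro sep) (auto simp: A_def)
    then show ?thesis using p(2) unfolding A_def q_def
      by (intro exI[of _ "max 1 (q p)"]) (force simp: q_def le_max_iff_disj)
  qed
qed

lemma finite_grid:
  assumes "0 < (\<eta>::real)"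
  shows "\<exists>G. finite G \<and> G \<subseteq> B \<and> (\<forall>p\<in>B. \<exists>g\<in>G. norm (p - g) < \<eta>)"
proof -
  obtain G where G: "G \<subseteq> B" "finite G" "B \<subseteq> (\<Union>x\<in>G. ball x \<eta>)"
    by (rule compactE_image[OF B(1), of B "\<lambda>x. ball x \<eta>"]) (use assms in auto)
  then show ?thesis by (intro exI[of _ G]) (fastforce simp: dist_norm norm_minus_commute)
qed

text \<open>The first derivatives and the third derivatives are bounded by a multiple of \<open>u\<close> outside a negligible set, so on a finite
grid of mesh \<open>\<eta>\<close> (independent of \<open>u\<close>) the field and its second derivatives approximate their values everywhere up
to a small multiple of \<open>u\<close>. At the finitely many grid points it remains to exclude a value above \<open>(1 + e) u\<close>, a
large residual \<open>Z\<close> at a high point, and two distant high points, each of which is negligible. The constants are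
chosen in the order \<open>e\<close>, \<open>e2\<close>, \<open>\<delta>\<close>, \<open>e3\<close>, \<open>\<eta>\<close>.\<close>

theorem parabolic_peaks_overwhelming:
  assumes \<epsilon>: "0 < \<epsilon>" and \<delta>0: "0 < \<delta>0"
  shows "\<exists>\<delta>. 0 < \<delta> \<and> \<delta> \<le> \<delta>0 \<and> negligible_at (\<lambda>u. {\<omega>\<in>space M. \<not> parabolic_peaks B \<epsilon> \<delta> u (\<lambda>t. X t \<omega>)})"
proof -
  define n where "n = real CARD('n)"
  have n: "1 \<le> n" by (simp add: n_def Suc_le_eq)
  have "\<exists>K>0. negligible_at (\<lambda>u. {\<omega>\<in>space M. \<exists>i\<in>UNIV. \<exists>t\<in>B. \<bar>X1 i t \<omega>\<bar> > K * u})"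
    by (rule negligible_at_sup[OF gaussian_H(4) _ _ B(1,3) finite]) (simp_all add: in_H continuous_paths)
  then obtain K1 where K1: "K1 > 0" "negligible_at (\<lambda>u. {\<omega>\<in>space M. \<exists>i\<in>UNIV. \<exists>t\<in>B. \<bar>X1 i t \<omega>\<bar> > K1 * u})"
    by blast
  have "\<exists>K>0. negligible_at (\<lambda>u. {\<omega>\<in>space M. \<exists>q\<in>UNIV. \<exists>t\<in>B. \<bar>X3 (fst q) (fst (snd q)) (snd (snd q)) t \<omega>\<bar> > K * u})"
    by (rule negligible_at_sup[OF gaussian_H(4) _ _ B(1,3) finite]) (simp_all add: in_H continuous_paths)
  then obtain K3 where K3: "K3 > 0" "negligible_at (\<lambda>u. {\<omega>\<in>space M. \<exists>q\<in>UNIV. \<exists>t\<in>B. \<bar>X3 (fst q) (fst (snd q)) (snd (snd q)) t \<omega>\<bar> > K3 * u})"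
    by blast
  define K where "K = n * (K1 + K3)"
  have K: "K > 0" "n * K1 \<le> K" "n * K3 \<le> K" using K1 K3 n by (auto simp: K_def)
  obtain v where v: "v \<ge> 1" "\<And>i j t. t \<in> B \<Longrightarrow> expectation (\<lambda>\<omega>. (Z i j t \<omega>)\<^sup>2) \<le> v"
    using Z_variance_bound by blast
  define e where "e = min 1 (\<epsilon> / (3 * n\<^sup>2))"
  have e: "0 < e" "e \<le> 1" "3 * e \<le> \<epsilon> / n\<^sup>2" using \<epsilon> n by (auto simp: e_def min_def field_simps)
  define l where "l = e / (2 * v)"
  define e2 where "e2 = l * e / 2"
  have l: "0 < l" "l \<le> 1" using e v by (auto simp: l_def field_simps)
  have e2: "0 < e2" "e2 \<le> e" using l e mult_right_mono[of l 1 e] by (auto simp: e2_def)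
  define \<delta> where "\<delta> = min \<delta>0 (e2 / (4 * K))"
  have \<delta>: "0 < \<delta>" "\<delta> \<le> \<delta>0" "K * \<delta> \<le> e2 / 4" using \<delta>0 e2 K by (auto simp: \<delta>_def min_def field_simps)
  obtain m where m: "0 < m" "m < 4"
    "\<And>s t. s \<in> B \<Longrightarrow> t \<in> B \<Longrightarrow> \<delta> / 2 \<le> norm (s - t) \<Longrightarrow> expectation (\<lambda>\<omega>. (X s \<omega> + X t \<omega>)\<^sup>2) \<le> m"
    using separation_bound[of "\<delta> / 2"] \<delta> by auto
  define e3 where "e3 = (1 - sqrt m / 2) / 2"
  have sm: "0 < sqrt m" "sqrt m < 2" using m real_sqrt_less_mono[of m 4] by auto
  then have e3: "0 < e3" "sqrt m < 2 * (1 - e3)" by (auto simp: e3_def field_simps)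
  define \<eta> where "\<eta> = min (\<delta> / 4) (min (e2 / (4 * K)) (e3 / (2 * K)))"
  have \<eta>: "0 < \<eta>" using \<delta> e2 e3 K by (simp add: \<eta>_def)
  have "\<eta> \<le> e2 / (4 * K)" "\<eta> \<le> e3 / (2 * K)" unfolding \<eta>_def by linarith+
  then have "K * \<eta> \<le> K * (e2 / (4 * K))" "K * \<eta> \<le> K * (e3 / (2 * K))"
    using K(1) by (simp_all only: mult_le_cancel_left_pos)
  then have \<eta>2: "\<eta> \<le> \<delta> / 4" "K * \<eta> \<le> e2 / 4" "K * \<eta> \<le> e3 / 2"
    using K(1) by (simp_all add: \<eta>_def)
  obtain G where G: "finite G" "G \<subseteq> B" "\<And>p. p \<in> B \<Longrightarrow> \<exists>g\<in>G. norm (p - g) < \<eta>"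
    using finite_grid[OF \<eta>] by blast
  define A1 where "A1 = (\<lambda>u. {\<omega>\<in>space M. \<exists>i\<in>UNIV. \<exists>t\<in>B. \<bar>X1 i t \<omega>\<bar> > K1 * u})"
  define A3 where "A3 = (\<lambda>u. {\<omega>\<in>space M. \<exists>q\<in>UNIV. \<exists>t\<in>B. \<bar>X3 (fst q) (fst (snd q)) (snd (snd q)) t \<omega>\<bar> > K3 * u})"
  define E2 where "E2 = (\<lambda>u. \<Union>g\<in>G. {\<omega>\<in>space M. X g \<omega> \<ge> (1 + e) * u})"
  define E3 where "E3 = (\<lambda>u. \<Union>q\<in>G \<times> UNIV. {\<omega>\<in>space M. X (fst q) \<omega> \<ge> (1 - l * e / 2) * u \<and> \<bar>Z (fst (snd q)) (snd (snd q)) (fst q) \<omega>\<bar> \<ge> e * u})"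
  define G2 where "G2 = {p\<in>G \<times> G. \<delta> / 2 \<le> norm (fst p - snd p)}"
  define E4 where "E4 = (\<lambda>u. \<Union>p\<in>G2. {\<omega>\<in>space M. X (fst p) \<omega> + X (snd p) \<omega> \<ge> (2 * (1 - e3)) * u})"
  have "negligible_at (\<lambda>u. A1 u \<union> A3 u \<union> E2 u \<union> E3 u \<union> E4 u)"
  proof (intro negligible_at_Un)
    show "negligible_at A1" "negligible_at A3" unfolding A1_def A3_def by (rule K1 K3)+
    show "negligible_at E2" unfolding E2_def
    proof (rule negligible_at_UN[OF G(1)])
      fix g
      have "1 < (1 + e)\<^sup>2" using e by (simp add: power2_eq_square algebra_simps add_pos_pos)
      then show "negligible_at (\<lambda>u. {\<omega>\<in>space M. X g \<omega> \<ge> (1 + e) * u})"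
        using e by (intro negligible_at_tail[OF gaussian_H(4) in_H(1), of g 1]) (auto simp: var_X)
    qed
    show "negligible_at E3" unfolding E3_def
    proof (rule negligible_at_UN)
      show "finite (G \<times> (UNIV :: ('n \<times> 'n) set))" using G by simp
      fix q :: "(real^'n) \<times> 'n \<times> 'n" assume "q \<in> G \<times> UNIV"
      then have q: "fst q \<in> B" using G by auto
      show "negligible_at (\<lambda>u. {\<omega>\<in>space M. X (fst q) \<omega> \<ge> (1 - l * e / 2) * u \<and> \<bar>Z (fst (snd q)) (snd (snd q)) (fst q) \<omega>\<bar> \<ge> e * u})"
        by (rule negligible_large_hessian[OF q v(1) v(2)[OF q] e(1,2) l_def])
    qed
    show "negligible_at E4" unfolding E4_def
    proof (rule negligible_at_UN)
      show "finite G2" using G unfolding G2_def by simp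
      fix p assume p: "p \<in> G2"
      show "negligible_at (\<lambda>u. {\<omega>\<in>space M. X (fst p) \<omega> + X (snd p) \<omega> \<ge> (2 * (1 - e3)) * u})"
      proof (rule negligible_at_tail[OF gaussian_H(4)])
        show "(\<lambda>\<omega>. X (fst p) \<omega> + X (snd p) \<omega>) \<in> H" by (intro gaussian_space_add(1)[OF gaussian_H(4)] in_H)
        show "expectation (\<lambda>\<omega>. (X (fst p) \<omega> + X (snd p) \<omega>)\<^sup>2) \<le> m" 
          using p G by (intro m(3)) (auto simp: G2_def)
        show "0 < 2 * (1 - e3)" using e3 sm by linarith
        have "(sqrt m)\<^sup>2 < (2 * (1 - e3))\<^sup>2" using e3 sm by (intro power_strict_mono) auto
        then show "m < (2 * (1 - e3))\<^sup>2" using m by simp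
      qed (rule m)
    qed
  qed
  moreover have "\<forall>\<^sub>F u in at_top. {\<omega>\<in>space M. \<not> parabolic_peaks B \<epsilon> \<delta> u (\<lambda>t. X t \<omega>)} \<subseteq> A1 u \<union> A3 u \<union> E2 u \<union> E3 u \<union> E4 u"
    using eventually_ge_at_top[of "1::real"] eventually_ge_at_top[of "2 / e2"] eventually_ge_at_top[of "2 / e3"]
  proof eventually_elim
    case (elim u)
    have u1: "1 \<le> e2 * u / 2" "1 \<le> e3 * u / 2" using elim e2 e3 by (auto simp: field_simps)
    show ?case
    proof (rule subsetI, rule ccontr)
      fix \<omega> assume "\<omega> \<in> {\<omega>\<in>space M. \<not> parabolic_peaks B \<epsilon> \<delta> u (\<lambda>t. X t \<omega>)}"
        and no: "\<omega> \<notin> A1 u \<union> A3 u \<union> E2 u \<union> E3 u \<union> E4 u"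
      then have \<omega>: "\<omega> \<in> space M" and np: "\<not> parabolic_peaks B \<epsilon> \<delta> u (\<lambda>t. X t \<omega>)" by auto
      have b1: "\<bar>X1 i p \<omega>\<bar> \<le> K1 * u" if "p \<in> B" for i p
      proof (rule ccontr)
        assume "\<not> ?thesis"
        then have "\<exists>i\<in>UNIV. \<exists>t\<in>B. K1 * u < \<bar>X1 i t \<omega>\<bar>" using that by (intro bexI[of _ i] bexI[of _ p]) auto
        then show False using no \<omega> unfolding A1_def by blast
      qed
      have b3: "\<bar>X3 i j k p \<omega>\<bar> \<le> K3 * u" if "p \<in> B" for i j k p
      proof (rule ccontr)
        assume "\<not> ?thesis"
        then have "\<exists>q\<in>UNIV. \<exists>t\<in>B. K3 * u < \<bar>X3 (fst q) (fst (snd q)) (snd (snd q)) t \<omega>\<bar>"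
          using that by (intro bexI[of _ "(i, j, k)"] bexI[of _ p]) auto
        then show False using no \<omega> unfolding A3_def by blast
      qed
      have lip: "\<bar>X s \<omega> - X t \<omega>\<bar> \<le> K * u * norm (s - t)" if "s \<in> B" "t \<in> B" for s t
      proof -
        have "\<bar>X s \<omega> - X t \<omega>\<bar> \<le> real CARD('n) * (K1 * u) * norm (s - t)"
          by (rule class_C_lipschitz[where f = "\<lambda>t. X t \<omega>" and L = "K1 * u", OF class_C_Suc(1)[OF \<omega>] B(2) that])
            (use b1 in \<open>simp add: X1_def\<close>)
        also have "\<dots> \<le> K * u * norm (s - t)"
          using K(2) elim(1) mult_right_mono[of "n * K1" K u] by (intro mult_right_mono) (auto simp: n_def mult_ac)
        finally show ?thesis .
      qed
      have lip2: "\<bar>X2 i j s \<omega> - X2 i j t \<omega>\<bar> \<le> K * u * norm (s - t)" if "s \<in> B" "t \<in> B" for s t i j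
      proof -
        have "\<bar>X2 i j s \<omega> - X2 i j t \<omega>\<bar> \<le> real CARD('n) * (K3 * u) * norm (s - t)"
          by (rule class_C_lipschitz[where f = "\<lambda>t. X2 i j t \<omega>" and L = "K3 * u", OF class_C_Suc(3)[OF \<omega>] B(2) that])
            (use b3 in \<open>simp add: X3_def\<close>)
        also have "\<dots> \<le> K * u * norm (s - t)"
          using K(3) elim(1) mult_right_mono[of "n * K3" K u] by (intro mult_right_mono) (auto simp: n_def mult_ac)
        finally show ?thesis .
      qed
      have small: "K * u * x \<le> c * u" if "x \<le> y" "K * y \<le> c" for x y c
      proof -
        have "K * x \<le> c" using mult_left_mono[OF that(1), of K] that(2) K by linarith
        then have "K * x * u \<le> c * u" using elim(1) by (intro mult_right_mono) auto
        then show ?thesis by (simp add: mult_ac)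
      qed
      \<comment> \<open>near a high point the Hessian is \<open>- u I\<close> up to \<open>3 e u\<close>: one \<open>e u\<close> from the residual, one from the height, one from the grid\<close>
      have hess: "\<bar>X2 i j p \<omega> + (if i = j then u else 0)\<bar> \<le> 3 * e * u"
        if p: "p \<in> B" and t: "t \<in> B" "norm (p - t) \<le> \<delta>" "u - 1 \<le> X t \<omega>" for i j p t
      proof -
        obtain g where g: "g \<in> G" "norm (p - g) < \<eta>" using G(3)[OF p] by blast
        have gB: "g \<in> B" using g G by auto
        have "\<bar>X p \<omega> - X t \<omega>\<bar> \<le> e2 / 4 * u" using lip[OF p t(1)] small[OF t(2) \<delta>(3)] by linarith
        moreover have "\<bar>X p \<omega> - X g \<omega>\<bar> \<le> e2 / 4 * u" using lip[OF p gB] small[OF less_imp_le[OF g(2)] \<eta>2(2)] by linarith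
        ultimately have low: "X g \<omega> \<ge> (1 - e2) * u" 
          using t(3) u1 unfolding left_diff_distrib by linarith
        have up: "X g \<omega> < (1 + e) * u" using no \<omega> g by (auto simp: E2_def not_le)
        have "\<omega> \<notin> {\<omega>\<in>space M. X g \<omega> \<ge> (1 - l * e / 2) * u \<and> \<bar>Z i j g \<omega>\<bar> \<ge> e * u}"
          using no g unfolding E3_def by (force intro: UN_I[of "(g, i, j)"])
        then have z: "\<bar>Z i j g \<omega>\<bar> < e * u" using low \<omega> by (auto simp: e2_def not_le)
        have "\<bar>X2 i j p \<omega> - X2 i j g \<omega>\<bar> \<le> e2 / 4 * u" using lip2[OF p gB] small[OF less_imp_le[OF g(2)] \<eta>2(2)] by (meson order_trans)
        moreover have "e2 * u \<le> e * u" using e2 elim(1) by (intro mult_right_mono) auto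
        moreover have "0 \<le> e2 * u" using e2 elim(1) by simp
        moreover have "u - e2 * u \<le> X g \<omega>" "X g \<omega> < u + e * u" using low up by (simp_all add: algebra_simps)
        ultimately have "\<bar>X g \<omega> - u\<bar> \<le> e * u" "0 \<le> e * u" and "\<bar>X2 i j p \<omega> - X2 i j g \<omega>\<bar> \<le> e * u"
          by linarith+
        moreover from this have "\<bar>(if i = j then X g \<omega> else 0) - (if i = j then u else 0)\<bar> \<le> e * u" by simp
        ultimately have "\<bar>X2 i j p \<omega> + (if i = j then u else 0)\<bar> \<le> e * u + e * u + e * u"
          using z unfolding Z_def by linarith
        then show ?thesis by simp
      qed
      have "parabolic_peaks B \<epsilon> \<delta> u (\<lambda>t. X t \<omega>)"
        unfolding parabolic_peaks_def
      proof (intro conjI ballI impI allI)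
        fix s t i assume s: "s \<in> B" and t: "t \<in> B" and d: "norm (s - t) \<le> \<delta>" and f: "u - 1 \<le> X t \<omega>"
        obtain \<tau> where \<tau>: "\<tau> \<in> {0<..<1}"
          and eq: "X1 i s \<omega> - X1 i t \<omega> = (\<Sum>j\<in>UNIV. (s $ j - t $ j) * partial j (\<lambda>t. X1 i t \<omega>) (t + \<tau> *\<^sub>R (s - t)))"
          using class_C_mvt[OF class_C_Suc(2)[OF \<omega>]] by blast
        define p where "p = t + \<tau> *\<^sub>R (s - t)"
        have p: "p \<in> B" "norm (p - t) \<le> \<delta>" using segment_point[OF B(2) s t \<tau>] d by (auto simp: p_def)
        have "X1 i s \<omega> - X1 i t \<omega> + u * (s $ i - t $ i)
           = (\<Sum>j\<in>UNIV. (s $ j - t $ j) * X2 i j p \<omega>) + (\<Sum>j\<in>UNIV. if j = i then (s $ j - t $ j) * u else 0)"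
          unfolding eq p_def[symmetric] X2_def by (simp add: mult.commute)
        also have "\<dots> = (\<Sum>j\<in>UNIV. (s - t) $ j * (X2 i j p \<omega> + (if i = j then u else 0)))"
          unfolding sum.distrib[symmetric] by (intro sum.cong refl) (simp add: algebra_simps)
        finally have "\<bar>X1 i s \<omega> - X1 i t \<omega> + u * (s $ i - t $ i)\<bar> \<le> CARD('n) * (3 * e * u) * norm (s - t)"
          using sum_abs_le_norm[where v = "s - t" and c = "\<lambda>j. X2 i j p \<omega> + (if i = j then u else 0)",
              OF hess[OF p(1) t p(2) f]] by simp
        also have "\<dots> \<le> \<epsilon> / n * u * norm (s - t)"
        proof -
          have "n * (3 * e) \<le> n * (\<epsilon> / n\<^sup>2)" using e(3) n by (intro mult_left_mono) auto
          also have "\<dots> = \<epsilon> / n" using n by (simp add: power2_eq_square)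
          finally have "n * (3 * e) * u * norm (s - t) \<le> \<epsilon> / n * u * norm (s - t)"
            using elim(1) by (intro mult_right_mono) auto
          then show ?thesis by (simp add: n_def mult_ac)
        qed
        finally show "\<bar>partial i (\<lambda>t. X t \<omega>) s - partial i (\<lambda>t. X t \<omega>) t + u * (s $ i - t $ i)\<bar> \<le> \<epsilon> / CARD('n) * u * norm (s - t)"
          by (simp add: X1_def n_def)
      next
        fix s t assume s: "s \<in> B" and t: "t \<in> B" and f: "u - 1 \<le> X s \<omega>" "u - 1 \<le> X t \<omega>"
        show "norm (s - t) < \<delta>"
        proof (rule ccontr)
          assume far: "\<not> norm (s - t) < \<delta>"
          obtain g h where g: "g \<in> G" "norm (s - g) < \<eta>" and h: "h \<in> G" "norm (t - h) < \<eta>"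
            using G(3)[OF s] G(3)[OF t] by blast
          have "norm (s - t) \<le> norm (s - g) + norm (g - h) + norm (t - h)"
            using norm_triangle_ineq[of "s - g" "g - h"] norm_triangle_ineq4[of "s - h" "t - h"] by simp
          then have "\<delta> / 2 \<le> norm (g - h)" using far g h \<eta>2 by linarith
          then have "(g, h) \<in> G2" using g h by (simp add: G2_def)
          then have lt: "X g \<omega> + X h \<omega> < (2 * (1 - e3)) * u"
            using no \<omega> by (force simp: E4_def not_le)
          have gB: "g \<in> B" "h \<in> B" using g h G by auto
          have "\<bar>X s \<omega> - X g \<omega>\<bar> \<le> e3 / 2 * u" using lip[OF s gB(1)] small[OF less_imp_le[OF g(2)] \<eta>2(3)] by linarith
          moreover have "\<bar>X t \<omega> - X h \<omega>\<bar> \<le> e3 / 2 * u" using lip[OF t gB(2)] small[OF less_imp_le[OF h(2)] \<eta>2(3)] by linarith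
          ultimately show False using lt f u1 unfolding left_diff_distrib right_diff_distrib by linarith
        qed
      qed
      then show False using np by simp
    qed
  qed
  ultimately have "negligible_at (\<lambda>u. {\<omega>\<in>space M. \<not> parabolic_peaks B \<epsilon> \<delta> u (\<lambda>t. X t \<omega>)})"
    by (rule negligible_at_mono)
  then show ?thesis using \<delta> by (intro exI[of _ \<delta>] conjI)
qed

end

section \<open>Geometry of a parabolic peak\<close>

text \<open>The mean value theorem along the segment, applied to the difference between the path and its Taylor paraboloid.\<close>

lemma parabolic_taylor:
  fixes f :: "real^'n \<Rightarrow> real"
  assumes f: "class_C (Suc k) f" and pk: "parabolic_peaks B \<epsilon> \<delta> u f" and B: "convex B" "s \<in> B" "t \<in> B"
    and d: "norm (s - t) \<le> \<delta>" and ft: "u - 1 \<le> f t" and \<epsilon>: "0 \<le> \<epsilon>" "0 \<le> u"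
  shows "\<bar>f s - f t - (\<Sum>i\<in>UNIV. (s $ i - t $ i) * partial i f t) + u / 2 * (norm (s - t))\<^sup>2\<bar> \<le> \<epsilon> * u * (norm (s - t))\<^sup>2"
proof -
  define v where "v = s - t"
  define L where "L = (\<Sum>i\<in>UNIV. v $ i * partial i f t)"
  define g where "g = (\<lambda>\<tau>. f (t + \<tau> *\<^sub>R v) - \<tau> * L + u / 2 * \<tau>\<^sup>2 * (norm v)\<^sup>2)"
  define g' where "g' = (\<lambda>\<tau>. (\<Sum>i\<in>UNIV. v $ i * partial i f (t + \<tau> *\<^sub>R v)) - L + u * \<tau> * (norm v)\<^sup>2)"
  have "(g has_real_derivative g' \<tau>) (at \<tau>)" for \<tau>
    unfolding g_def g'_def
    by (rule derivative_eq_intros class_C_line_derivative[OF f] refl | simp)+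
  then obtain \<tau> where \<tau>: "0 < \<tau>" "\<tau> < 1" and eq: "g 1 - g 0 = (1 - 0) * g' \<tau>"
    using MVT2[of 0 1 g g'] by auto
  define p where "p = t + \<tau> *\<^sub>R v"
  have p: "p \<in> B" "norm (p - t) \<le> norm v"
    using segment_point[OF B, of \<tau>] \<tau> by (auto simp: p_def v_def)
  have sq: "(norm v)\<^sup>2 = (\<Sum>i\<in>UNIV. v $ i * v $ i)"
    by (simp add: power2_norm_eq_inner inner_vec_def)
  have "g' \<tau> = (\<Sum>i\<in>UNIV. v $ i * (partial i f p - partial i f t + u * (p $ i - t $ i)))"
    unfolding g'_def L_def sq p_def
    by (simp add: sum_distrib_left sum_subtractf[symmetric] sum.distrib[symmetric] algebra_simps)
  also have "\<bar>\<dots>\<bar> \<le> CARD('n) * (\<epsilon> / CARD('n) * u * norm v) * norm v"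
  proof (rule sum_abs_le_norm)
    fix i
    have "\<bar>partial i f p - partial i f t + u * (p $ i - t $ i)\<bar> \<le> \<epsilon> / CARD('n) * u * norm (p - t)"
      using pk p(1) B(3) ft order_trans[OF p(2)] d unfolding parabolic_peaks_def v_def by blast
    also have "\<dots> \<le> \<epsilon> / CARD('n) * u * norm v" using p(2) \<epsilon> by (intro mult_left_mono) auto
    finally show "\<bar>partial i f p - partial i f t + u * (p $ i - t $ i)\<bar> \<le> \<epsilon> / CARD('n) * u * norm v" .
  qed
  also have "\<dots> = \<epsilon> * u * (norm v)\<^sup>2" by (simp add: power2_eq_square)
  finally have "\<bar>g 1 - g 0\<bar> \<le> \<epsilon> * u * (norm v)\<^sup>2" using eq by simp
  then show ?thesis unfolding g_def L_def v_def by simp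
qed

lemma exists_dist_less_if_infdist_less:
  assumes "infdist t S < x" "S \<noteq> {}"
  shows "\<exists>s\<in>S. dist t s < x"
proof (rule ccontr)
  assume "\<not> ?thesis"
  then have "x \<le> infdist t S"
    unfolding infdist_notempty[OF assms(2)] using assms(2) by (intro cINF_greatest) (auto simp: not_less)
  then show False using assms(1) by simp
qed

text \<open>Cubes rather than balls, because the event that all partial derivatives are small is a rectangle, whose probability is
a product.\<close>

definition cube :: "real^'n \<Rightarrow> real \<Rightarrow> (real^'n) set" where
  "cube t h = cbox (t - (\<chi> i. h)) (t + (\<chi> i. h))"

lemma mem_cube: "s \<in> cube t h \<longleftrightarrow> (\<forall>i. \<bar>s $ i - t $ i\<bar> \<le> h)"
  unfolding cube_def mem_box_cart by (simp add: abs_le_iff) (metis add.commute add_diff_cancel_left' diff_le_eq le_diff_eq)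

lemma emeasure_cube:
  fixes t :: "real^'n"
  assumes "0 \<le> h"
  shows "emeasure lborel (cube t h) = ennreal ((2 * h) ^ CARD('n))"
proof -
  have ne: "cube t h \<noteq> {}" using mem_cube[of t t h] assms by auto
  then have "measure lborel (cube t h) = (\<Prod>i\<in>UNIV. (t + (\<chi> i. h)) $ i - (t - (\<chi> i. h)) $ i)"
    unfolding cube_def by (rule content_cbox_cart)
  also have "\<dots> = (2 * h) ^ CARD('n)" by simp
  finally have "measure lborel (cube t h) = (2 * h) ^ CARD('n)" .
  moreover have "emeasure lborel (cube t h) \<noteq> \<infinity>" 
    using emeasure_bounded_finite[of "cube t h"] unfolding cube_def by (simp add: bounded_cbox)
  ultimately show ?thesis by (metis emeasure_eq_ennreal_measure infinity_ennreal_def)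
qed

lemma norm_le_cube:
  fixes s t :: "real^'n" and h :: real
  assumes "s \<in> cube t h"
  shows "norm (s - t) \<le> CARD('n) * h"
proof -
  have "norm (s - t) \<le> (\<Sum>i\<in>UNIV. \<bar>(s - t) $ i\<bar>)" by (rule norm_le_l1_cart)
  also have "\<dots> \<le> (\<Sum>i\<in>(UNIV::'n set). h)" using assms by (intro sum_mono) (simp add: mem_cube)
  finally show ?thesis by simp
qed

text \<open>One path on the good event. The scale \<open>\<kappa>\<close> is the dimension times the bound imposed on the partial derivatives.\<close>

locale parabolic_path =
  fixes f :: "real^'n \<Rightarrow> real" and S :: "(real^'n) set" and r \<epsilon> \<delta> u \<kappa> :: real and k :: nat
  assumes f: "class_C (Suc k) f" and pk: "parabolic_peaks (cball 0 (r + 1)) \<epsilon> \<delta> u f"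
    and S: "S \<noteq> {}" "S \<subseteq> cball 0 r" and \<epsilon>: "0 < \<epsilon>" "\<epsilon> < 1/2" and \<delta>: "0 < \<delta>" "\<delta> \<le> 1/2"
    and u: "0 < u" and \<kappa>: "0 < \<kappa>" "\<kappa> / u \<le> \<delta>" "\<kappa>\<^sup>2 / u \<le> 1"
begin

lemmas taylor = parabolic_taylor[OF f pk convex_cball _ _ _ _ less_imp_le[OF \<epsilon>(1)] less_imp_le[OF u]]

lemma near_S: "s \<in> S \<Longrightarrow> norm (t - s) \<le> 1 \<Longrightarrow> t \<in> cball 0 (r + 1)"
  using S(2) norm_triangle_ineq[of "t - s" s] by (auto simp: subset_eq)

lemma gradient_close:
  assumes "s \<in> cball 0 (r + 1)" "t \<in> cball 0 (r + 1)" "norm (s - t) \<le> \<delta>" "u - 1 \<le> f t"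
  shows "\<bar>partial i f s - partial i f t + u * (s $ i - t $ i)\<bar> \<le> \<epsilon> / CARD('n) * u * norm (s - t)"
  using pk assms unfolding parabolic_peaks_def by blast

lemma high_points_close:
  assumes "s \<in> cball 0 (r + 1)" "t \<in> cball 0 (r + 1)" "u - 1 \<le> f s" "u - 1 \<le> f t"
  shows "norm (s - t) < \<delta>"
  using pk assms unfolding parabolic_peaks_def by blast

text \<open>The maximum over the ball of radius \<open>\<delta>\<close> about \<open>s\<close> cannot sit on the boundary, because two high points are closer than
\<open>\<delta>\<close>; so it is critical.\<close>

lemma peak:
  assumes s: "s \<in> S" "u < f s"
  shows "\<exists>t0. norm (s - t0) < \<delta> \<and> f s \<le> f t0 \<and> (\<forall>i. partial i f t0 = 0)"
proof -
  have "continuous_on (cball s \<delta>) f" using class_C_continuous[OF f] by (rule continuous_on_subset) simp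
  moreover have "cball s \<delta> \<noteq> {}" using \<delta> by simp
  ultimately obtain t0 where t0: "t0 \<in> cball s \<delta>" "\<And>t. t \<in> cball s \<delta> \<Longrightarrow> f t \<le> f t0"
    using continuous_attains_sup[OF compact_cball] by blast
  have ge: "f s \<le> f t0" using t0(2)[of s] \<delta> by simp
  have inB: "s \<in> cball 0 (r + 1)" "t0 \<in> cball 0 (r + 1)"
    using near_S[OF s(1), of s] near_S[OF s(1), of t0] t0(1) \<delta> by (auto simp: dist_norm norm_minus_commute)
  have lt: "norm (s - t0) < \<delta>" using high_points_close[OF inB] ge s(2) by auto
  have "(\<lambda>v. \<Sum>i\<in>UNIV. v $ i * partial i f t0) = (\<lambda>v. 0)"
    by (rule differential_zero_maxmin[of t0 "ball s \<delta>", OF _ open_ball class_C_has_derivative[OF f]])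
      (use lt t0(2) in \<open>auto simp: dist_norm\<close>)
  then have "(\<Sum>j\<in>UNIV. axis i 1 $ j * partial j f t0) = 0" for i by (rule fun_cong)
  then have "partial i f t0 = 0" for i
    by (simp add: axis_def if_distrib[of "\<lambda>y. y * _"] cong: if_cong)
  then show ?thesis using lt ge by blast
qed

text \<open>Around the peak, every point of a small cube has small partial derivatives and nearly the height of the peak, while
the exceedance at \<open>s\<close> bounds the distance from the peak to \<open>S\<close>. The terms in \<open>\<kappa>\<close> absorb the displacement from \<open>t0\<close> to \<open>t\<close>.\<close>

lemma cube_inside:
  assumes s: "s \<in> S" "u < f s"
  shows "\<exists>t0. cube t0 (\<kappa> / CARD('n) / ((1 + \<epsilon>) * u)) \<subseteq>
    {t. (\<forall>i. \<bar>partial i f t\<bar> \<le> \<kappa> / CARD('n)) \<and> u - \<kappa>\<^sup>2 / u \<le> f t \<and>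
        infdist t S \<le> (sqrt (2 * (u * (f t - u) + \<kappa>\<^sup>2) / (1 - 2 * \<epsilon>)) + \<kappa>) / u}"
proof -
  define n where "n = real CARD('n)"
  have n: "0 < n" by (simp add: n_def)
  obtain t0 where t0: "norm (s - t0) < \<delta>" "f s \<le> f t0" "\<And>i. partial i f t0 = 0" using peak[OF s] by blast
  have inB: "s \<in> cball 0 (r + 1)" "t0 \<in> cball 0 (r + 1)"
    using near_S[OF s(1), of s] near_S[OF s(1), of t0] t0(1) \<delta> by (auto simp: norm_minus_commute)
  define h where "h = \<kappa> / n / ((1 + \<epsilon>) * u)"
  have h0: "0 \<le> h" using \<kappa> n \<epsilon> u by (simp add: h_def)
  have nh: "n * h = \<kappa> / u / (1 + \<epsilon>)" using n by (simp add: h_def)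
  also have "\<dots> \<le> \<kappa> / u" using \<epsilon> \<kappa> u divide_left_mono[of 1 "1 + \<epsilon>" "\<kappa> / u"] by simp
  finally have nh1: "n * h \<le> \<kappa> / u" .
  show ?thesis
  proof (intro exI[of _ t0] subsetI CollectI conjI allI)
    fix t assume "t \<in> cube t0 (\<kappa> / real CARD('n) / ((1 + \<epsilon>) * u))"
    then have t: "t \<in> cube t0 h" by (simp add: h_def n_def)
    have tn: "norm (t - t0) \<le> n * h" using norm_le_cube[OF t] by (simp add: n_def)
    then have tk: "norm (t - t0) \<le> \<kappa> / u" "norm (t - t0) \<le> \<delta>" using nh1 \<kappa> by auto
    have tB: "t \<in> cball 0 (r + 1)"
      by (rule near_S[OF s(1)]) (use norm_triangle_ineq[of "t - t0" "t0 - s"] tk t0(1) \<delta> in \<open>simp add: norm_minus_commute\<close>)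
    have high: "u - 1 \<le> f t0" using t0(2) s(2) by simp
    show "\<bar>partial i f t\<bar> \<le> \<kappa> / real CARD('n)" for i
    proof -
      have "\<bar>partial i f t + u * (t $ i - t0 $ i)\<bar> \<le> \<epsilon> / n * u * norm (t - t0)"
        using gradient_close[OF tB inB(2) tk(2) high, of i] t0(3) by (simp add: n_def)
      also have "\<dots> \<le> \<epsilon> / n * u * (n * h)" using tn \<epsilon> n u by (intro mult_left_mono) auto
      also have "\<dots> = \<epsilon> * (u * h)" using n by simp
      finally have "\<bar>partial i f t + u * (t $ i - t0 $ i)\<bar> \<le> \<epsilon> * (u * h)" .
      moreover have "\<bar>u * (t $ i - t0 $ i)\<bar> \<le> u * h"
        using t u by (auto simp: mem_cube abs_mult intro!: mult_left_mono)
      ultimately have "\<bar>partial i f t\<bar> \<le> \<epsilon> * (u * h) + u * h" by linarith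
      also have "\<dots> = (1 + \<epsilon>) * (u * h)" by (simp add: algebra_simps)
      also have "\<dots> = \<kappa> / n" using u \<epsilon> by (simp add: h_def)
      finally show ?thesis by (simp add: n_def)
    qed
    have sqk: "u * (norm (t - t0))\<^sup>2 \<le> \<kappa>\<^sup>2 / u"
    proof -
      have "(norm (t - t0))\<^sup>2 \<le> (\<kappa> / u)\<^sup>2" using tk(1) by (rule power_mono) simp
      then have "u * (norm (t - t0))\<^sup>2 \<le> u * (\<kappa> / u)\<^sup>2" using u by (intro mult_left_mono) auto
      also have "\<dots> = \<kappa>\<^sup>2 / u" using u by (simp add: power2_eq_square)
      finally show ?thesis .
    qed
    have drop: "f t0 - \<kappa>\<^sup>2 / u \<le> f t"
    proof -
      have "\<bar>f t - f t0 + u / 2 * (norm (t - t0))\<^sup>2\<bar> \<le> \<epsilon> * u * (norm (t - t0))\<^sup>2"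
        using taylor[OF tB inB(2) tk(2) high] t0(3) by simp
      moreover have "\<epsilon> * u * (norm (t - t0))\<^sup>2 \<le> 1 / 2 * u * (norm (t - t0))\<^sup>2"
        using \<epsilon> u by (intro mult_right_mono) auto
      ultimately show ?thesis using sqk by linarith
    qed
    then show "u - \<kappa>\<^sup>2 / u \<le> f t" using t0(2) s(2) by linarith
    define Q where "Q = 2 * (u * (f t - u) + \<kappa>\<^sup>2) / (1 - 2 * \<epsilon>)"
    have "norm (s - t0) \<le> sqrt Q / u"
    proof -
      have "\<bar>f s - f t0 + u / 2 * (norm (s - t0))\<^sup>2\<bar> \<le> \<epsilon> * u * (norm (s - t0))\<^sup>2"
        using taylor[OF inB less_imp_le[OF t0(1)] high] t0(3) by simp
      then have "u / 2 * (norm (s - t0))\<^sup>2 - \<epsilon> * u * (norm (s - t0))\<^sup>2 \<le> f t - u + \<kappa>\<^sup>2 / u"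
        using drop s(2) by linarith
      then have "2 * u * (u / 2 * (norm (s - t0))\<^sup>2 - \<epsilon> * u * (norm (s - t0))\<^sup>2) \<le> 2 * u * (f t - u + \<kappa>\<^sup>2 / u)"
        using u by (intro mult_left_mono) auto
      also have "2 * u * (f t - u + \<kappa>\<^sup>2 / u) = 2 * (u * (f t - u) + \<kappa>\<^sup>2)" using u by (simp add: field_simps)
      also have "2 * u * (u / 2 * (norm (s - t0))\<^sup>2 - \<epsilon> * u * (norm (s - t0))\<^sup>2) = (1 - 2 * \<epsilon>) * (u * norm (s - t0))\<^sup>2"
        by (simp add: power2_eq_square algebra_simps)
      finally have "(u * norm (s - t0))\<^sup>2 \<le> Q" unfolding Q_def using \<epsilon> by (simp add: pos_le_divide_eq mult.commute)
      then have "u * norm (s - t0) \<le> sqrt Q" by (rule real_le_rsqrt)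
      then show ?thesis using u by (simp add: pos_le_divide_eq mult.commute)
    qed
    moreover have "infdist t S \<le> norm (t - t0) + norm (s - t0)"
      using infdist_le[OF s(1), of t] norm_triangle_ineq[of "t - t0" "t0 - s"] by (simp add: dist_norm norm_minus_commute)
    ultimately show "infdist t S \<le> (sqrt (2 * (u * (f t - u) + \<kappa>\<^sup>2) / (1 - 2 * \<epsilon>)) + \<kappa>) / u"
      using tk(1) by (simp add: Q_def add_divide_distrib)
  qed
qed

text \<open>Conversely, a point \<open>t\<close> of this set sees a point of \<open>S\<close> so close that the paraboloid is still above \<open>u\<close> there. All
such points belong to the same peak, and a gradient bounded by \<open>\<kappa> / n\<close> confines them to a cube about it.\<close>

lemma inside_cube:
  defines "W \<equiv> {t. (\<forall>i. \<bar>partial i f t\<bar> \<le> \<kappa> / CARD('n)) \<and> u < f t \<and> f t \<le> (1 + \<delta>\<^sup>2 / 2) * u \<and>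
        infdist t S \<le> (sqrt (2 * u * (f t - u) / (1 + 2 * \<epsilon>)) - 2 * \<kappa>) / u}"
  assumes "W \<noteq> {}"
  shows "(\<exists>s\<in>S. u < f s) \<and> (\<exists>t0. W \<subseteq> cube t0 (\<kappa> / CARD('n) / ((1 - \<epsilon>) * u)))"
proof -
  define n where "n = real CARD('n)"
  have n: "0 < n" by (simp add: n_def)
  have near: "\<exists>s\<in>S. norm (s - t) < \<delta> \<and> u * norm (s - t) + \<kappa> < sqrt (2 * u * (f t - u) / (1 + 2 * \<epsilon>))" if t: "t \<in> W" for t
  proof -
    define Q where "Q = 2 * u * (f t - u) / (1 + 2 * \<epsilon>)"
    have "infdist t S \<le> (sqrt Q - 2 * \<kappa>) / u" using t unfolding W_def Q_def by blast
    also have "\<dots> < (sqrt Q - \<kappa>) / u" using \<kappa> u by (simp add: divide_strict_right_mono)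
    finally obtain s where s: "s \<in> S" "dist t s < (sqrt Q - \<kappa>) / u"
      using exists_dist_less_if_infdist_less S by blast
    then have lt: "u * norm (s - t) + \<kappa> < sqrt Q"
      using u by (simp add: dist_norm norm_minus_commute pos_less_divide_eq mult.commute)
    have "Q \<le> (u * \<delta>)\<^sup>2"
    proof -
      have "f t - u \<le> \<delta>\<^sup>2 / 2 * u" "0 \<le> f t - u" using t unfolding W_def by (auto simp: algebra_simps)
      then have "2 * u * (f t - u) \<le> 2 * u * (\<delta>\<^sup>2 / 2 * u)" "0 \<le> 2 * u * (f t - u)" using u by (auto intro!: mult_left_mono)
      moreover have "Q \<le> 2 * u * (f t - u)" unfolding Q_def using \<epsilon> calculation(2)
          divide_left_mono[of 1 "1 + 2 * \<epsilon>" "2 * u * (f t - u)"] by simp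
      moreover have "2 * u * (\<delta>\<^sup>2 / 2 * u) = (u * \<delta>)\<^sup>2" by (simp add: power2_eq_square)
      ultimately show ?thesis by linarith
    qed
    then have "sqrt Q \<le> u * \<delta>" using u \<delta> by (intro real_le_lsqrt) auto
    then have "u * norm (s - t) < u * \<delta>" using lt \<kappa> by linarith
    then have "norm (s - t) < \<delta>" using u by simp
    then show ?thesis using s(1) lt unfolding Q_def by blast
  qed
  have WB: "t \<in> cball 0 (r + 1)" if "t \<in> W" for t
    using near[OF that] near_S \<delta> by (force simp: norm_minus_commute)
  have exceed: "u < f s" if t: "t \<in> W" and s: "s \<in> S" "norm (s - t) < \<delta>"
    "u * norm (s - t) + \<kappa> < sqrt (2 * u * (f t - u) / (1 + 2 * \<epsilon>))" for s t
  proof -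
    define R where "R = norm (s - t)"
    have sB: "s \<in> cball 0 (r + 1)" using near_S[OF s(1), of s] by simp
    have ft: "u < f t" using t by (simp add: W_def)
    have "\<bar>f s - f t - (\<Sum>i\<in>UNIV. (s - t) $ i * partial i f t) + u / 2 * R\<^sup>2\<bar> \<le> \<epsilon> * u * R\<^sup>2"
      using taylor[OF sB WB[OF t] less_imp_le[OF s(2)]] ft by (simp add: R_def)
    moreover have "\<bar>\<Sum>i\<in>UNIV. (s - t) $ i * partial i f t\<bar> \<le> real CARD('n) * (\<kappa> / CARD('n)) * norm (s - t)"
      using t by (intro sum_abs_le_norm) (simp add: W_def)
    ultimately have 1: "f s \<ge> f t - \<kappa> * R - u / 2 * R\<^sup>2 - \<epsilon> * u * R\<^sup>2" by (simp add: R_def)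
    have R: "0 \<le> R" by (simp add: R_def)
    have "(u * R + \<kappa>)\<^sup>2 < (sqrt (2 * u * (f t - u) / (1 + 2 * \<epsilon>)))\<^sup>2"
      using s(3) u \<kappa> R by (intro power_strict_mono) (auto simp: R_def)
    also have "\<dots> = 2 * u * (f t - u) / (1 + 2 * \<epsilon>)" using u ft \<epsilon> by simp
    finally have 2: "(1 + 2 * \<epsilon>) * (u * R + \<kappa>)\<^sup>2 < 2 * u * (f t - u)" using \<epsilon> by (simp add: pos_less_divide_eq mult.commute)
    have "2 * u * (\<kappa> * R + u / 2 * R\<^sup>2 + \<epsilon> * u * R\<^sup>2) = (1 + 2 * \<epsilon>) * (u * R)\<^sup>2 + 2 * (u * R) * \<kappa>"
      by (simp add: power2_eq_square algebra_simps)
    also have "\<dots> \<le> (1 + 2 * \<epsilon>) * (u * R)\<^sup>2 + (1 + 2 * \<epsilon>) * (2 * (u * R) * \<kappa> + \<kappa>\<^sup>2)"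
    proof -
      have "1 * (2 * (u * R) * \<kappa>) \<le> (1 + 2 * \<epsilon>) * (2 * (u * R) * \<kappa> + \<kappa>\<^sup>2)"
        using \<epsilon> u R \<kappa> by (intro mult_mono) auto
      then show ?thesis by simp
    qed
    also have "\<dots> = (1 + 2 * \<epsilon>) * (u * R + \<kappa>)\<^sup>2" by (simp add: power2_sum algebra_simps)
    also note 2
    finally have "\<kappa> * R + u / 2 * R\<^sup>2 + \<epsilon> * u * R\<^sup>2 < f t - u" using u by simp
    then show ?thesis using 1 by linarith
  qed
  obtain t1 where "t1 \<in> W" using assms(2) by blast
  with near obtain s where s: "s \<in> S" "u < f s" using exceed by meson
  obtain t0 where t0: "norm (s - t0) < \<delta>" "f s \<le> f t0" "\<And>i. partial i f t0 = 0" using peak[OF s] by blast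
  have t0B: "t0 \<in> cball 0 (r + 1)" using near_S[OF s(1), of t0] t0(1) \<delta> by (auto simp: norm_minus_commute)
  have "W \<subseteq> cube t0 (\<kappa> / CARD('n) / ((1 - \<epsilon>) * u))"
  proof
    fix t assume t: "t \<in> W"
    have ft: "u < f t" using t by (simp add: W_def)
    have d: "norm (t - t0) < \<delta>" using high_points_close[OF WB[OF t] t0B] ft t0(2) s(2) by auto
    \<comment> \<open>the coordinate in which \<open>t\<close> deviates most controls all others\<close>
    obtain m where m: "\<And>i. \<bar>t $ i - t0 $ i\<bar> \<le> \<bar>t $ m - t0 $ m\<bar>"
    proof -
      have "Max (range (\<lambda>i. \<bar>t $ i - t0 $ i\<bar>)) \<in> range (\<lambda>i. \<bar>t $ i - t0 $ i\<bar>)" by (intro Max_in) auto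
      then obtain m where "Max (range (\<lambda>i. \<bar>t $ i - t0 $ i\<bar>)) = \<bar>t $ m - t0 $ m\<bar>" by (rule rangeE)
      then have "\<bar>t $ i - t0 $ i\<bar> \<le> \<bar>t $ m - t0 $ m\<bar>" for i
        using Max_ge[of "range (\<lambda>i. \<bar>t $ i - t0 $ i\<bar>)" "\<bar>t $ i - t0 $ i\<bar>"] by simp
      then show ?thesis by (rule that)
    qed
    define y where "y = \<bar>t $ m - t0 $ m\<bar>"
    have "t \<in> cube t0 y" using m by (simp add: mem_cube y_def)
    then have nt: "norm (t - t0) \<le> n * y" using norm_le_cube by (force simp: n_def)
    have "\<bar>partial m f t + u * (t $ m - t0 $ m)\<bar> \<le> \<epsilon> / n * u * norm (t - t0)"
      using gradient_close[OF WB[OF t] t0B less_imp_le[OF d], of m] t0 s(2) by (simp add: n_def)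
    also have "\<dots> \<le> \<epsilon> / n * u * (n * y)" using nt \<epsilon> n u by (intro mult_left_mono) auto
    also have "\<dots> = \<epsilon> * (u * y)" using n by simp
    finally have "\<bar>u * (t $ m - t0 $ m)\<bar> \<le> \<epsilon> * (u * y) + \<bar>partial m f t\<bar>" by linarith
    moreover have "\<bar>partial m f t\<bar> \<le> \<kappa> / n" using t by (simp add: W_def n_def)
    moreover have "\<bar>u * (t $ m - t0 $ m)\<bar> = u * y" using u by (simp add: y_def abs_mult)
    ultimately have "(1 - \<epsilon>) * u * y \<le> \<kappa> / n" by (simp add: algebra_simps)
    then have "y * ((1 - \<epsilon>) * u) \<le> \<kappa> / n" by (simp only: mult.commute[of y])
    moreover have "0 < (1 - \<epsilon>) * u" using \<epsilon> u by simp
    ultimately have "y \<le> \<kappa> / n / ((1 - \<epsilon>) * u)" by (simp only: pos_le_divide_eq)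
    then show "t \<in> cube t0 (\<kappa> / CARD('n) / ((1 - \<epsilon>) * u))"
      using m unfolding mem_cube by (auto simp: y_def n_def intro: order_trans)
  qed
  then show ?thesis using s by blast
qed

end

section \<open>Expected volume of the near-critical points\<close>

lemma measurable_vec_nth[measurable]: "(\<lambda>x::real^'n. x $ i) \<in> borel_measurable borel"
  by (intro borel_measurable_continuous_onI continuous_intros)

text \<open>The field is the pointwise limit of its values at the lattice points obtained by rounding the parameter down.\<close>

lemma measurable_continuous_field:
  fixes Y :: "real^'n \<Rightarrow> 'w \<Rightarrow> real"
  assumes [measurable]: "\<And>t. Y t \<in> borel_measurable M"
    and C: "\<And>\<omega>. \<omega> \<in> space M \<Longrightarrow> continuous_on UNIV (\<lambda>t. Y t \<omega>)"
  shows "(\<lambda>p. Y (fst p) (snd p)) \<in> borel_measurable (lborel \<Otimes>\<^sub>M M)"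
proof -
  define q :: "nat \<Rightarrow> real^'n \<Rightarrow> int^'n" where "q = (\<lambda>k t. \<chi> i. \<lfloor>real (Suc k) * t $ i\<rfloor>)"
  define z :: "nat \<Rightarrow> int^'n \<Rightarrow> real^'n" where "z = (\<lambda>k v. \<chi> i. of_int (v $ i) / real (Suc k))"
  have lim: "(\<lambda>k. z k (q k t)) \<longlonglongrightarrow> t" for t
  proof (rule vec_tendstoI)
    fix i
    have "(\<lambda>k. of_int \<lfloor>real (Suc k) * t $ i\<rfloor> / real (Suc k)) \<longlonglongrightarrow> t $ i"
    proof (rule tendsto_sandwich)
      show "\<forall>\<^sub>F k in sequentially. t $ i - inverse (real (Suc k)) \<le> of_int \<lfloor>real (Suc k) * t $ i\<rfloor> / real (Suc k)"
      proof (intro always_eventually allI)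
        fix k
        have "real (Suc k) * t $ i - 1 \<le> of_int \<lfloor>real (Suc k) * t $ i\<rfloor>" by linarith
        then have "(real (Suc k) * t $ i - 1) / real (Suc k) \<le> of_int \<lfloor>real (Suc k) * t $ i\<rfloor> / real (Suc k)"
          by (intro divide_right_mono) auto
        then show "t $ i - inverse (real (Suc k)) \<le> of_int \<lfloor>real (Suc k) * t $ i\<rfloor> / real (Suc k)"
          by (simp add: diff_divide_distrib inverse_eq_divide del: of_nat_Suc)
      qed
      show "\<forall>\<^sub>F k in sequentially. of_int \<lfloor>real (Suc k) * t $ i\<rfloor> / real (Suc k) \<le> t $ i"
      proof (intro always_eventually allI)
        fix k
        have "of_int \<lfloor>real (Suc k) * t $ i\<rfloor> \<le> real (Suc k) * t $ i" by linarith
        then have "of_int \<lfloor>real (Suc k) * t $ i\<rfloor> / real (Suc k) \<le> real (Suc k) * t $ i / real (Suc k)"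
          by (intro divide_right_mono) auto
        then show "of_int \<lfloor>real (Suc k) * t $ i\<rfloor> / real (Suc k) \<le> t $ i" by (simp del: of_nat_Suc)
      qed
      show "(\<lambda>k. t $ i - inverse (real (Suc k))) \<longlonglongrightarrow> t $ i"
        using tendsto_diff[OF tendsto_const LIMSEQ_inverse_real_of_nat, of "t $ i"] by (simp del: of_nat_Suc)
    qed (rule tendsto_const)
    then show "(\<lambda>k. z k (q k t) $ i) \<longlonglongrightarrow> t $ i" by (simp add: z_def q_def del: of_nat_Suc)
  qed
  show ?thesis
  proof (rule borel_measurable_LIMSEQ_real[where u = "\<lambda>k p. Y (z k (q k (fst p))) (snd p)"])
    fix p :: "(real^'n) \<times> 'w" assume "p \<in> space (lborel \<Otimes>\<^sub>M M)"
    then have "snd p \<in> space M" by (auto simp: space_pair_measure)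
    from C[OF this] have "isCont (\<lambda>t. Y t (snd p)) (fst p)" by (simp add: continuous_on_eq_continuous_at)
    then show "(\<lambda>k. Y (z k (q k (fst p))) (snd p)) \<longlonglongrightarrow> Y (fst p) (snd p)" using lim by (rule isCont_tendsto_compose)
  next
    fix k
    have q: "(\<lambda>p. q k (fst p)) \<in> measurable (lborel \<Otimes>\<^sub>M M) (count_space UNIV)"
      unfolding measurable_count_space_eq2_countable
    proof (intro conjI ballI)
      fix v :: "int^'n"
      have "(\<lambda>p. q k (fst p)) -` {v} \<inter> space (lborel \<Otimes>\<^sub>M M)
          = {p\<in>space (lborel \<Otimes>\<^sub>M M). \<forall>i\<in>UNIV. \<lfloor>real (Suc k) * fst p $ i\<rfloor> = v $ i}"
        by (auto simp: q_def vec_eq_iff)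
      also have "\<dots> \<in> sets (lborel \<Otimes>\<^sub>M M)"
      proof (rule sets.sets_Collect_finite_All)
        fix i :: 'n
        have "(\<lambda>p. real (Suc k) * fst p $ i) \<in> borel_measurable (lborel \<Otimes>\<^sub>M M)" by measurable
        then have "(\<lambda>p. \<lfloor>real (Suc k) * fst p $ i\<rfloor>) \<in> measurable (lborel \<Otimes>\<^sub>M M) (count_space UNIV)"
          by (rule measurable_compose) (rule measurable_real_floor)
        from measurable_sets[OF this, of "{v $ i}"]
        show "{p\<in>space (lborel \<Otimes>\<^sub>M M). \<lfloor>real (Suc k) * fst p $ i\<rfloor> = v $ i} \<in> sets (lborel \<Otimes>\<^sub>M M)"
          by (simp add: vimage_def Int_def conj_commute)
      qed simp
      finally show "(\<lambda>p. q k (fst p)) -` {v} \<inter> space (lborel \<Otimes>\<^sub>M M) \<in> sets (lborel \<Otimes>\<^sub>M M)" .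
    qed auto
    show "(\<lambda>p. Y (z k (q k (fst p))) (snd p)) \<in> borel_measurable (lborel \<Otimes>\<^sub>M M)"
      by (rule measurable_compose_countable[OF _ q]) measurable
  qed
qed

lemma borel_measurable_infdist[measurable]: "(\<lambda>t. infdist t S) \<in> borel_measurable borel"
  by (intro borel_measurable_continuous_onI continuous_intros)

text \<open>How far from \<open>S\<close> a nearly critical point may lie when it has height \<open>x\<close>: at most \<open>outer_radius\<close> if there is
an exceedance, while \<open>inner_radius\<close> guarantees one. The radius \<open>-1\<close> encodes the empty tube.\<close>

definition outer_radius :: "real \<Rightarrow> real \<Rightarrow> real \<Rightarrow> real" where
  "outer_radius \<epsilon> u x =
     (if u - \<epsilon>\<^sup>2 / u \<le> x then (sqrt (2 * (u * (x - u) + \<epsilon>\<^sup>2) / (1 - 2 * \<epsilon>)) + \<epsilon>) / u else -1)"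

definition inner_radius :: "real \<Rightarrow> real \<Rightarrow> real \<Rightarrow> real \<Rightarrow> real" where
  "inner_radius \<epsilon> \<delta> u x =
     (if u < x \<and> x \<le> (1 + \<delta>\<^sup>2 / 2) * u then (sqrt (2 * u * (x - u) / (1 + 2 * \<epsilon>)) - 2 * \<epsilon>) / u else -1)"

lemma radius_measurable[measurable]:
  "outer_radius \<epsilon> u \<in> borel_measurable borel" "inner_radius \<epsilon> \<delta> u \<in> borel_measurable borel"
  unfolding outer_radius_def[abs_def] inner_radius_def[abs_def] by measurable

context smooth_gaussian_field
begin

lemma joint_measurable[measurable]:
  "(\<lambda>p. X (fst p) (snd p)) \<in> borel_measurable (lborel \<Otimes>\<^sub>M M)"
  "(\<lambda>p. X1 i (fst p) (snd p)) \<in> borel_measurable (lborel \<Otimes>\<^sub>M M)"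
  by (rule measurable_continuous_field;
      simp add: class_C_derivs[THEN class_C_continuous])+

text \<open>Fubini twice: the probability that \<open>t\<close> is counted factorises by independence, and its integral over \<open>t\<close> is a
volume that depends on the height \<open>x\<close> only.\<close>

lemma expected_volume:
  fixes S :: "(real^'n) set"
  assumes R[measurable]: "R \<in> borel_measurable borel" and \<rho>: "0 \<le> \<rho>"
  defines "W \<equiv> \<lambda>\<omega>. {t. (\<forall>i. \<bar>X1 i t \<omega>\<bar> \<le> \<rho>) \<and> infdist t S \<le> R (X t \<omega>)}"
  shows "\<And>\<omega>. \<omega> \<in> space M \<Longrightarrow> W \<omega> \<in> sets lborel" and "(\<lambda>\<omega>. emeasure lborel (W \<omega>)) \<in> borel_measurable M"
    and "(\<integral>\<^sup>+\<omega>. emeasure lborel (W \<omega>) \<partial>M) = ennreal (measure std_normal_distribution {-\<rho>..\<rho>} ^ CARD('n)) *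
      (\<integral>\<^sup>+x. ennreal (std_normal_density x) * emeasure lborel {t. infdist t S \<le> R x} \<partial>lborel)"
proof -
  interpret N: real_distribution std_normal_distribution by (rule real_dist_normal_dist)
  interpret P: pair_sigma_finite "lborel :: (real^'n) measure" M by unfold_locales
  interpret Q: pair_sigma_finite "lborel :: (real^'n) measure" std_normal_distribution by unfold_locales
  define q where "q = measure std_normal_distribution {-\<rho>..\<rho>}"
  define L where "L = {p\<in>space (lborel \<Otimes>\<^sub>M M). (\<forall>i\<in>UNIV. \<bar>X1 i (fst p) (snd p)\<bar> \<le> \<rho>) \<and> infdist (fst p) S \<le> R (X (fst p) (snd p))}"
  have L[measurable]: "L \<in> sets (lborel \<Otimes>\<^sub>M M)"
    unfolding L_def by measurable
  have sec: "(\<lambda>t. (t, \<omega>)) -` L = W \<omega>" if "\<omega> \<in> space M" for \<omega>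
    using that by (auto simp: L_def W_def space_pair_measure)
  show Wm: "W \<omega> \<in> sets lborel" if "\<omega> \<in> space M" for \<omega>
    using sets_Pair2[OF L, of \<omega>] sec[OF that] by simp
  have "(\<lambda>\<omega>. emeasure lborel ((\<lambda>t. (t, \<omega>)) -` L)) \<in> borel_measurable M"
    using P.measurable_emeasure_Pair2[OF L] .
  then show "(\<lambda>\<omega>. emeasure lborel (W \<omega>)) \<in> borel_measurable M"
    by (subst measurable_cong[where g = "\<lambda>\<omega>. emeasure lborel ((\<lambda>t. (t, \<omega>)) -` L)"]) (simp_all add: sec)
  define A where "A = (\<lambda>t. {x. infdist t S \<le> R x})"
  have Am: "A t \<in> sets borel" for t unfolding A_def by measurable
  have abs_mem: "\<bar>x\<bar> \<le> \<rho> \<longleftrightarrow> x \<in> {-\<rho>..\<rho>}" for x by auto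
  define L2 where "L2 = {p\<in>space (lborel \<Otimes>\<^sub>M std_normal_distribution). infdist (fst p) S \<le> R (snd p)}"
  have L2[measurable]: "L2 \<in> sets (lborel \<Otimes>\<^sub>M std_normal_distribution)"
    unfolding L2_def by measurable
  have "(\<integral>\<^sup>+\<omega>. emeasure lborel (W \<omega>) \<partial>M) = (\<integral>\<^sup>+\<omega>. emeasure lborel ((\<lambda>t. (t, \<omega>)) -` L) \<partial>M)"
    by (intro nn_integral_cong) (simp add: sec)
  also have "\<dots> = emeasure (lborel \<Otimes>\<^sub>M M) L" by (rule P.emeasure_pair_measure_alt2[symmetric, OF L])
  also have "\<dots> = (\<integral>\<^sup>+t. emeasure M (Pair t -` L) \<partial>lborel)" by (rule emeasure_pair_measure_alt[OF L])
  also have "\<dots> = (\<integral>\<^sup>+t. ennreal (q ^ CARD('n)) * emeasure std_normal_distribution (A t) \<partial>lborel)"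
  proof (rule nn_integral_cong)
    fix t :: "real^'n"
    have "Pair t -` L = {\<omega>\<in>space M. X t \<omega> \<in> A t \<and> (\<forall>i. X1 i t \<omega> \<in> {-\<rho>..\<rho>})}"
      using abs_mem by (auto simp: L_def A_def space_pair_measure simp del: atLeastAtMost_iff)
    then have "emeasure M (Pair t -` L) = ennreal (measure std_normal_distribution (A t) * q ^ CARD('n))"
      using prob_X_X1[OF Am, of "{-\<rho>..\<rho>}" t t] by (simp add: emeasure_eq_measure q_def)
    then show "emeasure M (Pair t -` L) = ennreal (q ^ CARD('n)) * emeasure std_normal_distribution (A t)"
      by (simp add: N.emeasure_eq_measure q_def mult.commute flip: ennreal_mult)
  qed
  also have "\<dots> = ennreal (q ^ CARD('n)) * (\<integral>\<^sup>+t. emeasure std_normal_distribution (Pair t -` L2) \<partial>lborel)"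
    using Q.measurable_emeasure_Pair1[OF L2]
    by (subst nn_integral_cmult[symmetric]) (auto simp: A_def L2_def space_pair_measure vimage_def intro!: nn_integral_cong)
  also have "(\<integral>\<^sup>+t. emeasure std_normal_distribution (Pair t -` L2) \<partial>lborel) = emeasure (lborel \<Otimes>\<^sub>M std_normal_distribution) L2"
    by (rule N.emeasure_pair_measure_alt[symmetric, OF L2])
  also have "\<dots> = (\<integral>\<^sup>+x. emeasure lborel ((\<lambda>t. (t, x)) -` L2) \<partial>std_normal_distribution)"
    by (rule Q.emeasure_pair_measure_alt2[OF L2])
  also have "\<dots> = (\<integral>\<^sup>+x. ennreal (std_normal_density x) * emeasure lborel ((\<lambda>t. (t, x)) -` L2) \<partial>lborel)"
    using Q.measurable_emeasure_Pair2[OF L2] by (subst nn_integral_density) auto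
  also have "\<dots> = (\<integral>\<^sup>+x. ennreal (std_normal_density x) * emeasure lborel {t. infdist t S \<le> R x} \<partial>lborel)"
    by (simp add: L2_def space_pair_measure vimage_def)
  finally show "(\<integral>\<^sup>+\<omega>. emeasure lborel (W \<omega>) \<partial>M) = ennreal (measure std_normal_distribution {-\<rho>..\<rho>} ^ CARD('n)) *
      (\<integral>\<^sup>+x. ennreal (std_normal_density x) * emeasure lborel {t. infdist t S \<le> R x} \<partial>lborel)"
    by (simp add: q_def)
qed

end

text \<open>The parameter ball exceeds the ball around \<open>S\<close> by one unit, so peaks near \<open>S\<close> are interior to it.\<close>

locale field_on_set = separated_gaussian_field M X "cball 0 (r + 1)" for M :: "'w measure" and X :: "real^'n \<Rightarrow> 'w \<Rightarrow> real" and r :: real +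
  fixes S :: "(real^'n) set"
  assumes S: "S \<noteq> {}" "S \<subseteq> cball 0 r"
begin

definition "exceed u = {\<omega>\<in>space M. \<exists>s\<in>S. u < X s \<omega>}"

lemma exceed_measurable[measurable]: "exceed u \<in> events"
proof -
  obtain D where D: "countable D" "D \<subseteq> S" "S \<subseteq> closure D" using separable by blast
  have "exceed u = {\<omega>\<in>space M. \<exists>s\<in>D. u < X s \<omega>}"
  proof -
    have "\<exists>s\<in>D. u < X s \<omega>" if \<omega>: "\<omega> \<in> space M" and s: "s \<in> S" "u < X s \<omega>" for \<omega> s
    proof (rule ccontr)
      assume "\<not> ?thesis"
      then have "\<And>t. t \<in> D \<Longrightarrow> X t \<omega> \<le> u" by (auto simp: not_less)
      then have "X s \<omega> \<le> u"
        using continuous_le_on_closure[OF continuous_on_subset[OF continuous_paths(1)[OF \<omega>] subset_UNIV[of "closure D"]], of s u]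
          s D by blast
      then show False using s by simp
    qed
    then show ?thesis using D(2) by (auto simp: exceed_def)
  qed
  also have "\<dots> = (\<Union>s\<in>D. {\<omega>\<in>space M. u < X s \<omega>})" by auto
  finally show ?thesis using D(1) by (auto intro!: sets.countable_UN')
qed

text \<open>On the good event an exceedance forces a cube of the stated side into the random set, so the expected volume bounds the
probability from above.\<close>

lemma exceed_upper:
  assumes \<epsilon>: "0 < \<epsilon>" "\<epsilon> < 1/2"
  shows "\<exists>c>0. \<exists>C\<ge>0. \<forall>\<^sub>F u in at_top.
    ennreal (prob (exceed u) - C * exp (- (1/2 + c) * u\<^sup>2)) * ennreal ((2 * (\<epsilon> / CARD('n) / ((1 + \<epsilon>) * u))) ^ CARD('n))
    \<le> ennreal (measure std_normal_distribution {- (\<epsilon> / CARD('n))..\<epsilon> / CARD('n)} ^ CARD('n)) *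
      (\<integral>\<^sup>+x. ennreal (std_normal_density x) * emeasure lborel {t. infdist t S \<le> outer_radius \<epsilon> u x} \<partial>lborel)"
proof -
  obtain \<delta> where \<delta>: "0 < \<delta>" "\<delta> \<le> 1/2"
    and neg: "negligible_at (\<lambda>u. {\<omega>\<in>space M. \<not> parabolic_peaks (cball 0 (r + 1)) \<epsilon> \<delta> u (\<lambda>t. X t \<omega>)})"
    using parabolic_peaks_overwhelming[OF \<epsilon>(1), of "1/2"] by auto
  obtain c C where c: "c > 0" "C \<ge> 0" and ev: "\<forall>\<^sub>F u in at_top. \<exists>E\<in>events.
     {\<omega>\<in>space M. \<not> parabolic_peaks (cball 0 (r + 1)) \<epsilon> \<delta> u (\<lambda>t. X t \<omega>)} \<subseteq> E \<and> prob E \<le> C * exp (- (1/2 + c) * u\<^sup>2)"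
    using neg unfolding negligible_at_def by blast
  define \<rho> where "\<rho> = \<epsilon> / CARD('n)"
  have \<rho>: "0 < \<rho>" using \<epsilon> by (simp add: \<rho>_def)
  show ?thesis
  proof (rule exI[of _ c], intro conjI c exI[of _ C])
    show "\<forall>\<^sub>F u in at_top.
      ennreal (prob (exceed u) - C * exp (- (1/2 + c) * u\<^sup>2)) * ennreal ((2 * (\<epsilon> / CARD('n) / ((1 + \<epsilon>) * u))) ^ CARD('n))
      \<le> ennreal (measure std_normal_distribution {- (\<epsilon> / CARD('n))..\<epsilon> / CARD('n)} ^ CARD('n)) *
        (\<integral>\<^sup>+x. ennreal (std_normal_density x) * emeasure lborel {t. infdist t S \<le> outer_radius \<epsilon> u x} \<partial>lborel)"
      using ev eventually_ge_at_top[of "1::real"] eventually_ge_at_top[of "\<epsilon> / \<delta>"]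
    proof eventually_elim
      case (elim u)
      then obtain E where E: "E \<in> events" "prob E \<le> C * exp (- (1/2 + c) * u\<^sup>2)"
        "\<And>\<omega>. \<omega> \<in> space M \<Longrightarrow> \<omega> \<notin> E \<Longrightarrow> parabolic_peaks (cball 0 (r + 1)) \<epsilon> \<delta> u (\<lambda>t. X t \<omega>)" by blast
      define R where "R = outer_radius \<epsilon> u"
      have Rm: "R \<in> borel_measurable borel" unfolding R_def by measurable
      define W where "W = (\<lambda>\<omega>. {t. (\<forall>i. \<bar>X1 i t \<omega>\<bar> \<le> \<rho>) \<and> infdist t S \<le> R (X t \<omega>)})"
      define h where "h = (2 * (\<rho> / ((1 + \<epsilon>) * u))) ^ CARD('n)"
      have big: "ennreal h \<le> emeasure lborel (W \<omega>)" if \<omega>: "\<omega> \<in> exceed u - E" for \<omega>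
      proof -
        have sp: "\<omega> \<in> space M" and "\<omega> \<notin> E" using \<omega> by (auto simp: exceed_def)
        interpret parabolic_path "\<lambda>t. X t \<omega>" S r \<epsilon> \<delta> u \<epsilon> 2
        proof
          have "\<epsilon>\<^sup>2 \<le> 1" using \<epsilon> by (simp add: power_le_one)
          then show "\<epsilon>\<^sup>2 / u \<le> 1" using elim(2) by (simp add: divide_le_eq)
          show "\<epsilon> / u \<le> \<delta>" using elim(2,3) \<delta> by (simp add: field_simps)
        qed (use S \<epsilon> \<delta> elim(2) E(3)[OF sp \<open>\<omega> \<notin> E\<close>] class_C_Suc(1)[OF sp] in auto)
        obtain s where s: "s \<in> S" "u < X s \<omega>" using \<omega> by (auto simp: exceed_def)
        obtain t0 where t0: "cube t0 (\<rho> / ((1 + \<epsilon>) * u)) \<subseteq>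
          {t. (\<forall>i. \<bar>X1 i t \<omega>\<bar> \<le> \<rho>) \<and> u - \<epsilon>\<^sup>2 / u \<le> X t \<omega> \<and>
          infdist t S \<le> (sqrt (2 * (u * (X t \<omega> - u) + \<epsilon>\<^sup>2) / (1 - 2 * \<epsilon>)) + \<epsilon>) / u}"
          using cube_inside[OF s] unfolding \<rho>_def X1_def by blast
        have "cube t0 (\<rho> / ((1 + \<epsilon>) * u)) \<subseteq> W \<omega>"
          using t0 unfolding W_def R_def outer_radius_def inner_radius_def by (auto simp: subset_eq)
        then have "emeasure lborel (cube t0 (\<rho> / ((1 + \<epsilon>) * u))) \<le> emeasure lborel (W \<omega>)"
          unfolding W_def by (intro emeasure_mono expected_volume(1)[OF Rm less_imp_le[OF \<rho>] sp])
        then show ?thesis using \<rho> \<epsilon> elim(2) by (subst (asm) emeasure_cube) (auto simp: h_def)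
      qed
      have "ennreal (prob (exceed u) - C * exp (- (1/2 + c) * u\<^sup>2)) * ennreal h \<le> ennreal (prob (exceed u - E)) * ennreal h"
      proof (intro mult_right_mono ennreal_leI)
        have "prob (exceed u) \<le> prob (exceed u - E) + prob E"
          using measure_Un_le[of "exceed u - E" M E] E(1) finite_measure_mono[of "exceed u" "(exceed u - E) \<union> E"] by (force intro: order_trans)
        then show "prob (exceed u) - C * exp (- (1/2 + c) * u\<^sup>2) \<le> prob (exceed u - E)" using E(2) by linarith
      qed simp
      also have "\<dots> = (\<integral>\<^sup>+\<omega>. ennreal h * indicator (exceed u - E) \<omega> \<partial>M)"
        using E(1) by (simp add: nn_integral_cmult_indicator emeasure_eq_measure mult.commute)
      also have "\<dots> \<le> (\<integral>\<^sup>+\<omega>. emeasure lborel (W \<omega>) \<partial>M)"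
        by (intro nn_integral_mono) (auto simp: indicator_def intro!: big)
      also have "\<dots> = ennreal (measure std_normal_distribution {-\<rho>..\<rho>} ^ CARD('n)) *
        (\<integral>\<^sup>+x. ennreal (std_normal_density x) * emeasure lborel {t. infdist t S \<le> R x} \<partial>lborel)"
        unfolding W_def by (rule expected_volume(3)[OF Rm less_imp_le[OF \<rho>]])
      finally show ?case unfolding R_def h_def \<rho>_def .
    qed
  qed
qed

text \<open>On the good event the random set is empty without an exceedance and otherwise fits into one cube; off the good event its
volume is at most that of the parameter ball.\<close>

lemma exceed_lower:
  assumes \<epsilon>: "0 < \<epsilon>" "\<epsilon> < 1/2"
  shows "\<exists>\<delta>>0. \<exists>c>0. \<exists>C\<ge>0. \<forall>\<^sub>F u in at_top.
    ennreal (measure std_normal_distribution {- (\<epsilon> / CARD('n))..\<epsilon> / CARD('n)} ^ CARD('n)) *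
      (\<integral>\<^sup>+x. ennreal (std_normal_density x) * emeasure lborel {t. infdist t S \<le> inner_radius \<epsilon> \<delta> u x} \<partial>lborel)
    \<le> ennreal ((2 * (\<epsilon> / CARD('n) / ((1 - \<epsilon>) * u))) ^ CARD('n) * prob (exceed u) + C * exp (- (1/2 + c) * u\<^sup>2))"
proof -
  obtain \<delta> where \<delta>: "0 < \<delta>" "\<delta> \<le> 1/2"
    and neg: "negligible_at (\<lambda>u. {\<omega>\<in>space M. \<not> parabolic_peaks (cball 0 (r + 1)) \<epsilon> \<delta> u (\<lambda>t. X t \<omega>)})"
    using parabolic_peaks_overwhelming[OF \<epsilon>(1), of "1/2"] by auto
  obtain c C where c: "c > 0" "C \<ge> 0" and ev: "\<forall>\<^sub>F u in at_top. \<exists>E\<in>events.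
     {\<omega>\<in>space M. \<not> parabolic_peaks (cball 0 (r + 1)) \<epsilon> \<delta> u (\<lambda>t. X t \<omega>)} \<subseteq> E \<and> prob E \<le> C * exp (- (1/2 + c) * u\<^sup>2)"
    using neg unfolding negligible_at_def by blast
  define \<rho> where "\<rho> = \<epsilon> / CARD('n)"
  have \<rho>: "0 < \<rho>" using \<epsilon> by (simp add: \<rho>_def)
  define v where "v = measure lborel (cball (0::real^'n) (r + 1))"
  have v: "emeasure lborel (cball (0::real^'n) (r + 1)) = ennreal v"
    unfolding v_def using emeasure_bounded_finite[OF bounded_cball, of "0::real^'n" "r + 1"]
    by (intro emeasure_eq_ennreal_measure) auto
  show ?thesis
  proof (rule exI[of _ \<delta>], rule conjI[OF \<delta>(1)], rule exI[of _ c], rule conjI[OF c(1)], rule exI[of _ "v * C"], intro conjI)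
    show "0 \<le> v * C" using c by (simp add: v_def)
    show "\<forall>\<^sub>F u in at_top.
    ennreal (measure std_normal_distribution {- (\<epsilon> / CARD('n))..\<epsilon> / CARD('n)} ^ CARD('n)) *
      (\<integral>\<^sup>+x. ennreal (std_normal_density x) * emeasure lborel {t. infdist t S \<le> inner_radius \<epsilon> \<delta> u x} \<partial>lborel)
    \<le> ennreal ((2 * (\<epsilon> / CARD('n) / ((1 - \<epsilon>) * u))) ^ CARD('n) * prob (exceed u) + v * C * exp (- (1/2 + c) * u\<^sup>2))"
      using ev eventually_ge_at_top[of "1::real"] eventually_ge_at_top[of "\<epsilon> / \<delta>"]
    proof eventually_elim
      case (elim u)
      then obtain E where E: "E \<in> events" "prob E \<le> C * exp (- (1/2 + c) * u\<^sup>2)"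
        "\<And>\<omega>. \<omega> \<in> space M \<Longrightarrow> \<omega> \<notin> E \<Longrightarrow> parabolic_peaks (cball 0 (r + 1)) \<epsilon> \<delta> u (\<lambda>t. X t \<omega>)" by blast
      define R where "R = inner_radius \<epsilon> \<delta> u"
      have Rm: "R \<in> borel_measurable borel" unfolding R_def by measurable
      define W where "W = (\<lambda>\<omega>. {t. (\<forall>i. \<bar>X1 i t \<omega>\<bar> \<le> \<rho>) \<and> infdist t S \<le> R (X t \<omega>)})"
      define h where "h = (2 * (\<rho> / ((1 - \<epsilon>) * u))) ^ CARD('n)"
      have h: "0 \<le> h" using \<rho> \<epsilon> elim(2) by (simp add: h_def)
      have Wsub: "W \<omega> \<subseteq> {t. (\<forall>i. \<bar>X1 i t \<omega>\<bar> \<le> \<rho>) \<and> u < X t \<omega> \<and> X t \<omega> \<le> (1 + \<delta>\<^sup>2 / 2) * u \<and>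
          infdist t S \<le> (sqrt (2 * u * (X t \<omega> - u) / (1 + 2 * \<epsilon>)) - 2 * \<epsilon>) / u}" for \<omega>
      proof
        fix t assume t: "t \<in> W \<omega>"
        have "\<not> infdist t S \<le> -1" using infdist_nonneg[of t S] by linarith
        then show "t \<in> {t. (\<forall>i. \<bar>X1 i t \<omega>\<bar> \<le> \<rho>) \<and> u < X t \<omega> \<and> X t \<omega> \<le> (1 + \<delta>\<^sup>2 / 2) * u \<and>
          infdist t S \<le> (sqrt (2 * u * (X t \<omega> - u) / (1 + 2 * \<epsilon>)) - 2 * \<epsilon>) / u}"
          using t unfolding W_def R_def outer_radius_def inner_radius_def by (auto split: if_splits)
      qed
      have WB: "W \<omega> \<subseteq> cball 0 (r + 1)" for \<omega>
      proof
        fix t assume t: "t \<in> W \<omega>"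
        define Q where "Q = 2 * u * (X t \<omega> - u) / (1 + 2 * \<epsilon>)"
        have t': "0 \<le> X t \<omega> - u" "X t \<omega> - u \<le> \<delta>\<^sup>2 / 2 * u" "infdist t S \<le> (sqrt Q - 2 * \<epsilon>) / u"
          using Wsub[of \<omega>] t by (auto simp: Q_def algebra_simps)
        have "Q \<le> 2 * u * (X t \<omega> - u)"
          unfolding Q_def using \<epsilon> t' elim(2) divide_left_mono[of 1 "1 + 2 * \<epsilon>" "2 * u * (X t \<omega> - u)"] by simp
        also have "\<dots> \<le> 2 * u * (\<delta>\<^sup>2 / 2 * u)" using t' elim(2) by (intro mult_left_mono) auto
        also have "\<dots> = (u * \<delta>)\<^sup>2" by (simp add: power2_eq_square)
        finally have "sqrt Q \<le> u * \<delta>" using elim(2) \<delta> by (intro real_le_lsqrt) auto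
        then have "(sqrt Q - 2 * \<epsilon>) / u < \<delta>" using elim(2) \<epsilon> by (simp add: pos_divide_less_eq mult.commute)
        then have "infdist t S < \<delta>" using t' by linarith
        then obtain s where s: "s \<in> S" "dist t s < \<delta>" using exists_dist_less_if_infdist_less S(1) by blast
        then have "norm t \<le> r + \<delta>"
          using norm_triangle_ineq[of "t - s" s] S(2) by (force simp: dist_norm)
        then show "t \<in> cball 0 (r + 1)" using \<delta> by simp
      qed
      have small: "emeasure lborel (W \<omega>) \<le> ennreal h * indicator (exceed u) \<omega> + ennreal v * indicator E \<omega>" if sp: "\<omega> \<in> space M" for \<omega>
      proof (cases "\<omega> \<in> E")
        case True
        have "emeasure lborel (W \<omega>) \<le> ennreal v" unfolding v[symmetric] by (intro emeasure_mono WB) simp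
        also have "\<dots> \<le> ennreal h * indicator (exceed u) \<omega> + ennreal v * indicator E \<omega>"
          using True by (simp add: add_increasing)
        finally show ?thesis .
      next
        case False
        interpret parabolic_path "\<lambda>t. X t \<omega>" S r \<epsilon> \<delta> u \<epsilon> 2
        proof
          have "\<epsilon>\<^sup>2 \<le> 1" using \<epsilon> by (simp add: power_le_one)
          then show "\<epsilon>\<^sup>2 / u \<le> 1" using elim(2) by (simp add: divide_le_eq)
          show "\<epsilon> / u \<le> \<delta>" using elim(2,3) \<delta> by (simp add: field_simps)
        qed (use S \<epsilon> \<delta> elim(2) E(3)[OF sp False] class_C_Suc(1)[OF sp] in auto)
        show ?thesis
        proof (cases "W \<omega> = {}")
          case True
          then show ?thesis by simp
        next
          case nonempty: False
          define W' where "W' = {t. (\<forall>i. \<bar>partial i (\<lambda>t. X t \<omega>) t\<bar> \<le> \<epsilon> / CARD('n)) \<and> u < X t \<omega> \<and> X t \<omega> \<le> (1 + \<delta>\<^sup>2 / 2) * u \<and>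
            infdist t S \<le> (sqrt (2 * u * (X t \<omega> - u) / (1 + 2 * \<epsilon>)) - 2 * \<epsilon>) / u}"
          have sub: "W \<omega> \<subseteq> W'" using Wsub[of \<omega>] unfolding W'_def X1_def \<rho>_def .
          then have "W' \<noteq> {}" using nonempty by blast
          from inside_cube[folded W'_def, OF this]
          obtain t0 where ex: "\<exists>s\<in>S. u < X s \<omega>" and t0: "W' \<subseteq> cube t0 (\<rho> / ((1 - \<epsilon>) * u))"
            unfolding \<rho>_def by blast
          have "emeasure lborel (W \<omega>) \<le> emeasure lborel (cube t0 (\<rho> / ((1 - \<epsilon>) * u)))"
            using sub t0 by (intro emeasure_mono) (auto simp: cube_def)
          also have "\<dots> = ennreal h" using \<rho> \<epsilon> elim(2) by (subst emeasure_cube) (auto simp: h_def)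
          finally show ?thesis using ex sp by (simp add: exceed_def False)
        qed
      qed
      have "ennreal (measure std_normal_distribution {-\<rho>..\<rho>} ^ CARD('n)) *
        (\<integral>\<^sup>+x. ennreal (std_normal_density x) * emeasure lborel {t. infdist t S \<le> R x} \<partial>lborel) = (\<integral>\<^sup>+\<omega>. emeasure lborel (W \<omega>) \<partial>M)"
        unfolding W_def by (rule expected_volume(3)[symmetric, OF Rm less_imp_le[OF \<rho>]])
      also have "\<dots> \<le> (\<integral>\<^sup>+\<omega>. ennreal h * indicator (exceed u) \<omega> + ennreal v * indicator E \<omega> \<partial>M)"
        by (intro nn_integral_mono small)
      also have "\<dots> = ennreal h * ennreal (prob (exceed u)) + ennreal v * ennreal (prob E)"
        using E(1) by (subst nn_integral_add) (auto simp: nn_integral_cmult_indicator emeasure_eq_measure)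
      also have "\<dots> = ennreal (h * prob (exceed u) + v * prob E)"
        using h by (simp add: v_def ennreal_mult ennreal_plus)
      also have "\<dots> \<le> ennreal (h * prob (exceed u) + v * C * exp (- (1/2 + c) * u\<^sup>2))"
        using mult_left_mono[OF E(2), of v] by (intro ennreal_leI) (simp add: v_def mult.assoc)
      finally show ?case unfolding R_def h_def \<rho>_def .
    qed
  qed
qed

end

section \<open>Tube volumes and normalised bounds\<close>

lemma closed_tube: "closed (tube e S)"
  unfolding tube_def by (intro closed_Collect_le continuous_intros)

lemma bounded_tube:
  fixes S :: "(real^'n) set"
  assumes "S \<noteq> {}" "S \<subseteq> cball 0 r"
  shows "bounded (tube e S)"
proof (rule bounded_subset[OF bounded_cball[of 0 "r + \<bar>e\<bar> + 1"]], rule subsetI)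
  fix t assume "t \<in> tube e S"
  then have "infdist t S < \<bar>e\<bar> + 1" by (simp add: tube_def)
  then obtain s where "s \<in> S" "dist t s < \<bar>e\<bar> + 1" using exists_dist_less_if_infdist_less assms(1) by blast
  then show "t \<in> cball 0 (r + \<bar>e\<bar> + 1)"
    using assms(2) norm_triangle_ineq[of "t - s" s] by (force simp: dist_norm)
qed

lemma emeasure_tube:
  fixes S :: "(real^'n) set"
  assumes "S \<noteq> {}" "S \<subseteq> cball 0 r"
  shows "emeasure lborel {t. infdist t S \<le> e} = ennreal (measure lebesgue (tube e S))"
proof -
  have "tube e S \<in> sets borel" by (rule borel_closed[OF closed_tube])
  moreover have "emeasure lborel (tube e S) \<noteq> \<infinity>"
    using emeasure_bounded_finite[OF bounded_tube[OF assms], of e] by auto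
  ultimately show ?thesis
    by (simp add: tube_def[symmetric] emeasure_eq_ennreal_measure measure_completion)
qed

lemma tube_volume_mono:
  fixes S :: "(real^'n) set"
  assumes "S \<noteq> {}" "S \<subseteq> cball 0 r" "d \<le> e"
  shows "measure lebesgue (tube d S) \<le> measure lebesgue (tube e S)"
proof -
  have "ennreal (measure lebesgue (tube d S)) \<le> ennreal (measure lebesgue (tube e S))"
    unfolding emeasure_tube[OF assms(1,2), symmetric] using assms(3) closed_tube[of e S]
    by (intro emeasure_mono) (auto simp: tube_def)
  then show ?thesis by (simp add: ennreal_le_iff)
qed

lemma tube_volume_pos:
  fixes S :: "(real^'n) set"
  assumes "S \<noteq> {}" "S \<subseteq> cball 0 r" "0 < e"
  shows "0 < measure lebesgue (tube e S)"
proof -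
  obtain s where s: "s \<in> S" using assms by blast
  have "0 < measure lebesgue (cball s e)" using assms(3) by (simp add: content_cball_pos)
  also have "\<dots> \<le> measure lebesgue (tube e S)"
  proof (rule measure_mono_fmeasurable)
    show "cball s e \<subseteq> tube e S" 
      by (auto simp: tube_def dist_commute intro!: order_trans[OF infdist_le[OF s]])
    show "tube e S \<in> lmeasurable"
      using bounded_tube[OF assms(1,2)] closed_tube by (intro lmeasurable_compact) (simp add: compact_eq_bounded_closed)
  qed auto
  finally show ?thesis .
qed

text \<open>By Vitali's covering lemma \<open>S\<close> contains centres of disjoint balls of radius \<open>e\<close> whose fivefold enlargements cover \<open>S\<close>. The
disjoint balls lie in the tube of radius \<open>e\<close>, and their enlargements by the factor \<open>6 + l\<close> cover the tube of radius \<open>l e\<close>.\<close>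

theorem tube_doubling:
  fixes S :: "(real^'n) set"
  assumes S: "S \<noteq> {}" "S \<subseteq> cball 0 r" and e: "0 < e" and l: "1 \<le> l"
  shows "measure lebesgue (tube (l * e) S) \<le> (6 + l) ^ CARD('n) * measure lebesgue (tube e S)"
proof -
  have "S \<subseteq> (\<Union>i\<in>S. cball i e)" using e by auto
  then obtain C where C: "C \<subseteq> S" "pairwise (\<lambda>i j. disjnt (cball i e) (cball j e)) C" "S \<subseteq> (\<Union>i\<in>C. cball i (5 * e))"
    by (rule Vitali_covering_lemma_cballs[where a = "\<lambda>s. s" and r = "\<lambda>_. e" and B = e]) (use e in auto)
  define v where "v = unit_ball_vol (real CARD('n))"
  have v: "0 < v" by (simp add: v_def unit_ball_vol_pos)
  have ball: "emeasure lborel (cball s x) = ennreal (v * x ^ CARD('n))" if "0 \<le> x" for x and s :: "real^'n"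
    using emeasure_cball[OF that, of s] by (simp add: v_def)
  have packing: "(\<Sum>s\<in>F. emeasure lborel (cball s e)) \<le> emeasure lborel (tube e S)" if F: "finite F" "F \<subseteq> C" for F
  proof -
    have "disjoint_family_on (\<lambda>s. cball s e) F"
      unfolding disjoint_family_on_def
    proof (intro ballI impI)
      fix i j assume "i \<in> F" "j \<in> F" "i \<noteq> j"
      then show "cball i e \<inter> cball j e = {}"
        using pairwiseD[OF C(2), of i j] F(2) unfolding disjnt_def by blast
    qed
    then have "(\<Sum>s\<in>F. emeasure lborel (cball s e)) = emeasure lborel (\<Union>s\<in>F. cball s e)"
      using F(1) by (intro sum_emeasure) auto
    also have "\<dots> \<le> emeasure lborel (tube e S)"
    proof (rule emeasure_mono)
      show "(\<Union>s\<in>F. cball s e) \<subseteq> tube e S"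
        using F(2) C(1) by (auto simp: tube_def dist_commute intro!: order_trans[OF infdist_le])
      show "tube e S \<in> sets lborel" using borel_closed[OF closed_tube] by simp
    qed
    finally show ?thesis .
  qed
  \<comment> \<open>finitely many disjoint balls of equal size fit into the tube\<close>
  have fin: "finite C"
  proof (rule ccontr)
    assume inf: "infinite C"
    define V where "V = measure lebesgue (tube e S)"
    have V: "emeasure lborel (tube e S) = ennreal V" using emeasure_tube[OF S] by (simp add: tube_def V_def)
    obtain k :: nat where k: "V < real k * (v * e ^ CARD('n))"
      using reals_Archimedean3[of "v * e ^ CARD('n)"] v e by auto
    obtain F where F: "finite F" "card F = k" "F \<subseteq> C" using infinite_arbitrarily_large[OF inf] by blast
    have "ennreal (real k * (v * e ^ CARD('n))) = (\<Sum>s\<in>F. emeasure lborel (cball s e))"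
      using e v F by (simp add: ball ennreal_mult'' ennreal_of_nat_eq_real_of_nat)
    also have "\<dots> \<le> ennreal V" using packing[OF F(1,3)] V by simp
    finally have "real k * (v * e ^ CARD('n)) \<le> V" by (simp add: ennreal_le_iff V_def)
    then show False using k by simp
  qed
  have "tube (l * e) S \<subseteq> (\<Union>s\<in>C. cball s ((6 + l) * e))"
  proof
    fix t assume "t \<in> tube (l * e) S"
    then have "infdist t S < (l + 1) * e" using e by (simp add: tube_def algebra_simps)
    then obtain s where s: "s \<in> S" "dist t s < (l + 1) * e" using exists_dist_less_if_infdist_less S(1) by blast
    obtain j where j: "j \<in> C" "dist j s \<le> 5 * e" using C(3) s(1) by auto
    have "dist j t \<le> dist j s + dist t s" by (rule dist_triangle2)
    also have "\<dots> \<le> (6 + l) * e" using s(2) j(2) by (simp add: algebra_simps)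
    finally show "t \<in> (\<Union>s\<in>C. cball s ((6 + l) * e))" using j(1) by auto
  qed
  then have "emeasure lborel (tube (l * e) S) \<le> emeasure lborel (\<Union>s\<in>C. cball s ((6 + l) * e))"
    using fin by (intro emeasure_mono) auto
  also have "\<dots> \<le> (\<Sum>s\<in>C. emeasure lborel (cball s ((6 + l) * e)))"
    using fin by (intro emeasure_subadditive_finite) auto
  also have "\<dots> = (\<Sum>s\<in>C. ennreal ((6 + l) ^ CARD('n)) * emeasure lborel (cball s e))"
  proof (rule sum.cong[OF refl])
    fix s :: "real^'n"
    have "v * ((6 + l) * e) ^ CARD('n) = (6 + l) ^ CARD('n) * (v * e ^ CARD('n))" by (simp add: power_mult_distrib)
    then show "emeasure lborel (cball s ((6 + l) * e)) = ennreal ((6 + l) ^ CARD('n)) * emeasure lborel (cball s e)"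
      using e l v by (simp add: ball flip: ennreal_mult)
  qed
  also have "\<dots> = ennreal ((6 + l) ^ CARD('n)) * (\<Sum>s\<in>C. emeasure lborel (cball s e))"
    by (simp add: sum_distrib_left)
  also have "\<dots> \<le> ennreal ((6 + l) ^ CARD('n)) * emeasure lborel (tube e S)"
    by (intro mult_left_mono packing fin) auto
  finally have "ennreal (measure lebesgue (tube (l * e) S)) \<le> ennreal ((6 + l) ^ CARD('n) * measure lebesgue (tube e S))"
    using emeasure_tube[OF S] l by (simp add: tube_def ennreal_mult)
  then show ?thesis using l by (subst (asm) ennreal_le_iff) auto
qed

lemma power_le_exp:
  fixes y :: real
  assumes "0 \<le> y" "0 < n"
  shows "y ^ n \<le> real n ^ n * exp y"
proof -
  have "y / real n \<le> exp (y / real n)" using exp_ge_add_one_self[of "y / real n"] by linarith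
  then have "(y / real n) ^ n \<le> exp (y / real n) ^ n" using assms by (intro power_mono) auto
  also have "\<dots> = exp y" using assms by (simp flip: exp_of_nat_mult)
  finally show ?thesis using assms by (simp add: power_divide divide_le_eq mult.commute)
qed

text \<open>The density is between its values at \<open>\<rho>\<close> and at \<open>0\<close>.\<close>

lemma std_normal_central_mass:
  assumes \<rho>: "0 \<le> \<rho>"
  shows "measure std_normal_distribution {-\<rho>..\<rho>} \<le> 2 * \<rho> / sqrt (2 * pi)"
    and "2 * \<rho> * exp (- \<rho>\<^sup>2 / 2) / sqrt (2 * pi) \<le> measure std_normal_distribution {-\<rho>..\<rho>}"
proof -
  interpret N: real_distribution std_normal_distribution by (rule real_dist_normal_dist)
  have em: "ennreal (measure std_normal_distribution {-\<rho>..\<rho>}) = (\<integral>\<^sup>+x. ennreal (std_normal_density x) * indicator {-\<rho>..\<rho>} x \<partial>lborel)"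
    by (simp add: N.emeasure_eq_measure[symmetric] emeasure_density)
  have cst: "(\<integral>\<^sup>+x. ennreal c * indicator {-\<rho>..\<rho>} x \<partial>lborel) = ennreal (c * (2 * \<rho>))" if "0 \<le> c" for c
    using \<rho> that by (simp add: nn_integral_cmult_indicator ennreal_mult)
  have "ennreal (measure std_normal_distribution {-\<rho>..\<rho>}) \<le> (\<integral>\<^sup>+x. ennreal (1 / sqrt (2 * pi)) * indicator {-\<rho>..\<rho>} x \<partial>lborel)"
    unfolding em by (intro nn_integral_mono mult_right_mono ennreal_leI) (auto simp: std_normal_density_def divide_right_mono)
  then have "measure std_normal_distribution {-\<rho>..\<rho>} \<le> 1 / sqrt (2 * pi) * (2 * \<rho>)"
    using \<rho> by (subst (asm) cst) (auto simp: ennreal_le_iff)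
  then show "measure std_normal_distribution {-\<rho>..\<rho>} \<le> 2 * \<rho> / sqrt (2 * pi)" by simp
  have "(\<integral>\<^sup>+x. ennreal (exp (- \<rho>\<^sup>2 / 2) / sqrt (2 * pi)) * indicator {-\<rho>..\<rho>} x \<partial>lborel) \<le> ennreal (measure std_normal_distribution {-\<rho>..\<rho>})"
    unfolding em
  proof (intro nn_integral_mono)
    fix x
    show "ennreal (exp (- \<rho>\<^sup>2 / 2) / sqrt (2 * pi)) * indicator {-\<rho>..\<rho>} x \<le> ennreal (std_normal_density x) * indicator {-\<rho>..\<rho>} x"
    proof (cases "x \<in> {-\<rho>..\<rho>}")
      case True
      then have "x\<^sup>2 \<le> \<rho>\<^sup>2" by (intro abs_le_square_iff[THEN iffD1]) auto
      then have "exp (- \<rho>\<^sup>2 / 2) / sqrt (2 * pi) \<le> std_normal_density x"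
        by (simp add: std_normal_density_def divide_right_mono)
      then show ?thesis using True by (simp add: ennreal_leI)
    qed simp
  qed
  then have "exp (- \<rho>\<^sup>2 / 2) / sqrt (2 * pi) * (2 * \<rho>) \<le> measure std_normal_distribution {-\<rho>..\<rho>}"
    by (subst (asm) cst) (auto simp: ennreal_le_iff)
  then show "2 * \<rho> * exp (- \<rho>\<^sup>2 / 2) / sqrt (2 * pi) \<le> measure std_normal_distribution {-\<rho>..\<rho>}" by (simp add: mult_ac)
qed

lemma std_normal_density_shift:
  assumes "u \<noteq> 0"
  shows "std_normal_density (u + y / u) = std_normal_density u * exp (- y - y\<^sup>2 / (2 * u\<^sup>2))"
proof -
  have "- (u + y / u)\<^sup>2 / 2 = - u\<^sup>2 / 2 + (- y - y\<^sup>2 / (2 * u\<^sup>2))"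
    using assms by (simp add: power2_eq_square field_simps)
  then show ?thesis by (simp add: std_normal_density_def exp_add[symmetric] mult_exp_exp)
qed

lemma integrable_exponential_density:
  assumes "0 < (l::real)"
  shows "integrable lborel (exponential_density l)"
proof (rule integrableI_nonneg)
  interpret prob_space "density lborel (exponential_density l)" by (rule prob_space_exponential_density[OF assms])
  show "(\<integral>\<^sup>+x. ennreal (exponential_density l x) \<partial>lborel) < \<infinity>"
    using emeasure_space_1 by (simp add: emeasure_density)
qed (use assms in \<open>auto simp: exponential_density_def\<close>)

context field_on_set
begin

definition "vol e = measure lebesgue (tube e S)"
definition "rel_vol u a = vol (a / u) / vol (1 / u)"
text \<open>The exact order of the tail, for every bounded set.\<close>

definition "rate u = u ^ CARD('n) / u * std_normal_density u * vol (1 / u)"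
text \<open>An integrable majorant of \<open>exp (- p)\<close> times the polynomial growth of the tube volumes, uniform in \<open>u\<close> and \<open>\<epsilon>\<close>.\<close>

definition "envelope p = (if p < 0 then 0 else real CARD('n) ^ CARD('n) * exp 10 * exp (- p / 2))"

lemma emeasure_vol: "emeasure lborel {t. infdist t S \<le> e} = ennreal (vol e)"
  unfolding vol_def by (rule emeasure_tube[OF S])

lemma vol_mono: "mono vol"
  unfolding vol_def by (rule monoI) (rule tube_volume_mono[OF S])

lemma vol_measurable[measurable]: "vol \<in> borel_measurable borel"
  by (rule borel_measurable_mono[OF vol_mono])

lemma vol_pos: "0 < e \<Longrightarrow> 0 < vol e"
  unfolding vol_def by (rule tube_volume_pos[OF S])

lemma vol_nonneg: "0 \<le> vol e" by (simp add: vol_def)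

lemma vol_neg: "e < 0 \<Longrightarrow> vol e = 0"
proof -
  assume "e < 0"
  then have "tube e S = {}" unfolding tube_def using infdist_nonneg[of _ S] by (auto simp: not_le intro: less_le_trans)
  then show ?thesis by (simp add: vol_def)
qed

lemma rel_vol_measurable[measurable]: "rel_vol u \<in> borel_measurable borel"
  unfolding rel_vol_def by measurable

lemma rel_vol_nonneg: "0 \<le> rel_vol u a" by (simp add: rel_vol_def vol_nonneg)

lemma rel_vol_neg: "0 < u \<Longrightarrow> a < 0 \<Longrightarrow> rel_vol u a = 0" by (simp add: rel_vol_def vol_neg divide_neg_pos)

lemma rel_vol_ge_1: "0 < u \<Longrightarrow> 1 \<le> a \<Longrightarrow> 1 \<le> rel_vol u a"
  using monoD[OF vol_mono, of "1 / u" "a / u"] vol_pos[of "1 / u"]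
  by (simp add: rel_vol_def divide_right_mono)

lemma vol_rel_vol: "0 < u \<Longrightarrow> vol (a / u) = vol (1 / u) * rel_vol u a"
  using vol_pos[of "1 / u"] by (simp add: rel_vol_def)

lemma rel_vol_le:
  assumes u: "0 < u" and a: "0 \<le> a"
  shows "rel_vol u a \<le> (7 + a) ^ CARD('n)"
proof -
  define l where "l = max 1 a"
  have l: "1 \<le> l" "a \<le> l" "6 + l \<le> 7 + a" using a by (auto simp: l_def)
  have "vol (a / u) \<le> vol (l * (1 / u))" using l u by (intro monoD[OF vol_mono]) (simp add: divide_right_mono)
  also have "\<dots> \<le> (6 + l) ^ CARD('n) * vol (1 / u)" unfolding vol_def using l u by (intro tube_doubling[OF S]) auto
  also have "\<dots> \<le> (7 + a) ^ CARD('n) * vol (1 / u)" using l by (intro mult_right_mono power_mono vol_nonneg) auto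
  finally show ?thesis using vol_pos[of "1 / u"] u by (simp add: rel_vol_def divide_le_eq)
qed

lemma power_le_envelope:
  assumes "0 \<le> p" "0 \<le> a" "a \<le> 2 * sqrt p + 1"
  shows "exp (- p) * (7 + a) ^ CARD('n) \<le> envelope p"
proof -
  define n where "n = CARD('n)"
  have n: "0 < n" by (simp add: n_def)
  have am: "2 * sqrt p \<le> p / 2 + 2"
  proof -
    have "0 \<le> (sqrt p - 2)\<^sup>2" by simp
    also have "(sqrt p - 2)\<^sup>2 = (sqrt p)\<^sup>2 - 4 * sqrt p + 4" by (simp add: power2_eq_square algebra_simps)
    also have "(sqrt p)\<^sup>2 = p" using assms(1) by simp
    finally show ?thesis by simp
  qed
  have "(7 + a) ^ n \<le> real n ^ n * exp (7 + a)" using assms n by (intro power_le_exp) auto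
  also have "\<dots> \<le> real n ^ n * exp (10 + p / 2)" using assms(3) am by (intro mult_left_mono) auto
  finally have "exp (- p) * (7 + a) ^ n \<le> exp (- p) * (real n ^ n * exp (10 + p / 2))" by simp
  also have "\<dots> = real n ^ n * exp 10 * (exp (- p) * exp (p / 2))" by (simp add: exp_add)
  also have "exp (- p) * exp (p / 2) = exp (- p / 2)" by (simp add: mult_exp_exp)
  finally show ?thesis using assms(1) by (simp add: envelope_def n_def)
qed

lemma integrable_envelope: "integrable lborel envelope"
proof -
  have "integrable lborel (exponential_density (1/2))" by (rule integrable_exponential_density) simp
  then have "integrable lborel (\<lambda>p. 2 * real CARD('n) ^ CARD('n) * exp 10 * exponential_density (1/2) p)"
    by (rule integrable_mult_right)
  moreover have "envelope = (\<lambda>p. 2 * real CARD('n) ^ CARD('n) * exp 10 * exponential_density (1/2) p)"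
    by (rule ext) (simp add: envelope_def exponential_density_def)
  ultimately show ?thesis by simp
qed

lemma envelope_nonneg: "0 \<le> envelope p" by (simp add: envelope_def)

text \<open>The radii of the two bounds, in units of \<open>1 / u\<close> and in terms of \<open>p = u (x - u)\<close> (for the upper bound shifted by \<open>\<epsilon>^2\<close>).
Both tend to \<open>sqrt (2 p)\<close> as \<open>\<epsilon>\<close> tends to zero.\<close>

definition "upper_radius \<epsilon> p = sqrt (2 * p / (1 - 2 * \<epsilon>)) + \<epsilon>"
definition "lower_radius \<epsilon> p = sqrt (2 * p / (1 + 2 * \<epsilon>)) - 2 * \<epsilon>"
definition "upper_integrand \<epsilon> u p = indicator {0..} p * (exp (- p) * rel_vol u (upper_radius \<epsilon> p))"
definition "lower_integrand \<epsilon> \<delta> u p = indicator {p. 0 < p \<and> p \<le> \<delta>\<^sup>2 * u\<^sup>2 / 2} p * (exp (- p - p\<^sup>2 / (2 * u\<^sup>2)) * rel_vol u (lower_radius \<epsilon> p))"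

lemma integrand_measurable[measurable]: "upper_radius \<epsilon> \<in> borel_measurable borel" "lower_radius \<epsilon> \<in> borel_measurable borel"
  "upper_integrand \<epsilon> u \<in> borel_measurable borel" "lower_integrand \<epsilon> \<delta> u \<in> borel_measurable borel"
  unfolding upper_integrand_def[abs_def] lower_integrand_def[abs_def] upper_radius_def[abs_def] lower_radius_def[abs_def] by measurable

lemma upper_radius_le: "0 \<le> p \<Longrightarrow> 0 \<le> \<epsilon> \<Longrightarrow> \<epsilon> \<le> 1/4 \<Longrightarrow> 0 \<le> upper_radius \<epsilon> p \<and> upper_radius \<epsilon> p \<le> 2 * sqrt p + 1"
proof -
  assume a: "0 \<le> p" "0 \<le> \<epsilon>" "\<epsilon> \<le> 1/4"
  have "2 * p / (1 - 2 * \<epsilon>) \<le> 2 * p / (1/2)" using a by (intro divide_left_mono) auto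
  then have "sqrt (2 * p / (1 - 2 * \<epsilon>)) \<le> sqrt (4 * p)" by simp
  also have "\<dots> = 2 * sqrt p" by (simp add: real_sqrt_mult)
  finally show ?thesis using a by (simp add: upper_radius_def)
qed

lemma lower_radius_le: "0 \<le> p \<Longrightarrow> 0 \<le> \<epsilon> \<Longrightarrow> lower_radius \<epsilon> p \<le> 2 * sqrt p + 1"
proof -
  assume a: "0 \<le> p" "0 \<le> \<epsilon>"
  have "2 * p / (1 + 2 * \<epsilon>) \<le> 2 * p / 1" using a by (intro divide_left_mono) auto
  then have "sqrt (2 * p / (1 + 2 * \<epsilon>)) \<le> sqrt (4 * p)" using a by simp
  also have "\<dots> = 2 * sqrt p" by (simp add: real_sqrt_mult)
  finally show ?thesis using a by (simp add: lower_radius_def)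
qed

lemma upper_integrand_bounds:
  assumes "0 < u" "0 \<le> \<epsilon>" "\<epsilon> \<le> 1/4"
  shows "0 \<le> upper_integrand \<epsilon> u p" "upper_integrand \<epsilon> u p \<le> envelope p"
proof -
  show "0 \<le> upper_integrand \<epsilon> u p" by (simp add: upper_integrand_def rel_vol_nonneg)
  show "upper_integrand \<epsilon> u p \<le> envelope p"
  proof (cases "0 \<le> p")
    case True
    have "upper_integrand \<epsilon> u p \<le> exp (- p) * (7 + upper_radius \<epsilon> p) ^ CARD('n)"
      using True rel_vol_le[OF assms(1), of "upper_radius \<epsilon> p"] upper_radius_le[OF True assms(2,3)] by (simp add: upper_integrand_def)
    also have "\<dots> \<le> envelope p" using power_le_envelope[OF True] upper_radius_le[OF True assms(2,3)] by blast
    finally show ?thesis .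
  qed (simp add: upper_integrand_def envelope_nonneg)
qed

lemma lower_integrand_bounds:
  assumes "0 < u" "0 \<le> \<epsilon>"
  shows "0 \<le> lower_integrand \<epsilon> \<delta> u p" "lower_integrand \<epsilon> \<delta> u p \<le> envelope p"
proof -
  show "0 \<le> lower_integrand \<epsilon> \<delta> u p" by (simp add: lower_integrand_def rel_vol_nonneg)
  show "lower_integrand \<epsilon> \<delta> u p \<le> envelope p"
  proof (cases "0 < p \<and> 0 \<le> lower_radius \<epsilon> p")
    case True
    have "lower_integrand \<epsilon> \<delta> u p \<le> exp (- p - p\<^sup>2 / (2 * u\<^sup>2)) * rel_vol u (lower_radius \<epsilon> p)"
      by (simp add: lower_integrand_def rel_vol_nonneg indicator_def)
    also have "\<dots> \<le> exp (- p) * (7 + lower_radius \<epsilon> p) ^ CARD('n)"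
      using True rel_vol_le[OF assms(1), of "lower_radius \<epsilon> p"] by (intro mult_mono rel_vol_nonneg) auto
    also have "\<dots> \<le> envelope p" using power_le_envelope[of p "lower_radius \<epsilon> p"] lower_radius_le[of p \<epsilon>] True assms by auto
    finally show ?thesis .
  next
    case False
    then show ?thesis using rel_vol_neg[OF assms(1)] by (auto simp: lower_integrand_def envelope_nonneg not_le)
  qed
qed

lemma integrable_integrands:
  assumes "0 < u" "0 \<le> \<epsilon>" "\<epsilon> \<le> 1/4"
  shows "integrable lborel (upper_integrand \<epsilon> u)" "integrable lborel (lower_integrand \<epsilon> \<delta> u)"
  using upper_integrand_bounds[OF assms] lower_integrand_bounds[OF assms(1,2)]
  by (auto intro!: Bochner_Integration.integrable_bound[OF integrable_envelope] AE_I2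
      simp: abs_of_nonneg[OF envelope_nonneg])

lemma rate_pos: "0 < u \<Longrightarrow> 0 < rate u"
  using vol_pos[of "1 / u"] by (simp add: rate_def std_normal_density_def)

text \<open>The substitution \<open>x = u + (p - \<epsilon>^2) / u\<close>.\<close>

lemma upper_integral:
  assumes u: "0 < u" and \<epsilon>: "0 < \<epsilon>" "\<epsilon> \<le> 1/4"
  shows "(\<integral>\<^sup>+x. ennreal (std_normal_density x) * emeasure lborel {t. infdist t S \<le> outer_radius \<epsilon> u x} \<partial>lborel)
    \<le> ennreal (1 / u * (std_normal_density u * exp (\<epsilon>\<^sup>2) * vol (1 / u) * (LINT p|lborel. upper_integrand \<epsilon> u p)))" (is "?L \<le> _")
proof -
  define R where "R = outer_radius \<epsilon> u"
  have [measurable]: "R \<in> borel_measurable borel" unfolding R_def by measurable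
  define A where "A = std_normal_density u * exp (\<epsilon>\<^sup>2) * vol (1 / u)"
  have A: "0 \<le> A" by (simp add: A_def vol_nonneg)
  have "?L = (\<integral>\<^sup>+x. ennreal (std_normal_density x * vol (R x)) \<partial>lborel)"
    by (simp add: emeasure_vol R_def ennreal_mult vol_nonneg)
  also have "\<dots> = ennreal (1 / u) * (\<integral>\<^sup>+p. ennreal (std_normal_density ((u - \<epsilon>\<^sup>2 / u) + 1 / u * p) * vol (R ((u - \<epsilon>\<^sup>2 / u) + 1 / u * p))) \<partial>lborel)"
    using nn_integral_real_affine[of "\<lambda>x. ennreal (std_normal_density x * vol (R x))" "1 / u" "u - \<epsilon>\<^sup>2 / u"] u by simp
  also have "\<dots> \<le> ennreal (1 / u) * (\<integral>\<^sup>+p. ennreal (A * upper_integrand \<epsilon> u p) \<partial>lborel)"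
  proof (intro mult_left_mono nn_integral_mono ennreal_leI)
    fix p
    define x where "x = (u - \<epsilon>\<^sup>2 / u) + 1 / u * p"
    have x: "x = u + (p - \<epsilon>\<^sup>2) / u" by (simp add: x_def diff_divide_distrib)
    show "std_normal_density x * vol (R x) \<le> A * upper_integrand \<epsilon> u p"
    proof (cases "0 \<le> p")
      case True
      have "u * (x - u) + \<epsilon>\<^sup>2 = p" using u by (simp add: x)
      moreover have "u - \<epsilon>\<^sup>2 / u \<le> x" using True u by (simp add: x_def)
      ultimately have R: "R x = upper_radius \<epsilon> p / u" by (simp add: R_def outer_radius_def upper_radius_def)
      have "std_normal_density x = std_normal_density u * exp (- (p - \<epsilon>\<^sup>2) - (p - \<epsilon>\<^sup>2)\<^sup>2 / (2 * u\<^sup>2))"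
        unfolding x using u by (intro std_normal_density_shift) simp
      also have "\<dots> \<le> std_normal_density u * exp (\<epsilon>\<^sup>2 + - p)" by (intro mult_left_mono) auto
      finally have "std_normal_density x \<le> std_normal_density u * exp (\<epsilon>\<^sup>2) * exp (- p)"
        by (simp only: exp_add mult.assoc)
      then have "std_normal_density x * vol (R x) \<le> std_normal_density u * exp (\<epsilon>\<^sup>2) * exp (- p) * vol (R x)"
        by (intro mult_right_mono vol_nonneg)
      then show ?thesis using True by (simp add: R vol_rel_vol[OF u, of "upper_radius \<epsilon> p"] A_def upper_integrand_def mult_ac)
    next
      case False
      then have "\<not> u - \<epsilon>\<^sup>2 / u \<le> x" using u by (simp add: x_def not_le divide_neg_pos)
      then have "vol (R x) = 0" by (simp add: R_def outer_radius_def vol_neg)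
      then show ?thesis using A upper_integrand_bounds(1)[OF u] \<epsilon> by simp
    qed
  qed simp
  also have "(\<integral>\<^sup>+p. ennreal (A * upper_integrand \<epsilon> u p) \<partial>lborel) = ennreal (A * (LINT p|lborel. upper_integrand \<epsilon> u p))"
    using A upper_integrand_bounds(1)[OF u] integrable_integrands(1)[OF u] \<epsilon> by (subst nn_integral_eq_integral) auto
  also have "ennreal (1 / u) * ennreal (A * (LINT p|lborel. upper_integrand \<epsilon> u p)) = ennreal (1 / u * (A * (LINT p|lborel. upper_integrand \<epsilon> u p)))"
    using u A upper_integrand_bounds(1)[OF u, of \<epsilon>] \<epsilon> by (intro ennreal_mult[symmetric]) (auto intro!: mult_nonneg_nonneg integral_nonneg_AE)
  finally show ?thesis unfolding A_def .
qed

text \<open>The substitution \<open>x = u + p / u\<close>.\<close>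

lemma lower_integral:
  assumes u: "0 < u" and \<epsilon>: "0 < \<epsilon>" "\<epsilon> \<le> 1/4"
  shows "(\<integral>\<^sup>+x. ennreal (std_normal_density x) * emeasure lborel {t. infdist t S \<le> inner_radius \<epsilon> \<delta> u x} \<partial>lborel)
    = ennreal (1 / u * (std_normal_density u * vol (1 / u) * (LINT p|lborel. lower_integrand \<epsilon> \<delta> u p)))" (is "?L = _")
proof -
  define R where "R = inner_radius \<epsilon> \<delta> u"
  have [measurable]: "R \<in> borel_measurable borel" unfolding R_def by measurable
  define A where "A = std_normal_density u * vol (1 / u)"
  have A: "0 \<le> A" by (simp add: A_def vol_nonneg)
  have "?L = (\<integral>\<^sup>+x. ennreal (std_normal_density x * vol (R x)) \<partial>lborel)"
    by (simp add: emeasure_vol R_def ennreal_mult vol_nonneg)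
  also have "\<dots> = ennreal (1 / u) * (\<integral>\<^sup>+p. ennreal (std_normal_density (u + 1 / u * p) * vol (R (u + 1 / u * p))) \<partial>lborel)"
    using nn_integral_real_affine[of "\<lambda>x. ennreal (std_normal_density x * vol (R x))" "1 / u" u] u by simp
  also have "(\<integral>\<^sup>+p. ennreal (std_normal_density (u + 1 / u * p) * vol (R (u + 1 / u * p))) \<partial>lborel)
      = (\<integral>\<^sup>+p. ennreal (A * lower_integrand \<epsilon> \<delta> u p) \<partial>lborel)"
  proof (intro nn_integral_cong arg_cong[where f = ennreal])
    fix p
    define x where "x = u + 1 / u * p"
    have x: "x = u + p / u" by (simp add: x_def)
    have ux: "u * (x - u) = p" using u by (simp add: x)
    have c: "(u < x \<and> x \<le> (1 + \<delta>\<^sup>2 / 2) * u) \<longleftrightarrow> (0 < p \<and> p \<le> \<delta>\<^sup>2 * u\<^sup>2 / 2)"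
    proof -
      have "u < x \<longleftrightarrow> 0 < p" using u by (simp add: x zero_less_divide_iff)
      moreover have "x \<le> (1 + \<delta>\<^sup>2 / 2) * u \<longleftrightarrow> u * x \<le> u * ((1 + \<delta>\<^sup>2 / 2) * u)" using u by simp
      moreover have "u * x = u\<^sup>2 + p" using u by (simp add: x distrib_left power2_eq_square)
      moreover have "u * ((1 + \<delta>\<^sup>2 / 2) * u) = u\<^sup>2 + \<delta>\<^sup>2 * u\<^sup>2 / 2" by (simp add: power2_eq_square algebra_simps)
      ultimately show ?thesis by auto
    qed
    show "std_normal_density x * vol (R x) = A * lower_integrand \<epsilon> \<delta> u p"
    proof (cases "0 < p \<and> p \<le> \<delta>\<^sup>2 * u\<^sup>2 / 2")
      case True
      then have R: "R x = lower_radius \<epsilon> p / u" using c ux by (simp add: R_def inner_radius_def lower_radius_def mult.assoc)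
      have "std_normal_density x = std_normal_density u * exp (- p - p\<^sup>2 / (2 * u\<^sup>2))"
        unfolding x using u by (intro std_normal_density_shift) simp
      then show ?thesis using True by (simp add: R vol_rel_vol[OF u, of "lower_radius \<epsilon> p"] A_def lower_integrand_def)
    next
      case False
      then have "R x = -1" unfolding R_def inner_radius_def using c by (intro if_not_P) blast
      then show ?thesis using False by (simp add: vol_neg lower_integrand_def)
    qed
  qed
  also have "\<dots> = ennreal (A * (LINT p|lborel. lower_integrand \<epsilon> \<delta> u p))"
    using A lower_integrand_bounds(1)[OF u] integrable_integrands(2)[OF u] \<epsilon> by (subst nn_integral_eq_integral) auto
  also have "ennreal (1 / u) * ennreal (A * (LINT p|lborel. lower_integrand \<epsilon> \<delta> u p)) = ennreal (1 / u * (A * (LINT p|lborel. lower_integrand \<epsilon> \<delta> u p)))"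
    using u A lower_integrand_bounds(1)[OF u, of \<epsilon>] \<epsilon> by (intro ennreal_mult[symmetric]) (auto intro!: mult_nonneg_nonneg integral_nonneg_AE)
  finally show ?thesis unfolding A_def .
qed

theorem exceed_le:
  assumes \<epsilon>: "0 < \<epsilon>" "\<epsilon> \<le> 1/4"
  shows "\<exists>c>0. \<exists>C\<ge>0. \<forall>\<^sub>F u in at_top. prob (exceed u) \<le>
     ((1 + \<epsilon>) / sqrt (2 * pi)) ^ CARD('n) * exp (\<epsilon>\<^sup>2) * (LINT p|lborel. upper_integrand \<epsilon> u p) * rate u + C * exp (- (1/2 + c) * u\<^sup>2)"
proof -
  obtain c C where c: "c > 0" "C \<ge> 0" and ev: "\<forall>\<^sub>F u in at_top.
    ennreal (prob (exceed u) - C * exp (- (1/2 + c) * u\<^sup>2)) * ennreal ((2 * (\<epsilon> / CARD('n) / ((1 + \<epsilon>) * u))) ^ CARD('n))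
    \<le> ennreal (measure std_normal_distribution {- (\<epsilon> / CARD('n))..\<epsilon> / CARD('n)} ^ CARD('n)) *
      (\<integral>\<^sup>+x. ennreal (std_normal_density x) * emeasure lborel {t. infdist t S \<le> outer_radius \<epsilon> u x} \<partial>lborel)"
    using exceed_upper[OF \<epsilon>(1)] \<epsilon>(2) by auto
  define n where "n = CARD('n)"
  define \<rho> where "\<rho> = \<epsilon> / n"
  have \<rho>: "0 < \<rho>" using \<epsilon> by (simp add: \<rho>_def n_def)
  define q where "q = measure std_normal_distribution {-\<rho>..\<rho>}"
  have q: "0 \<le> q" "q \<le> 2 * \<rho> / sqrt (2 * pi)" using std_normal_central_mass(1)[of \<rho>] \<rho> by (simp_all add: q_def)
  show ?thesis
  proof (rule exI[of _ c], rule conjI[OF c(1)], rule exI[of _ C], rule conjI[OF c(2)])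
    show "\<forall>\<^sub>F u in at_top. prob (exceed u) \<le>
     ((1 + \<epsilon>) / sqrt (2 * pi)) ^ CARD('n) * exp (\<epsilon>\<^sup>2) * (LINT p|lborel. upper_integrand \<epsilon> u p) * rate u + C * exp (- (1/2 + c) * u\<^sup>2)"
      using ev eventually_gt_at_top[of "0::real"]
    proof eventually_elim
      case (elim u)
      define J where "J = (LINT p|lborel. upper_integrand \<epsilon> u p)"
      have J: "0 \<le> J" unfolding J_def using upper_integrand_bounds(1)[OF elim(2), of \<epsilon>] \<epsilon> by (intro integral_nonneg_AE) auto
      define h where "h = 2 * (\<rho> / ((1 + \<epsilon>) * u))"
      have h: "0 < h" using \<rho> \<epsilon> elim(2) by (simp add: h_def)
      define K where "K = 1 / u * (std_normal_density u * exp (\<epsilon>\<^sup>2) * vol (1 / u) * J)"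
      have K: "0 \<le> K" using elim(2) J by (simp add: K_def vol_nonneg)
      define D where "D = prob (exceed u) - C * exp (- (1/2 + c) * u\<^sup>2)"
      have "ennreal D * ennreal (h ^ n) \<le> ennreal (q ^ n) * ennreal K"
        unfolding D_def h_def q_def \<rho>_def n_def K_def J_def
        by (rule order_trans[OF elim(1)]) (intro mult_left_mono upper_integral[OF elim(2) \<epsilon>] zero_le)
      then have "ennreal (D * h ^ n) \<le> ennreal (q ^ n * K)"
        using h q K by (simp add: ennreal_mult'' ennreal_mult')
      then have "D * h ^ n \<le> q ^ n * K" using q K by (simp add: ennreal_le_iff)
      then have "D \<le> (q / h) ^ n * K" using h by (simp add: power_divide field_simps)
      also have "\<dots> \<le> ((1 + \<epsilon>) / sqrt (2 * pi) * u) ^ n * K"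
      proof (intro mult_right_mono power_mono K)
        have "q / h \<le> 2 * \<rho> / sqrt (2 * pi) / h" using q h by (intro divide_right_mono) auto
        also have "\<dots> = (1 + \<epsilon>) / sqrt (2 * pi) * u" using \<rho> \<epsilon> elim(2) by (simp add: h_def field_simps)
        finally show "q / h \<le> (1 + \<epsilon>) / sqrt (2 * pi) * u" .
      qed (use q h in auto)
      also have "\<dots> = ((1 + \<epsilon>) / sqrt (2 * pi)) ^ n * exp (\<epsilon>\<^sup>2) * J * rate u"
        unfolding power_mult_distrib K_def rate_def n_def by simp
      finally show ?case by (simp add: D_def J_def n_def)
    qed
  qed
qed

theorem exceed_ge:
  assumes \<epsilon>: "0 < \<epsilon>" "\<epsilon> \<le> 1/4"
  shows "\<exists>\<delta>>0. \<exists>c>0. \<exists>C\<ge>0. \<forall>\<^sub>F u in at_top.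
     ((1 - \<epsilon>) * exp (- \<epsilon>\<^sup>2) / sqrt (2 * pi)) ^ CARD('n) * (LINT p|lborel. lower_integrand \<epsilon> \<delta> u p) * rate u
       - C * u ^ CARD('n) * exp (- (1/2 + c) * u\<^sup>2) \<le> prob (exceed u)"
proof -
  obtain \<delta> c C where c: "\<delta> > 0" "c > 0" "C \<ge> 0" and ev: "\<forall>\<^sub>F u in at_top.
    ennreal (measure std_normal_distribution {- (\<epsilon> / CARD('n))..\<epsilon> / CARD('n)} ^ CARD('n)) *
      (\<integral>\<^sup>+x. ennreal (std_normal_density x) * emeasure lborel {t. infdist t S \<le> inner_radius \<epsilon> \<delta> u x} \<partial>lborel)
    \<le> ennreal ((2 * (\<epsilon> / CARD('n) / ((1 - \<epsilon>) * u))) ^ CARD('n) * prob (exceed u) + C * exp (- (1/2 + c) * u\<^sup>2))"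
    using exceed_lower[OF \<epsilon>(1)] \<epsilon>(2) by auto
  define n where "n = CARD('n)"
  have n: "0 < n" by (simp add: n_def)
  define \<rho> where "\<rho> = \<epsilon> / n"
  have \<rho>: "0 < \<rho>" using \<epsilon> by (simp add: \<rho>_def n_def)
  have "\<rho> \<le> \<epsilon>" using \<epsilon> n by (simp add: \<rho>_def divide_le_eq mult_le_cancel_left1)
  then have "\<rho>\<^sup>2 \<le> \<epsilon>\<^sup>2" using \<rho> by (intro power_mono) auto
  then have \<rho>2: "\<rho>\<^sup>2 / 2 \<le> \<epsilon>\<^sup>2" using zero_le_power2[of \<epsilon>] by linarith
  define q where "q = measure std_normal_distribution {-\<rho>..\<rho>}"
  have q: "0 \<le> q" "2 * \<rho> * exp (- \<rho>\<^sup>2 / 2) / sqrt (2 * pi) \<le> q" using std_normal_central_mass(2)[of \<rho>] \<rho> by (simp_all add: q_def)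
  define C' where "C' = C * ((1 - \<epsilon>) / (2 * \<rho>)) ^ n"
  have C': "0 \<le> C'" using c \<rho> \<epsilon> by (simp add: C'_def)
  show ?thesis
  proof (rule exI[of _ \<delta>], rule conjI[OF c(1)], rule exI[of _ c], rule conjI[OF c(2)], rule exI[of _ C'], rule conjI[OF C'])
    show "\<forall>\<^sub>F u in at_top.
     ((1 - \<epsilon>) * exp (- \<epsilon>\<^sup>2) / sqrt (2 * pi)) ^ CARD('n) * (LINT p|lborel. lower_integrand \<epsilon> \<delta> u p) * rate u
       - C' * u ^ CARD('n) * exp (- (1/2 + c) * u\<^sup>2) \<le> prob (exceed u)"
      using ev eventually_gt_at_top[of "0::real"]
    proof eventually_elim
      case (elim u)
      define J where "J = (LINT p|lborel. lower_integrand \<epsilon> \<delta> u p)"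
      have J: "0 \<le> J" unfolding J_def using lower_integrand_bounds(1)[OF elim(2), of \<epsilon>] \<epsilon> by (intro integral_nonneg_AE) auto
      define h where "h = 2 * (\<rho> / ((1 - \<epsilon>) * u))"
      have h: "0 < h" using \<rho> \<epsilon> elim(2) by (simp add: h_def)
      define K where "K = 1 / u * (std_normal_density u * vol (1 / u) * J)"
      have K: "0 \<le> K" using elim(2) J by (simp add: K_def vol_nonneg)
      define E where "E = C * exp (- (1/2 + c) * u\<^sup>2)"
      have E: "0 \<le> E" using c by (simp add: E_def)
      have "ennreal (q ^ n) * ennreal K \<le> ennreal (h ^ n * prob (exceed u) + E)"
        using elim(1) unfolding lower_integral[OF elim(2) \<epsilon>] E_def h_def q_def \<rho>_def n_def K_def J_def .
      then have "ennreal (q ^ n * K) \<le> ennreal (h ^ n * prob (exceed u) + E)"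
        using q K by (simp add: ennreal_mult)
      then have "q ^ n * K \<le> h ^ n * prob (exceed u) + E" using h E by (subst (asm) ennreal_le_iff) auto
      then have "(q ^ n * K - E) / h ^ n \<le> prob (exceed u)" using h by (simp add: divide_le_eq mult.commute)
      then have 1: "(q / h) ^ n * K - E / h ^ n \<le> prob (exceed u)" by (simp add: diff_divide_distrib power_divide)
      have "((1 - \<epsilon>) * exp (- \<epsilon>\<^sup>2) / sqrt (2 * pi) * u) ^ n * K \<le> (q / h) ^ n * K"
      proof (intro mult_right_mono power_mono K)
        have "(1 - \<epsilon>) * exp (- \<epsilon>\<^sup>2) / sqrt (2 * pi) * u \<le> (1 - \<epsilon>) * exp (- \<rho>\<^sup>2 / 2) / sqrt (2 * pi) * u"
          using \<rho>2 \<epsilon> elim(2) by (intro mult_right_mono divide_right_mono mult_left_mono) auto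
        also have "\<dots> = 2 * \<rho> * exp (- \<rho>\<^sup>2 / 2) / sqrt (2 * pi) / h" using \<rho> \<epsilon> elim(2) by (simp add: h_def field_simps)
        also have "\<dots> \<le> q / h" using q h by (intro divide_right_mono) auto
        finally show "(1 - \<epsilon>) * exp (- \<epsilon>\<^sup>2) / sqrt (2 * pi) * u \<le> q / h" .
      qed (use \<epsilon> elim(2) in auto)
      moreover have "((1 - \<epsilon>) * exp (- \<epsilon>\<^sup>2) / sqrt (2 * pi) * u) ^ n * K = ((1 - \<epsilon>) * exp (- \<epsilon>\<^sup>2) / sqrt (2 * pi)) ^ n * J * rate u"
        unfolding power_mult_distrib K_def rate_def n_def by simp
      moreover have "E / h ^ n = C' * u ^ n * exp (- (1/2 + c) * u\<^sup>2)"
      proof -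
        have inv: "1 / h = (1 - \<epsilon>) / (2 * \<rho>) * u" using \<rho> \<epsilon> elim(2) by (simp add: h_def field_simps)
        have "E / h ^ n = E * (1 / h) ^ n" by (simp add: power_divide)
        also have "\<dots> = C' * u ^ n * exp (- (1/2 + c) * u\<^sup>2)"
          unfolding inv power_mult_distrib E_def C'_def by (simp only: mult_ac)
        finally show ?thesis .
      qed
      ultimately show ?case using 1 by (simp add: J_def n_def)
    qed
  qed
qed

end

section \<open>Limits of the normalised probability\<close>

context field_on_set
begin

text \<open>By doubling, \<open>vol (1 / u)\<close> is at least of order \<open>u^(- n)\<close>, so \<open>rate u\<close> is at least a power of \<open>u\<close> times the normal density.\<close>

lemma negligible_relative_to_rate:
  assumes c: "0 < c" and C: "0 \<le> C"
  shows "((\<lambda>u. C * exp (- (1/2 + c) * u\<^sup>2) / rate u) \<longlongrightarrow> 0) at_top"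
    "((\<lambda>u. C * u ^ CARD('n) * exp (- (1/2 + c) * u\<^sup>2) / rate u) \<longlongrightarrow> 0) at_top"
proof -
  define n where "n = CARD('n)"
  have n: "0 < n" by (simp add: n_def)
  define K where "K = C * real n ^ n * sqrt (2 * pi) / vol 1"
  have main: "C * u ^ k * exp (- (1/2 + c) * u\<^sup>2) / rate u \<le> K * (u * exp (6 + u) * exp (- c * u\<^sup>2))"
    if u: "1 \<le> u" and k: "k \<le> n" for u k
  proof -
    have "vol 1 = vol (u * (1 / u))" using u by simp
    also have "\<dots> \<le> (6 + u) ^ n * vol (1 / u)"
      unfolding vol_def n_def by (rule tube_doubling[OF S]) (use u in auto)
    also have "\<dots> \<le> (real n ^ n * exp (6 + u)) * vol (1 / u)"
      using power_le_exp[of "6 + u" n] n u by (intro mult_right_mono vol_nonneg) auto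
    finally have v: "vol 1 \<le> real n ^ n * exp (6 + u) * vol (1 / u)" .
    have vp: "0 < vol 1" "0 < vol (1 / u)" using vol_pos u by auto
    have "C * u ^ k * exp (- (1/2 + c) * u\<^sup>2) / rate u \<le> C * u ^ n * exp (- (1/2 + c) * u\<^sup>2) / rate u"
      using rate_pos[of u] u C k by (intro divide_right_mono mult_right_mono mult_left_mono power_increasing) auto
    also have "\<dots> = C * sqrt (2 * pi) * u * exp (- c * u\<^sup>2) / vol (1 / u)"
    proof -
      have "exp (- (1/2 + c) * u\<^sup>2) = exp (- u\<^sup>2 / 2) * exp (- c * u\<^sup>2)"
        by (simp add: mult_exp_exp algebra_simps)
      then show ?thesis using u by (simp add: rate_def n_def std_normal_density_def)
    qed
    also have "\<dots> \<le> C * sqrt (2 * pi) * u * exp (- c * u\<^sup>2) * (real n ^ n * exp (6 + u) / vol 1)"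
    proof -
      have "1 / vol (1 / u) \<le> real n ^ n * exp (6 + u) / vol 1" using v vp by (simp add: field_simps)
      from mult_left_mono[OF this, of "C * sqrt (2 * pi) * u * exp (- c * u\<^sup>2)"] show ?thesis using C u by simp
    qed
    also have "\<dots> = K * (u * exp (6 + u) * exp (- c * u\<^sup>2))" by (simp add: K_def)
    finally show ?thesis .
  qed
  have "((\<lambda>u. u * exp (6 + u) * exp (- c * u\<^sup>2)) \<longlongrightarrow> 0) at_top" using c by real_asymp
  then have lim: "((\<lambda>u. K * (u * exp (6 + u) * exp (- c * u\<^sup>2))) \<longlongrightarrow> 0) at_top"
    by (rule tendsto_mult_right_zero)
  have "((\<lambda>u. C * u ^ k * exp (- (1/2 + c) * u\<^sup>2) / rate u) \<longlongrightarrow> 0) at_top" if "k \<le> n" for k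
  proof (rule tendsto_sandwich[OF _ _ tendsto_const lim])
    show "\<forall>\<^sub>F u in at_top. 0 \<le> C * u ^ k * exp (- (1/2 + c) * u\<^sup>2) / rate u"
      using eventually_ge_at_top[of "1::real"] by eventually_elim (use C rate_pos in \<open>simp add: less_imp_le\<close>)
    show "\<forall>\<^sub>F u in at_top. C * u ^ k * exp (- (1/2 + c) * u\<^sup>2) / rate u \<le> K * (u * exp (6 + u) * exp (- c * u\<^sup>2))"
      using eventually_ge_at_top[of "1::real"] by eventually_elim (rule main[OF _ that])
  qed
  from this[of 0] this[of n]
  show "((\<lambda>u. C * exp (- (1/2 + c) * u\<^sup>2) / rate u) \<longlongrightarrow> 0) at_top"
    "((\<lambda>u. C * u ^ CARD('n) * exp (- (1/2 + c) * u\<^sup>2) / rate u) \<longlongrightarrow> 0) at_top"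
    by (simp_all add: n_def)
qed

definition "ratio u = prob (exceed u) / rate u"
definition "upper_const \<epsilon> = ((1 + \<epsilon>) / sqrt (2 * pi)) ^ CARD('n) * exp (\<epsilon>\<^sup>2)"
definition "lower_const \<epsilon> = ((1 - \<epsilon>) * exp (- \<epsilon>\<^sup>2) / sqrt (2 * pi)) ^ CARD('n)"

lemma ratio_upper:
  assumes "0 < \<epsilon>" "\<epsilon> \<le> 1/4" "0 < \<eta>"
  shows "\<forall>\<^sub>F u in at_top. ratio u \<le> upper_const \<epsilon> * (LINT p|lborel. upper_integrand \<epsilon> u p) + \<eta>"
proof -
  obtain c C where c: "c > 0" "C \<ge> 0" and ev: "\<forall>\<^sub>F u in at_top. prob (exceed u) \<le>
     ((1 + \<epsilon>) / sqrt (2 * pi)) ^ CARD('n) * exp (\<epsilon>\<^sup>2) * (LINT p|lborel. upper_integrand \<epsilon> u p) * rate u + C * exp (- (1/2 + c) * u\<^sup>2)"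
    using exceed_le[OF assms(1,2)] by blast
  have "\<forall>\<^sub>F u in at_top. C * exp (- (1/2 + c) * u\<^sup>2) / rate u < \<eta>"
    by (rule order_tendstoD(2)[OF negligible_relative_to_rate(1)[OF c] assms(3)])
  with ev show ?thesis using eventually_gt_at_top[of "0::real"]
  proof eventually_elim
    case (elim u)
    have r: "0 < rate u" by (rule rate_pos[OF elim(3)])
    have "ratio u \<le> (upper_const \<epsilon> * (LINT p|lborel. upper_integrand \<epsilon> u p) * rate u + C * exp (- (1/2 + c) * u\<^sup>2)) / rate u"
      unfolding ratio_def upper_const_def using elim(1) r by (intro divide_right_mono) auto
    also have "\<dots> = upper_const \<epsilon> * (LINT p|lborel. upper_integrand \<epsilon> u p) + C * exp (- (1/2 + c) * u\<^sup>2) / rate u"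
      using r by (simp add: add_divide_distrib)
    finally show ?case using elim(2) by linarith
  qed
qed

lemma ratio_lower:
  assumes "0 < \<epsilon>" "\<epsilon> \<le> 1/4"
  shows "\<exists>\<delta>>0. \<forall>\<eta>>0. \<forall>\<^sub>F u in at_top. lower_const \<epsilon> * (LINT p|lborel. lower_integrand \<epsilon> \<delta> u p) - \<eta> \<le> ratio u"
proof -
  obtain \<delta> c C where c: "\<delta> > 0" "c > 0" "C \<ge> 0" and ev: "\<forall>\<^sub>F u in at_top.
     ((1 - \<epsilon>) * exp (- \<epsilon>\<^sup>2) / sqrt (2 * pi)) ^ CARD('n) * (LINT p|lborel. lower_integrand \<epsilon> \<delta> u p) * rate u
       - C * u ^ CARD('n) * exp (- (1/2 + c) * u\<^sup>2) \<le> prob (exceed u)"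
    using exceed_ge[OF assms] by blast
  show ?thesis
  proof (rule exI[of _ \<delta>], rule conjI[OF c(1)], intro allI impI)
    fix \<eta> :: real assume \<eta>: "0 < \<eta>"
    have "\<forall>\<^sub>F u in at_top. C * u ^ CARD('n) * exp (- (1/2 + c) * u\<^sup>2) / rate u < \<eta>"
      by (rule order_tendstoD(2)[OF negligible_relative_to_rate(2)[OF c(2,3)] \<eta>])
    with ev show "\<forall>\<^sub>F u in at_top. lower_const \<epsilon> * (LINT p|lborel. lower_integrand \<epsilon> \<delta> u p) - \<eta> \<le> ratio u"
      using eventually_gt_at_top[of "0::real"]
    proof eventually_elim
      case (elim u)
      have r: "0 < rate u" by (rule rate_pos[OF elim(3)])
      have "(lower_const \<epsilon> * (LINT p|lborel. lower_integrand \<epsilon> \<delta> u p) * rate u - C * u ^ CARD('n) * exp (- (1/2 + c) * u\<^sup>2)) / rate u \<le> ratio u"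
        unfolding ratio_def lower_const_def using elim(1) r by (intro divide_right_mono) auto
      moreover have "(lower_const \<epsilon> * (LINT p|lborel. lower_integrand \<epsilon> \<delta> u p) * rate u - C * u ^ CARD('n) * exp (- (1/2 + c) * u\<^sup>2)) / rate u
        = lower_const \<epsilon> * (LINT p|lborel. lower_integrand \<epsilon> \<delta> u p) - C * u ^ CARD('n) * exp (- (1/2 + c) * u\<^sup>2) / rate u"
        using r by (simp add: diff_divide_distrib)
      ultimately show ?case using elim(2) by linarith
    qed
  qed
qed

text \<open>Above, the envelope bounds the integral. Below, \<open>\<epsilon> = 1/4\<close> and \<open>2 \<le> p \<le> 3\<close> suffice: there the radius is at least
\<open>3/2 - 1/2 = 1\<close> in units of \<open>1 / u\<close>.\<close>

theorem ratio_bounded: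
  "\<exists>a>0. \<exists>b>0. \<forall>\<^sub>F u in at_top. a \<le> ratio u \<and> ratio u \<le> b"
proof -
  define I where "I = (LINT p|lborel. envelope p)"
  have I: "0 \<le> I" unfolding I_def by (intro integral_nonneg_AE) (simp add: envelope_nonneg)
  have cu: "0 < upper_const (1/4)" by (simp add: upper_const_def)
  have cl: "0 < lower_const (1/4)" by (simp add: lower_const_def)
  have ev: "\<forall>\<^sub>F u in at_top. ratio u \<le> upper_const (1/4) * (LINT p|lborel. upper_integrand (1/4) u p) + 1"
    by (rule ratio_upper) simp_all
  have up: "\<forall>\<^sub>F u in at_top. ratio u \<le> upper_const (1/4) * I + 1"
    using ev eventually_gt_at_top[of "0::real"]
  proof eventually_elim
    case (elim u)
    note u = elim(2,1)
    have "(LINT p|lborel. upper_integrand (1/4) u p) \<le> I" unfolding I_def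
      using upper_integrand_bounds[OF u(1), of "1/4"] integrable_integrands(1)[OF u(1), of "1/4"] by (intro integral_mono integrable_envelope) auto
    then have "upper_const (1/4) * (LINT p|lborel. upper_integrand (1/4) u p) \<le> upper_const (1/4) * I" using cu by (intro mult_left_mono) auto
    then show ?case using u(2) by linarith
  qed
  obtain \<delta> where \<delta>: "\<delta> > 0" "\<And>\<eta>. \<eta> > 0 \<Longrightarrow> \<forall>\<^sub>F u in at_top. lower_const (1/4) * (LINT p|lborel. lower_integrand (1/4) \<delta> u p) - \<eta> \<le> ratio u"
    using ratio_lower[of "1/4"] by auto
  define a where "a = lower_const (1/4) * exp (-4) / 2"
  have a: "0 < a" using cl by (simp add: a_def)
  have "\<forall>\<^sub>F u in at_top. a \<le> ratio u"
    using \<delta>(2)[OF a] eventually_ge_at_top[of "3::real"] eventually_ge_at_top[of "3 / \<delta>"]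
  proof eventually_elim
    case (elim u)
    have u: "0 < u" using elim by simp
    have "exp (-4) = (LINT p|lborel. indicator {2..3::real} p * exp (-4::real))" by simp
    also have "\<dots> \<le> (LINT p|lborel. lower_integrand (1/4) \<delta> u p)"
    proof (rule integral_mono)
      show "integrable lborel (\<lambda>p. indicator {2..3::real} p * exp (-4::real))" by simp
      show "integrable lborel (lower_integrand (1/4) \<delta> u)" using integrable_integrands(2)[OF u, of "1/4"] by simp
      fix p :: real
      show "indicator {2..3} p * exp (-4) \<le> lower_integrand (1/4) \<delta> u p"
      proof (cases "p \<in> {2..3}")
        case True
        have "3 \<le> \<delta> * u" using elim(3) \<delta>(1) by (simp add: field_simps)
        then have "3\<^sup>2 \<le> (\<delta> * u)\<^sup>2" by (intro power_mono) auto
        then have 1: "p \<le> \<delta>\<^sup>2 * u\<^sup>2 / 2" using True by (simp add: power_mult_distrib)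
        have "(3/2)\<^sup>2 \<le> 2 * p / (1 + 2 * (1/4))" using True by (simp add: power2_eq_square)
        then have "3/2 \<le> sqrt (2 * p / (1 + 2 * (1/4)))" by (rule real_le_rsqrt)
        then have "1 \<le> lower_radius (1/4) p" by (simp add: lower_radius_def)
        then have 2: "1 \<le> rel_vol u (lower_radius (1/4) p)" by (rule rel_vol_ge_1[OF u])
        have "p\<^sup>2 / (2 * u\<^sup>2) \<le> 1"
        proof -
          have "p\<^sup>2 \<le> u\<^sup>2" using True elim(2) by (intro power_mono) auto
          then show ?thesis using u by (simp add: divide_le_eq) (metis order_trans zero_le_power2 le_add_same_cancel1 mult_2)
        qed
        then have "exp (-4) \<le> exp (- p - p\<^sup>2 / (2 * u\<^sup>2))" using True by simp
        from mult_mono[OF this 2] have "exp (-4) \<le> exp (- p - p\<^sup>2 / (2 * u\<^sup>2)) * rel_vol u (lower_radius (1/4) p)" by simp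
        then show ?thesis using True 1 by (simp add: lower_integrand_def)
      next
        case False
        then show ?thesis using lower_integrand_bounds(1)[OF u, of "1/4"] by simp
      qed
    qed
    finally have "lower_const (1/4) * exp (-4) \<le> lower_const (1/4) * (LINT p|lborel. lower_integrand (1/4) \<delta> u p)" using cl by (intro mult_left_mono) auto
    then show ?case using elim(1) by (simp add: a_def)
  qed
  with up have "\<forall>\<^sub>F u in at_top. a \<le> ratio u \<and> ratio u \<le> upper_const (1/4) * I + 1" by eventually_elim simp
  moreover have "0 < upper_const (1/4) * I + 1" using cu I by (intro add_nonneg_pos) auto
  ultimately show ?thesis using a by blast
qed

text \<open>The limit of the relative volumes, with the value \<open>0\<close> for negative radii also when \<open>m = 0\<close>.\<close>

definition pos_powr :: "real \<Rightarrow> real \<Rightarrow> real" where "pos_powr m a = (if 0 < a then a powr m else 0)"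

lemma pos_powr_nonneg: "0 \<le> pos_powr m a" by (simp add: pos_powr_def)

lemma pos_powr_measurable[measurable]: "pos_powr m \<in> borel_measurable borel"
  unfolding pos_powr_def[abs_def] by measurable

lemma Gamma_limit_integral:
  assumes m: "0 \<le> (m::real)"
  shows "(LINT p|lborel. indicator {0..} p * (exp (- p) * pos_powr m (sqrt (2 * p)))) = 2 powr (m / 2) * Gamma (1 + m / 2)"
proof -
  have g: "0 < Gamma (1 + m / 2)" using m by (intro Gamma_real_pos) simp
  have "(\<integral>\<^sup>+p. ennreal (indicator {0..} p * (exp (- p) * pos_powr m (sqrt (2 * p)))) \<partial>lborel)
     = (\<integral>\<^sup>+p. ennreal (2 powr (m / 2)) * ennreal (indicator {0..} p * p powr ((1 + m / 2) - 1) / exp p) \<partial>lborel)"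
  proof (rule nn_integral_cong_AE, rule AE_mp[OF AE_lborel_singleton[of 0]], rule AE_I2, rule impI)
    fix p :: real assume p: "p \<noteq> 0"
    show "ennreal (indicator {0..} p * (exp (- p) * pos_powr m (sqrt (2 * p)))) =
      ennreal (2 powr (m / 2)) * ennreal (indicator {0..} p * p powr ((1 + m / 2) - 1) / exp p)"
    proof (cases "0 < p")
      case True
      have "sqrt (2 * p) powr m = (2 * p) powr (m / 2)" using True by (simp add: powr_half_sqrt[symmetric] powr_powr)
      also have "\<dots> = 2 powr (m / 2) * p powr (m / 2)" using True by (simp add: powr_mult)
      finally have pl: "pos_powr m (sqrt (2 * p)) = 2 powr (m / 2) * p powr (m / 2)" using True by (simp add: pos_powr_def)
      have i: "indicator {0..} p = (1::real)" using True by simp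
      have e: "exp (- p) = 1 / exp p" by (simp add: exp_minus inverse_eq_divide)
      have m2: "(1 + m / 2) - 1 = m / 2" by simp
      have "indicator {0..} p * (exp (- p) * pos_powr m (sqrt (2 * p)))
          = 2 powr (m / 2) * (indicator {0..} p * p powr ((1 + m / 2) - 1) / exp p)"
        unfolding i e pl m2 by simp
      then show ?thesis by (simp only:) (rule ennreal_mult, auto)
    next
      case False
      then show ?thesis using p by (simp add: indicator_def)
    qed
  qed
  also have "\<dots> = ennreal (2 powr (m / 2)) * ennreal (Gamma (1 + m / 2))"
    using m by (subst nn_integral_cmult) (simp_all add: Gamma_conv_nn_integral_real)
  also have "\<dots> = ennreal (2 powr (m / 2) * Gamma (1 + m / 2))" using g by (simp add: ennreal_mult)
  finally have nn: "(\<integral>\<^sup>+p. ennreal (indicator {0..} p * (exp (- p) * pos_powr m (sqrt (2 * p)))) \<partial>lborel)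
    = ennreal (2 powr (m / 2) * Gamma (1 + m / 2))" .
  show ?thesis
    by (subst integral_eq_nn_integral) (auto simp: nn pos_powr_nonneg g less_imp_le intro!: AE_I2 mult_nonneg_nonneg)
qed

text \<open>For fixed \<open>\<epsilon>\<close>, dominated convergence gives the limits of both bounds as \<open>u\<close> tends to infinity; along \<open>\<epsilon> = 1 / (k + 4)\<close> these
limits converge to the same value.\<close>

theorem ratio_tendsto:
  assumes m: "0 \<le> m" and wl: "\<And>a. 0 < a \<Longrightarrow> ((\<lambda>u. rel_vol u a) \<longlongrightarrow> a powr m) at_top"
  shows "(ratio \<longlongrightarrow> (1 / sqrt (2 * pi)) ^ CARD('n) * (2 powr (m / 2) * Gamma (1 + m / 2))) at_top"
proof -
  define gup where "gup = (\<lambda>\<epsilon> p. indicator {0..} p * (exp (- p) * pos_powr m (upper_radius \<epsilon> p)))"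
  define glow where "glow = (\<lambda>\<epsilon> p. indicator {0..} p * (exp (- p) * pos_powr m (lower_radius \<epsilon> p)))"
  have [measurable]: "gup \<epsilon> \<in> borel_measurable borel" "glow \<epsilon> \<in> borel_measurable borel" for \<epsilon>
    unfolding gup_def glow_def by measurable
  have wl': "((\<lambda>u. rel_vol u a) \<longlongrightarrow> pos_powr m a) at_top" if "a \<noteq> 0" for a
  proof (cases "0 < a")
    case True then show ?thesis using wl by (simp add: pos_powr_def)
  next
    case False
    then have "a < 0" using that by simp
    have "\<forall>\<^sub>F u in at_top. rel_vol u a = 0"
      using eventually_gt_at_top[of "0::real"] by eventually_elim (rule rel_vol_neg[OF _ \<open>a < 0\<close>])
    then show ?thesis using False by (simp add: pos_powr_def tendsto_eventually)
  qed
  have pos_powr_bound: "pos_powr m a \<le> (7 + a) ^ CARD('n)" if "0 \<le> a" for a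
  proof (cases "a = 0")
    case False
    have "\<forall>\<^sub>F u in at_top. rel_vol u a \<le> (7 + a) ^ CARD('n)"
      using eventually_gt_at_top[of "0::real"] by eventually_elim (rule rel_vol_le[OF _ that])
    then show ?thesis by (rule tendsto_upperbound[OF wl'[OF False]]) simp
  qed (simp add: pos_powr_def)
  have g_bound: "\<bar>indicator {0..} p * (exp (- p) * pos_powr m a)\<bar> \<le> envelope p"
    if "0 \<le> p \<Longrightarrow> a \<le> 2 * sqrt p + 1" for p a
  proof (cases "0 \<le> p \<and> 0 < a")
    case True
    have "exp (- p) * pos_powr m a \<le> exp (- p) * (7 + a) ^ CARD('n)" using True pos_powr_bound[of a] by simp
    also have "\<dots> \<le> envelope p" using True that power_le_envelope by simp
    finally show ?thesis using True by (simp add: pos_powr_def)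
  next
    case False
    then show ?thesis by (auto simp: pos_powr_def envelope_nonneg)
  qed
  have upper_integrand_lim: "((\<lambda>u. LINT p|lborel. upper_integrand \<epsilon> u p) \<longlongrightarrow> (LINT p|lborel. gup \<epsilon> p)) at_top" if \<epsilon>: "0 < \<epsilon>" "\<epsilon> \<le> 1/4" for \<epsilon>
  proof (rule integral_dominated_convergence_at_top[where w = envelope])
    show "\<forall>\<^sub>F u in at_top. AE p in lborel. norm (upper_integrand \<epsilon> u p) \<le> envelope p"
      using eventually_gt_at_top[of "0::real"] by eventually_elim (use upper_integrand_bounds \<epsilon> in auto)
    show "AE p in lborel. ((\<lambda>u. upper_integrand \<epsilon> u p) \<longlongrightarrow> gup \<epsilon> p) at_top"
    proof (rule AE_I2)
      fix p :: real
      show "((\<lambda>u. upper_integrand \<epsilon> u p) \<longlongrightarrow> gup \<epsilon> p) at_top"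
      proof (cases "0 \<le> p")
        case True
        then have "0 < upper_radius \<epsilon> p" using \<epsilon> by (simp add: upper_radius_def add_nonneg_pos)
        then show ?thesis unfolding upper_integrand_def gup_def by (intro tendsto_mult tendsto_const wl') auto
      qed (simp add: upper_integrand_def gup_def)
    qed
  qed (auto simp: integrable_envelope)
  have lower_integrand_lim: "((\<lambda>u. LINT p|lborel. lower_integrand \<epsilon> \<delta> u p) \<longlongrightarrow> (LINT p|lborel. glow \<epsilon> p)) at_top" if \<epsilon>: "0 < \<epsilon>" and \<delta>: "0 < \<delta>" for \<epsilon> \<delta>
  proof (rule integral_dominated_convergence_at_top[where w = envelope])
    show "\<forall>\<^sub>F u in at_top. AE p in lborel. norm (lower_integrand \<epsilon> \<delta> u p) \<le> envelope p"
      using eventually_gt_at_top[of "0::real"] by eventually_elim (use lower_integrand_bounds \<epsilon> in auto)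
    \<comment> \<open>the second excluded point is where the radius vanishes, and there the relative volume need not converge\<close>
    have "AE p in lborel. p \<noteq> 0 \<and> p \<noteq> 2 * \<epsilon>\<^sup>2 * (1 + 2 * \<epsilon>)"
      using AE_lborel_singleton[of 0] AE_lborel_singleton[of "2 * \<epsilon>\<^sup>2 * (1 + 2 * \<epsilon>)"] by auto
    then show "AE p in lborel. ((\<lambda>u. lower_integrand \<epsilon> \<delta> u p) \<longlongrightarrow> glow \<epsilon> p) at_top"
    proof eventually_elim
      case (elim p)
      show ?case
      proof (cases "0 < p")
        case True
        have "lower_radius \<epsilon> p \<noteq> 0"
        proof
          assume "lower_radius \<epsilon> p = 0"
          then have "(sqrt (2 * p / (1 + 2 * \<epsilon>)))\<^sup>2 = (2 * \<epsilon>)\<^sup>2" by (simp add: lower_radius_def)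
          then have "2 * p / (1 + 2 * \<epsilon>) = 4 * \<epsilon>\<^sup>2" using True \<epsilon> by (simp add: power2_eq_square)
          then have "p = 2 * \<epsilon>\<^sup>2 * (1 + 2 * \<epsilon>)" using \<epsilon> by (simp add: divide_eq_eq)
          then show False using elim by simp
        qed
        then have w: "((\<lambda>u. rel_vol u (lower_radius \<epsilon> p)) \<longlongrightarrow> pos_powr m (lower_radius \<epsilon> p)) at_top" by (rule wl')
        have "((\<lambda>u. - p - p\<^sup>2 / (2 * u\<^sup>2)) \<longlongrightarrow> - p) at_top" by real_asymp
        then have e: "((\<lambda>u. exp (- p - p\<^sup>2 / (2 * u\<^sup>2))) \<longlongrightarrow> exp (- p)) at_top" by (rule tendsto_exp)
        have "filterlim (\<lambda>u::real. \<delta>\<^sup>2 * u\<^sup>2 / 2) at_top at_top" using \<delta> by real_asymp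
        then have "\<forall>\<^sub>F u in at_top. p \<le> \<delta>\<^sup>2 * u\<^sup>2 / 2" by (simp add: filterlim_at_top)
        then have "\<forall>\<^sub>F u in at_top. exp (- p - p\<^sup>2 / (2 * u\<^sup>2)) * rel_vol u (lower_radius \<epsilon> p) = lower_integrand \<epsilon> \<delta> u p"
          by eventually_elim (use True in \<open>simp add: lower_integrand_def\<close>)
        moreover have "((\<lambda>u. exp (- p - p\<^sup>2 / (2 * u\<^sup>2)) * rel_vol u (lower_radius \<epsilon> p)) \<longlongrightarrow> glow \<epsilon> p) at_top"
          using tendsto_mult[OF e w] True by (simp add: glow_def)
        ultimately show ?thesis by (rule Lim_transform_eventually[rotated])
      next
        case False
        then have "p < 0" using elim by simp
        then show ?thesis by (simp add: lower_integrand_def glow_def)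
      qed
    qed
  qed (auto simp: integrable_envelope)
  define e where "e = (\<lambda>k::nat. 1 / (real k + 4))"
  have e: "0 < e k" "e k \<le> 1/4" for k by (simp_all add: e_def divide_le_eq)
  have e0: "e \<longlonglongrightarrow> 0" unfolding e_def by real_asymp
  define L where "L = 2 powr (m / 2) * Gamma (1 + m / 2)"
  define g0 where "g0 = (\<lambda>p. indicator {0..} p * (exp (- p) * pos_powr m (sqrt (2 * p))))"
  have g0m[measurable]: "g0 \<in> borel_measurable borel" unfolding g0_def by measurable
  have L: "(LINT p|lborel. g0 p) = L" unfolding g0_def L_def by (rule Gamma_limit_integral[OF m])
  have cont: "(\<lambda>k. pos_powr m (x k)) \<longlonglongrightarrow> pos_powr m y" if x: "x \<longlonglongrightarrow> y" and y: "0 < y" for x y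
  proof -
    have "(\<lambda>k. x k powr m) \<longlonglongrightarrow> y powr m" using x y by (intro tendsto_powr tendsto_const) auto
    moreover have "\<forall>\<^sub>F k in sequentially. x k powr m = pos_powr m (x k)"
      using order_tendstoD(1)[OF x y] by eventually_elim (simp add: pos_powr_def)
    ultimately show ?thesis using y by (auto simp: pos_powr_def intro: Lim_transform_eventually)
  qed
  have gup_lim: "(\<lambda>k. LINT p|lborel. gup (e k) p) \<longlonglongrightarrow> L" unfolding L[symmetric]
  proof (rule integral_dominated_convergence[where w = envelope])
    show "AE p in lborel. norm (gup (e k) p) \<le> envelope p" for k
      unfolding gup_def real_norm_def by (intro AE_I2 g_bound) (use upper_radius_le e in \<open>auto simp: less_imp_le\<close>)
    show "AE p in lborel. (\<lambda>k. gup (e k) p) \<longlonglongrightarrow> g0 p"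
    proof (rule AE_mp[OF AE_lborel_singleton[of 0]], rule AE_I2, rule impI)
      fix p :: real assume p: "p \<noteq> 0"
      show "(\<lambda>k. gup (e k) p) \<longlonglongrightarrow> g0 p"
      proof (cases "0 < p")
        case True
        have "(\<lambda>k. sqrt (2 * p / (1 - 2 * e k)) + e k) \<longlonglongrightarrow> sqrt (2 * p / (1 - 2 * 0)) + 0"
          by (intro tendsto_intros e0) auto
        then have "(\<lambda>k. upper_radius (e k) p) \<longlonglongrightarrow> sqrt (2 * p)" by (simp add: upper_radius_def)
        then show ?thesis unfolding gup_def g0_def using True by (intro tendsto_mult tendsto_const cont) auto
      qed (use p in \<open>simp add: gup_def g0_def\<close>)
    qed
  qed (auto simp: integrable_envelope)
  have glow_lim: "(\<lambda>k. LINT p|lborel. glow (e k) p) \<longlonglongrightarrow> L" unfolding L[symmetric]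
  proof (rule integral_dominated_convergence[where w = envelope])
    show "AE p in lborel. norm (glow (e k) p) \<le> envelope p" for k
      unfolding glow_def real_norm_def by (intro AE_I2 g_bound) (use lower_radius_le e in \<open>auto simp: less_imp_le\<close>)
    show "AE p in lborel. (\<lambda>k. glow (e k) p) \<longlonglongrightarrow> g0 p"
    proof (rule AE_mp[OF AE_lborel_singleton[of 0]], rule AE_I2, rule impI)
      fix p :: real assume p: "p \<noteq> 0"
      show "(\<lambda>k. glow (e k) p) \<longlonglongrightarrow> g0 p"
      proof (cases "0 < p")
        case True
        have "(\<lambda>k. sqrt (2 * p / (1 + 2 * e k)) - 2 * e k) \<longlonglongrightarrow> sqrt (2 * p / (1 + 2 * 0)) - 2 * 0"
          by (intro tendsto_intros e0) auto
        then have "(\<lambda>k. lower_radius (e k) p) \<longlonglongrightarrow> sqrt (2 * p)" by (simp add: lower_radius_def)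
        then show ?thesis unfolding glow_def g0_def using True by (intro tendsto_mult tendsto_const cont) auto
      qed (use p in \<open>simp add: glow_def g0_def\<close>)
    qed
  qed (auto simp: integrable_envelope)
  define T where "T = (1 / sqrt (2 * pi)) ^ CARD('n) * L"
  have "(\<lambda>k. upper_const (e k) * (LINT p|lborel. gup (e k) p)) \<longlonglongrightarrow> ((1 + 0) / sqrt (2 * pi)) ^ CARD('n) * exp (0\<^sup>2) * L"
    unfolding upper_const_def by (intro tendsto_intros gup_lim e0) auto
  then have cupl: "(\<lambda>k. upper_const (e k) * (LINT p|lborel. gup (e k) p)) \<longlonglongrightarrow> T" by (simp add: T_def)
  have "(\<lambda>k. lower_const (e k) * (LINT p|lborel. glow (e k) p)) \<longlonglongrightarrow> ((1 - 0) * exp (- (0\<^sup>2)) / sqrt (2 * pi)) ^ CARD('n) * L"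
    unfolding lower_const_def by (intro tendsto_intros glow_lim e0) auto
  then have clowl: "(\<lambda>k. lower_const (e k) * (LINT p|lborel. glow (e k) p)) \<longlonglongrightarrow> T" by (simp add: T_def)
  have "(ratio \<longlongrightarrow> T) at_top"
  proof (rule order_tendstoI)
    fix a assume "a < T"
    then obtain k where k: "a < lower_const (e k) * (LINT p|lborel. glow (e k) p)"
      using order_tendstoD(1)[OF clowl] eventually_happens'[OF sequentially_bot] by blast
    obtain \<delta> where \<delta>: "\<delta> > 0" "\<And>\<eta>. \<eta> > 0 \<Longrightarrow> \<forall>\<^sub>F u in at_top. lower_const (e k) * (LINT p|lborel. lower_integrand (e k) \<delta> u p) - \<eta> \<le> ratio u"
      using ratio_lower[OF e] by blast
    define \<eta> where "\<eta> = (lower_const (e k) * (LINT p|lborel. glow (e k) p) - a) / 2"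
    have \<eta>: "0 < \<eta>" using k by (simp add: \<eta>_def)
    have "((\<lambda>u. lower_const (e k) * (LINT p|lborel. lower_integrand (e k) \<delta> u p)) \<longlongrightarrow> lower_const (e k) * (LINT p|lborel. glow (e k) p)) at_top"
      by (intro tendsto_mult tendsto_const lower_integrand_lim e \<delta>(1))
    from order_tendstoD(1)[OF this, of "a + \<eta>"]
    have "\<forall>\<^sub>F u in at_top. a + \<eta> < lower_const (e k) * (LINT p|lborel. lower_integrand (e k) \<delta> u p)" using k by (simp add: \<eta>_def field_simps)
    with \<delta>(2)[OF \<eta>] show "\<forall>\<^sub>F u in at_top. a < ratio u" by eventually_elim linarith
  next
    fix a assume "T < a"
    then obtain k where k: "upper_const (e k) * (LINT p|lborel. gup (e k) p) < a"
      using order_tendstoD(2)[OF cupl] eventually_happens'[OF sequentially_bot] by blast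
    define \<eta> where "\<eta> = (a - upper_const (e k) * (LINT p|lborel. gup (e k) p)) / 2"
    have \<eta>: "0 < \<eta>" using k by (simp add: \<eta>_def)
    have "((\<lambda>u. upper_const (e k) * (LINT p|lborel. upper_integrand (e k) u p)) \<longlongrightarrow> upper_const (e k) * (LINT p|lborel. gup (e k) p)) at_top"
      by (intro tendsto_mult tendsto_const upper_integrand_lim e)
    from order_tendstoD(2)[OF this, of "a - \<eta>"]
    have "\<forall>\<^sub>F u in at_top. upper_const (e k) * (LINT p|lborel. upper_integrand (e k) u p) < a - \<eta>" using k by (simp add: \<eta>_def field_simps)
    with ratio_upper[OF e \<eta>, of k] show "\<forall>\<^sub>F u in at_top. ratio u < a" by eventually_elim linarith
  qed
  then show ?thesis by (simp add: T_def L_def)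
qed

end

section \<open>The three tail estimates\<close>

context field_on_set
begin

lemma sup_exceeds_iff:
  assumes \<omega>: "\<omega> \<in> space M"
  shows "u < (SUP t\<in>S. X t \<omega>) \<longleftrightarrow> (\<exists>s\<in>S. u < X s \<omega>)"
proof -
  have "compact ((\<lambda>t. X t \<omega>) ` cball 0 r)"
    by (intro compact_continuous_image continuous_on_subset[OF continuous_paths(1)[OF \<omega>]] compact_cball) simp
  then have "bdd_above ((\<lambda>t. X t \<omega>) ` cball 0 r)" by (intro bounded_imp_bdd_above compact_imp_bounded)
  then have "bdd_above ((\<lambda>t. X t \<omega>) ` S)" by (rule bdd_above_mono) (use S(2) in blast)
  then show ?thesis by (rule less_cSUP_iff[OF S(1)])
qed

lemma sup_event: "{\<omega>\<in>space M. (SUP t\<in>S. X t \<omega>) > u} = exceed u"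
  unfolding exceed_def using sup_exceeds_iff by blast

lemma prob_ratio: "0 < u \<Longrightarrow> prob (exceed u) = ratio u * rate u"
  using rate_pos[of u] by (simp add: ratio_def)

lemma rate_powr:
  fixes d :: real
  assumes u: "0 < u"
  shows "rate u = vol (1 / u) / (1 / u) powr (CARD('n) - d) * (u powr (d - 1) * std_normal_density u)"
proof -
  have "u powr (real CARD('n) - d) * u powr (d - 1) = u powr (real CARD('n) - 1)" by (simp flip: powr_add)
  also have "\<dots> = u ^ CARD('n) / u" using u by (simp add: powr_diff powr_realpow)
  finally have 1: "u ^ CARD('n) / u = u powr (real CARD('n) - d) * u powr (d - 1)" ..
  have 2: "vol (1 / u) / (1 / u) powr (CARD('n) - d) = vol (1 / u) * u powr (CARD('n) - d)"
    using u by (simp add: powr_divide)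
  show ?thesis unfolding rate_def 1 2 by simp
qed

lemma filterlim_shrink: "0 < (a::real) \<Longrightarrow> filterlim (\<lambda>u. a / u) (at_right 0) at_top"
  by real_asymp

text \<open>The exponent \<open>m = n - d\<close> is nonnegative because tube volumes stay bounded as the radius shrinks; then \<open>ratio_tendsto\<close> applies.\<close>

theorem strong_tail:
  assumes "minkowski_measurable_strong S d C"
  shows "(\<lambda>u. prob (exceed u)) \<sim>[at_top]
     (\<lambda>u. C / (2 powr (d / 2) * pi powr (real CARD('n) / 2)) * Gamma (1 + (real CARD('n) - d) / 2)
        * u powr (d - 1) * std_normal_density u)"
proof -
  define n where "n = real CARD('n)"
  define m where "m = n - d"
  define q where "q = (\<lambda>e. vol e / e powr m)"
  have C: "0 < C" and as: "vol \<sim>[at_right 0] (\<lambda>e. C * e powr m)"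
    using assms by (simp_all add: minkowski_measurable_strong_def vol_def[abs_def] m_def n_def)
  have "((\<lambda>e. vol e / (C * e powr m)) \<longlongrightarrow> 1) (at_right 0)"
  proof (rule asymp_equivD_strong[OF as])
    show "\<forall>\<^sub>F e in at_right 0. vol e \<noteq> 0 \<or> C * e powr m \<noteq> 0"
      using eventually_at_right_less[of "0::real"] by eventually_elim (use vol_pos in force)
  qed
  from tendsto_mult[OF this tendsto_const[of C]]
  have q: "(q \<longlongrightarrow> C) (at_right 0)" using C by (simp add: q_def)
  have m: "0 \<le> m"
  proof (rule ccontr)
    assume "\<not> 0 \<le> m"
    then have "filterlim (\<lambda>e::real. e powr m) at_top (at_right 0)" by real_asymp
    then have "\<forall>\<^sub>F e in at_right 0. 2 * vol 1 / C + 1 \<le> e powr m" by (simp add: filterlim_at_top)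
    moreover have "\<forall>\<^sub>F e in at_right 0. C / 2 < q e" using order_tendstoD(1)[OF q, of "C / 2"] C by simp
    moreover have "\<forall>\<^sub>F e in at_right (0::real). e < 1" by (rule eventually_at_right_real[OF zero_less_one, THEN eventually_mono]) simp
    ultimately have "\<forall>\<^sub>F e in at_right (0::real). False"
      using eventually_at_right_less[of "0::real"]
    proof eventually_elim
      case (elim e)
      have "C / 2 * (2 * vol 1 / C + 1) \<le> q e * e powr m" using elim C by (intro mult_mono) (auto simp: vol_nonneg)
      also have "\<dots> = vol e" using elim by (simp add: q_def)
      also have "\<dots> \<le> vol 1" using elim by (intro monoD[OF vol_mono]) simp
      finally have "C / 2 * (2 * vol 1 / C + 1) \<le> vol 1" .
      moreover have "C / 2 * (2 * vol 1 / C + 1) = vol 1 + C / 2" using C by (simp add: field_simps)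
      ultimately show False using C by linarith
    qed
    then show False by simp
  qed
  have q_at: "((\<lambda>u. q (a / u)) \<longlongrightarrow> C) at_top" if "0 < a" for a
    by (rule filterlim_compose[OF q filterlim_shrink[OF that]])
  have wl: "((\<lambda>u. rel_vol u a) \<longlongrightarrow> a powr m) at_top" if a: "0 < a" for a
  proof -
    have "((\<lambda>u. q (a / u) / q (1 / u) * a powr m) \<longlongrightarrow> C / C * a powr m) at_top"
      using C by (intro tendsto_intros q_at a) auto
    moreover have "\<forall>\<^sub>F u in at_top. q (a / u) / q (1 / u) * a powr m = rel_vol u a"
      using eventually_gt_at_top[of "0::real"] by eventually_elim (use a in \<open>simp add: q_def rel_vol_def powr_divide\<close>)
    ultimately show ?thesis using C by (auto intro: Lim_transform_eventually)
  qed
  define T where "T = (1 / sqrt (2 * pi)) ^ CARD('n) * (2 powr (m / 2) * Gamma (1 + m / 2))"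
  have r: "(ratio \<longlongrightarrow> T) at_top" unfolding T_def by (rule ratio_tendsto[OF m wl])
  have T: "0 < T" using m by (auto simp: T_def intro!: mult_pos_pos Gamma_real_pos)
  have coef: "C / (2 powr (d / 2) * pi powr (real CARD('n) / 2)) * Gamma (1 + (real CARD('n) - d) / 2) = C * T"
  proof -
    have "(1 / sqrt (2 * pi)) ^ CARD('n) = (2 * pi) powr (- n / 2)"
      by (simp add: n_def powr_half_sqrt[symmetric] powr_realpow[symmetric] powr_powr powr_minus_divide power_one_over powr_divide)
    also have "\<dots> = 2 powr (- n / 2) * pi powr (- n / 2)" by (simp add: powr_mult)
    finally have "T = (2 powr (- n / 2) * 2 powr (m / 2)) * pi powr (- n / 2) * Gamma (1 + m / 2)" by (simp add: T_def)
    also have "2 powr (- n / 2) * 2 powr (m / 2) = 2 powr (- (d / 2))" by (simp add: m_def diff_divide_distrib flip: powr_add)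
    finally show ?thesis by (simp add: powr_minus_divide m_def n_def)
  qed
  have "((\<lambda>u. ratio u * q (1 / u) / (C * T)) \<longlongrightarrow> T * C / (C * T)) at_top"
    using C T by (intro tendsto_intros r q_at) auto
  then have lim: "((\<lambda>u. ratio u * q (1 / u) / (C * T)) \<longlongrightarrow> 1) at_top" using C T by simp
  have "\<forall>\<^sub>F u in at_top. ratio u * q (1 / u) / (C * T) = prob (exceed u) / (C * T * u powr (d - 1) * std_normal_density u)"
    using eventually_gt_at_top[of "0::real"]
  proof eventually_elim
    case (elim u)
    define g where "g = u powr (d - 1) * std_normal_density u"
    have g: "0 < g" using elim by (simp add: g_def std_normal_density_def)
    have eq: "rate u = q (1 / u) * g" using rate_powr[OF elim, of d] by (simp add: q_def m_def n_def g_def)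
    have eq': "C * T * u powr (d - 1) * std_normal_density u = C * T * g" by (simp add: g_def)
    show ?case unfolding prob_ratio[OF elim] eq eq' using g by simp
  qed
  then have "((\<lambda>u. prob (exceed u) / (C * T * u powr (d - 1) * std_normal_density u)) \<longlongrightarrow> 1) at_top"
    by (rule Lim_transform_eventually[OF lim])
  then show ?thesis unfolding coef by (rule asymp_equivI')
qed

theorem weak_tail:
  assumes "minkowski_measurable_weak S d"
  shows "same_order at_top (\<lambda>u. prob (exceed u)) (\<lambda>u. u powr (d - 1) * std_normal_density u)"
proof -
  obtain c where c: "0 < c" and ev: "\<forall>\<^sub>F e in at_right 0. 1 / c \<le> vol e / e powr (real CARD('n) - d) \<and> vol e / e powr (real CARD('n) - d) \<le> c"
    using assms unfolding minkowski_measurable_weak_def same_order_def vol_def by blast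
  obtain a b where ab: "0 < a" "0 < b" and r: "\<forall>\<^sub>F u in at_top. a \<le> ratio u \<and> ratio u \<le> b" using ratio_bounded by blast
  have ev': "\<forall>\<^sub>F u in at_top. 1 / c \<le> vol (1 / u) / (1 / u) powr (real CARD('n) - d) \<and> vol (1 / u) / (1 / u) powr (real CARD('n) - d) \<le> c"
    by (rule eventually_compose_filterlim[OF ev filterlim_shrink[OF zero_less_one]])
  define k where "k = max (c / a) (b * c)"
  have k: "0 < k" using ab c by (simp add: k_def less_max_iff_disj)
  have "1 / k \<le> 1 / (c / a)" using ab c k by (intro divide_left_mono mult_pos_pos) (auto simp: k_def)
  then have k1: "1 / k \<le> a * (1 / c)" by simp
  show ?thesis
    unfolding same_order_def
  proof (rule exI[of _ k], rule conjI[OF k])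
    show "\<forall>\<^sub>F u in at_top. 1 / k \<le> prob (exceed u) / (u powr (d - 1) * std_normal_density u) \<and>
       prob (exceed u) / (u powr (d - 1) * std_normal_density u) \<le> k"
      using ev' r eventually_gt_at_top[of "0::real"]
    proof eventually_elim
      case (elim u)
      define q where "q = vol (1 / u) / (1 / u) powr (real CARD('n) - d)"
      define g where "g = u powr (d - 1) * std_normal_density u"
      have "0 < g" using elim by (simp add: g_def std_normal_density_def)
      moreover have "rate u = q * g" unfolding q_def g_def by (rule rate_powr[OF elim(3)])
      ultimately have e: "prob (exceed u) / (u powr (d - 1) * std_normal_density u) = ratio u * q"
        by (simp add: prob_ratio[OF elim(3)] flip: g_def)
      have "a * (1 / c) \<le> ratio u * q" using elim ab c by (intro mult_mono) (auto simp: q_def)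
      moreover have "ratio u * q \<le> b * c" using elim ab c
        by (intro mult_mono) (auto simp: q_def vol_nonneg)
      ultimately show ?case using k1 unfolding e by (simp add: k_def)
    qed
  qed
qed

theorem dimension_tail:
  assumes "has_minkowski_dim S d"
  shows "\<exists>h. (h \<longlongrightarrow> 0) at_top \<and>
     (\<forall>\<^sub>F u in at_top. ln (prob (exceed u)) = - (1/2) * u\<^sup>2 + (d - 1 + h u) * ln u)"
proof -
  define n where "n = real CARD('n)"
  obtain L where L: "((\<lambda>e. ln (vol e) / ln e) \<longlongrightarrow> L) (at_right 0)" and d: "d = n - L"
    using assms unfolding has_minkowski_dim_def vol_def n_def by blast
  obtain a b where ab: "0 < a" "0 < b" and r: "\<forall>\<^sub>F u in at_top. a \<le> ratio u \<and> ratio u \<le> b" using ratio_bounded by blast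
  define h where "h = (\<lambda>u. (ln (prob (exceed u)) + u\<^sup>2 / 2) / ln u - (d - 1))"
  have L': "((\<lambda>u. ln (vol (1 / u)) / ln (1 / u)) \<longlongrightarrow> L) at_top"
    by (rule filterlim_compose[OF L filterlim_shrink[OF zero_less_one]])
  have ln_top: "filterlim (\<lambda>u::real. ln u) at_top at_top" by (rule ln_at_top)
  have small: "((\<lambda>u. c / ln u) \<longlongrightarrow> 0) at_top" for c :: real
    by (rule tendsto_divide_0[OF tendsto_const filterlim_at_top_imp_at_infinity[OF ln_top]])
  have lr: "((\<lambda>u. ln (ratio u) / ln u) \<longlongrightarrow> 0) at_top"
  proof (rule tendsto_sandwich[OF _ _ small[of "ln a"] small[of "ln b"]])
    show "\<forall>\<^sub>F u in at_top. ln a / ln u \<le> ln (ratio u) / ln u"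
      using r eventually_gt_at_top[of "1::real"]
      by eventually_elim (use ab in \<open>auto intro!: divide_right_mono\<close>)
    show "\<forall>\<^sub>F u in at_top. ln (ratio u) / ln u \<le> ln b / ln u"
      using r eventually_gt_at_top[of "1::real"]
      by eventually_elim (use ab in \<open>auto intro!: divide_right_mono\<close>)
  qed
  have "((\<lambda>u. ln (ratio u) / ln u - ln (sqrt (2 * pi)) / ln u + (n - 1) - ln (vol (1 / u)) / ln (1 / u) - (d - 1))
     \<longlongrightarrow> 0 - 0 + (n - 1) - L - (d - 1)) at_top"
    by (intro tendsto_intros lr small L')
  moreover have "\<forall>\<^sub>F u in at_top. ln (ratio u) / ln u - ln (sqrt (2 * pi)) / ln u + (n - 1) - ln (vol (1 / u)) / ln (1 / u) - (d - 1) = h u"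
    using r eventually_gt_at_top[of "1::real"]
  proof eventually_elim
    case (elim u)
    have u: "0 < u" using elim by simp
    have v: "0 < vol (1 / u)" using u by (intro vol_pos) simp
    have rp: "0 < ratio u" using elim ab by linarith
    have lnu: "0 < ln u" using elim by simp
    have "ln (prob (exceed u)) = ln (ratio u) + ln (rate u)"
      unfolding prob_ratio[OF u] using rp rate_pos[OF u] by (simp add: ln_mult)
    also have "ln (rate u) = (n - 1) * ln u - ln (sqrt (2 * pi)) - u\<^sup>2 / 2 + ln (vol (1 / u))"
    proof -
      have "rate u = u ^ CARD('n) / u * (1 / sqrt (2 * pi) * exp (- u\<^sup>2 / 2)) * vol (1 / u)"
        by (simp add: rate_def std_normal_density_def)
      also have "ln \<dots> = ln (u ^ CARD('n) / u) + ln (1 / sqrt (2 * pi) * exp (- u\<^sup>2 / 2)) + ln (vol (1 / u))"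
      proof -
        have "ln (x * y * z) = ln x + ln y + ln z" if "0 < x" "0 < y" "0 < z" for x y z :: real
          using that by (simp add: ln_mult)
        moreover have "0 < u ^ CARD('n) / u" "0 < 1 / sqrt (2 * pi) * exp (- u\<^sup>2 / 2)" using u by simp_all
        ultimately show ?thesis using v by blast
      qed
      also have "ln (u ^ CARD('n) / u) = (n - 1) * ln u" using u by (simp add: ln_div ln_realpow n_def algebra_simps)
      also have "ln (1 / sqrt (2 * pi) * exp (- u\<^sup>2 / 2)) = - ln (sqrt (2 * pi)) - u\<^sup>2 / 2"
        by (subst ln_mult) (simp_all add: ln_div)
      finally show ?thesis by simp
    qed
    finally have e: "ln (prob (exceed u)) + u\<^sup>2 / 2 = ln (ratio u) - ln (sqrt (2 * pi)) + (n - 1) * ln u + ln (vol (1 / u))" by simp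
    have "ln (1 / u) = - ln u" using u by (simp add: ln_div)
    then show ?case using lnu unfolding h_def e by (simp add: add_divide_distrib diff_divide_distrib)
  qed
  ultimately have "(h \<longlongrightarrow> 0 - 0 + (n - 1) - L - (d - 1)) at_top" by (rule Lim_transform_eventually)
  then have "(h \<longlongrightarrow> 0) at_top" by (simp add: d)
  moreover have "\<forall>\<^sub>F u in at_top. ln (prob (exceed u)) = - (1/2) * u\<^sup>2 + (d - 1 + h u) * ln u"
    using eventually_gt_at_top[of "1::real"] by eventually_elim (simp add: h_def)
  ultimately show ?thesis by blast
qed

end

text \<open>The point \<open>r / (r + 1) * t\<close> of the smaller ball is within distance \<open>1\<close> of \<open>t\<close>.\<close>

lemma cball_subset_tube:
  fixes r :: real
  assumes "0 < r"
  shows "cball (0::real^'n) (r + 1) \<subseteq> tube 1 (cball 0 r)"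
proof
  fix t :: "real^'n" assume t: "t \<in> cball 0 (r + 1)"
  define s where "s = (r / (r + 1)) *\<^sub>R t"
  have "norm s = r / (r + 1) * norm t" using assms by (simp add: s_def)
  also have "\<dots> \<le> r / (r + 1) * (r + 1)" using t assms by (intro mult_left_mono) auto
  finally have s: "s \<in> cball 0 r" using assms by simp
  have "t - s = (1 / (r + 1)) *\<^sub>R t"
    using assms by (simp add: s_def field_simps flip: scaleR_left_diff_distrib) (simp add: algebra_simps add_divide_distrib[symmetric] flip: scaleR_left.add)
  then have "dist t s = norm t / (r + 1)" using assms by (simp add: dist_norm)
  also have "\<dots> \<le> 1" using t assms by simp
  finally show "t \<in> tube 1 (cball 0 r)" using infdist_le[OF s, of t] by (simp add: tube_def)
qed

theorem theorem1:
  fixes M :: "'w measure"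
    and X :: "real^'n \<Rightarrow> 'w \<Rightarrow> real"
    and S Bt B :: "(real^'n) set"
    and r :: real
  assumes "prob_space M"
    and "S \<noteq> {}" and "bounded S"
    and "0 < r" and "Bt = cball 0 r" and "S \<subseteq> Bt" and "B = tube 1 Bt"
    and "gaussian_field M X" and "centered_field M X" and "stationary_field M X"
    and "\<forall>\<omega>\<in>space M. class_C 3 (\<lambda>t. X t \<omega>)"
    and "\<forall>s\<in>B. \<forall>t\<in>B. s \<noteq> t \<longrightarrow>
           nondegenerate_distr M
             (\<lambda>\<omega>. (X s \<omega>, X t \<omega>, gradient (\<lambda>t. X t \<omega>) s, gradient (\<lambda>t. X t \<omega>) t))"
    and "\<forall>v\<in>sphere 0 1.
           nondegenerate_distr M
             (\<lambda>\<omega>. (X 0 \<omega>, gradient (\<lambda>t. X t \<omega>) 0, hessian (\<lambda>t. X t \<omega>) 0 *v v))"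
    and "\<forall>t. (\<integral>\<omega>. (X t \<omega> - (\<integral>\<omega>'. X t \<omega>' \<partial>M))\<^sup>2 \<partial>M) = 1"
    and "\<forall>t. variance_matrix M (\<lambda>\<omega>. gradient (\<lambda>t. X t \<omega>) t) = mat 1"
  defines "P \<equiv> \<lambda>u::real. measure M {\<omega> \<in> space M. (SUP t\<in>S. X t \<omega>) > u}"
  shows "(\<forall>d C. minkowski_measurable_strong S d C \<longrightarrow>
            P \<sim>[at_top]
              (\<lambda>u. C / (2 powr (d / 2) * pi powr (real CARD('n) / 2))
                     * Gamma (1 + (real CARD('n) - d) / 2)
                     * u powr (d - 1) * std_normal_density u)) \<and>
         (\<forall>d. minkowski_measurable_weak S d \<longrightarrow>
            same_order at_top P (\<lambda>u. u powr (d - 1) * std_normal_density u)) \<and>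
         (\<forall>d. has_minkowski_dim S d \<longrightarrow>
            (\<exists>h. (h \<longlongrightarrow> 0) at_top \<and>
               (\<forall>\<^sub>F u in at_top. ln (P u) = - (1/2) * u\<^sup>2 + (d - 1 + h u) * ln u)))"
proof -
  interpret smooth_gaussian_field M X
    by (intro smooth_gaussian_field.intro smooth_gaussian_field_axioms.intro assms(1,8-11,14,15))
  interpret field_on_set M X r S
  proof unfold_locales
    show "compact (cball (0::real^'n) (r + 1))" "convex (cball (0::real^'n) (r + 1))" by simp_all
    show "cball (0::real^'n) (r + 1) \<noteq> {}" using \<open>0 < r\<close> by simp
    show "S \<noteq> {}" "S \<subseteq> cball 0 r" using assms(2,5,6) by simp_all
    fix s t :: "real^'n" assume "s \<in> cball 0 (r + 1)" "t \<in> cball 0 (r + 1)" "s \<noteq> t"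
    moreover have "cball 0 (r + 1) \<subseteq> B" using cball_subset_tube[OF \<open>0 < r\<close>] assms(5,7) by simp
    ultimately show "expectation (\<lambda>\<omega>. (X s \<omega> + X t \<omega>)\<^sup>2) < 4"
      using assms(12) by (intro variance_sum_less_4) blast
  qed
  have P: "P = (\<lambda>u. prob (exceed u))" unfolding P_def sup_event ..
  show ?thesis unfolding P using strong_tail weak_tail dimension_tail by blast
qed

end
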